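(* Consider the one-term model under the deterministic scheme along a sequence with $M+N\to\infty$, and assume: (A1) $\frac{m_0+n_0}{\ln\ln(MN)}\to\infty$ and $\frac{m_0^\dagger+n_0^\dagger}{\ln\ln(MN)}\to\infty$; (A2) $\bm E$ has i.i.d. standard normal entries; (A3) $$\lim \frac{2^{(M+N)/2}}{2^{(m_0+n_0)/2}+2^{(m_0^\dagger+n_0^\dagger)/2}}\cdot\frac{\lambda}{\sigma}\cdot\psi=\infty\quad\text{and}\quad \lim 2^{(M+N)/4}\cdot\frac{\lambda}{\sigma}\cdot\psi^2=\infty.$$ If $$\kappa\ge 2\ln 2\quad\text{and}\quad \kappa=o\left(\frac{2^{M+N}\ln(1+(\lambda/\sigma)^2\psi^2)}{2^{m_0+n_0}+2^{m_0^\dagger+n_0^\dagger}}\right),$$ then $$\min_{(m,n)\in\mathcal W}\mathbb E[\mathrm{IC}_\kappa(m,n)]-\mathbb E[\mathrm{IC}_\kappa(m_0,n_0)]\ge 2^{M+N}\ln[1+(\lambda/\sigma)^2\psi^2]\,(1+o(1)).$$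
   Context: Model: $\bm Y=\lambda\bm A\otimes\bm B+\sigma 2^{-(M+N)/2}\bm E$ ($2^M\times 2^N$), $\lambda>0,\sigma>0$, $\bm A$ is $2^{m_0}\times 2^{n_0}$, $\bm B$ is $2^{M-m_0}\times 2^{N-n_0}$, $\|\bm A\|_F=\|\bm B\|_F=1$; deterministic scheme means $\lambda,\bm A,\bm B$ non-random. $m_0^\dagger=M-m_0$, $n_0^\dagger=N-n_0$. All quantities, including $\kappa\ge0$, may depend on the index of the sequence; limits and $o(\cdot)$ are along it. For a sequence $a_k$, "$a_k\ge o(1)$" means $\max\{-a_k,0\}=o(1)$; the displayed inequality is understood in this sense. Vectorization $\mathrm{vec}$ stacks rows; rearrangement: for a $2^a\times 2^b$ matrix $\bm C$ and $0\le m\le a,0\le n\le b$, view $\bm C$ as a $2^m\times 2^n$ array of $2^{a-m}\times 2^{b-n}$ blocks $\bm C_{i,j}$; $\mathcal R_{m,n}[\bm C]$ is the $2^{m+n}\times 2^{a+b-m-n}$ matrix with rows $\mathrm{vec}(\bm C_{i,j})'$ in row-major order of $(i,j)$. Fit under configuration $(m,n)$: $\hat\lambda=\|\mathcal R_{m,n}[\bm Y]\|_S$, $\hat{\bm A}=\mathrm{vec}^{-1}(u_1)$, $\hat{\bm B}=\mathrm{vec}^{-1}(v_1)$ with $u_1,v_1$ leading singular vectors of $\mathcal R_{m,n}[\bm Y]$, and $\hat{\bm Y}^{(m,n)}=\hat\lambda\hat{\bm A}\otimes\hat{\bm B}$. Information criterion: $\mathrm{IC}_\kappa(m,n)=2^{M+N}\ln\|\bm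 Y-\hat{\bm Y}^{(m,n)}\|_F^2+\kappa(2^{m+n}+2^{M+N-m-n})$. Candidate set $\mathcal C=\{0,\dots,M\}\times\{0,\dots,N\}\setminus\{(0,0),(M,N)\}$; wrong configurations $\mathcal W=\mathcal C\setminus\{(m_0,n_0)\}$. Representation gap: $\phi=\max_{(m,n)\in\mathcal W}\|\mathcal R_{m,n}[\bm A\otimes\bm B]\|_S$, $\psi^2=1-\phi^2$, $\psi\ge 0$. *)

theory Defs
  imports "HOL-Probability.Probability" "HOL-Library.Landau_Symbols"
begin

text \<open>Matrices are functions nat => nat => real with explicit dimensions;
vectors are functions nat => real with explicit length.\<close>

definition vnorm :: "nat \<Rightarrow> (nat \<Rightarrow> real) \<Rightarrow> real" where
  "vnorm c x = sqrt (\<Sum>j<c. (x j)\<^sup>2)"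

definition frob :: "nat \<Rightarrow> nat \<Rightarrow> (nat \<Rightarrow> nat \<Rightarrow> real) \<Rightarrow> real" where
  "frob r c C = sqrt (\<Sum>i<r. \<Sum>j<c. (C i j)\<^sup>2)"

definition mvec :: "nat \<Rightarrow> nat \<Rightarrow> (nat \<Rightarrow> nat \<Rightarrow> real) \<Rightarrow> (nat \<Rightarrow> real) \<Rightarrow> nat \<Rightarrow> real" where
  "mvec r c C x = (\<lambda>i. \<Sum>j<c. C i j * x j)"

definition specnorm :: "nat \<Rightarrow> nat \<Rightarrow> (nat \<Rightarrow> nat \<Rightarrow> real) \<Rightarrow> real" where
  "specnorm r c C = Sup ((\<lambda>x. vnorm r (mvec r c C x)) ` {x. vnorm c x = 1})"

definition kron :: "nat \<Rightarrow> nat \<Rightarrow> (nat \<Rightarrow> nat \<Rightarrow> real) \<Rightarrow> (nat \<Rightarrow> nat \<Rightarrow> real) \<Rightarrow> nat \<Rightarrow> nat \<Rightarrow> real" where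
  "kron p q A B = (\<lambda>i j. A (i div p) (j div q) * B (i mod p) (j mod q))"

text \<open>Rearrangement R_{m,n} of a 2^a x 2^b matrix: row index r = i*2^n + j
(block (i,j), row-major), column index s = k*2^(b-n) + l (row-major vec of the block).\<close>
definition rearr :: "nat \<Rightarrow> nat \<Rightarrow> nat \<Rightarrow> nat \<Rightarrow> (nat \<Rightarrow> nat \<Rightarrow> real) \<Rightarrow> nat \<Rightarrow> nat \<Rightarrow> real" where
  "rearr a b m n C = (\<lambda>r s. C ((r div 2^n) * 2^(a-m) + s div 2^(b-n))
                              ((r mod 2^n) * 2^(b-n) + s mod 2^(b-n)))"

definition leading_sv :: "nat \<Rightarrow> nat \<Rightarrow> (nat \<Rightarrow> nat \<Rightarrow> real) \<Rightarrow> (nat \<Rightarrow> real) \<Rightarrow> (nat \<Rightarrow> real) \<Rightarrow> bool" where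
  "leading_sv r c C u v \<longleftrightarrow> vnorm r u = 1 \<and> vnorm c v = 1 \<and>
     (\<forall>i<r. (\<Sum>j<c. C i j * v j) = specnorm r c C * u i) \<and>
     (\<forall>j<c. (\<Sum>i<r. C i j * u i) = specnorm r c C * v j)"

definition fitY :: "nat \<Rightarrow> nat \<Rightarrow> nat \<Rightarrow> nat \<Rightarrow> (nat \<Rightarrow> nat \<Rightarrow> real) \<Rightarrow> nat \<Rightarrow> nat \<Rightarrow> real" where
  "fitY M N m n Y =
     (let R = rearr M N m n Y; r = 2^(m+n); c = 2^(M+N-m-n);
          lh = specnorm r c R;
          uv = (SOME uv. leading_sv r c R (fst uv) (snd uv));
          Ah = (\<lambda>i j. fst uv (i * 2^n + j));
          Bh = (\<lambda>k l. snd uv (k * 2^(N-n) + l))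
      in (\<lambda>i j. lh * kron (2^(M-m)) (2^(N-n)) Ah Bh i j))"

definition IC :: "nat \<Rightarrow> nat \<Rightarrow> real \<Rightarrow> (nat \<Rightarrow> nat \<Rightarrow> real) \<Rightarrow> nat \<Rightarrow> nat \<Rightarrow> real" where
  "IC M N kap Y m n =
     2^(M+N) * ln ((frob (2^M) (2^N) (\<lambda>i j. Y i j - fitY M N m n Y i j))\<^sup>2)
     + kap * (2^(m+n) + 2^(M+N-m-n))"

definition cands :: "nat \<Rightarrow> nat \<Rightarrow> (nat \<times> nat) set" where
  "cands M N = ({0..M} \<times> {0..N}) - {(0,0), (M,N)}"

definition Ymod :: "nat \<Rightarrow> nat \<Rightarrow> nat \<Rightarrow> nat \<Rightarrow> real \<Rightarrow> real \<Rightarrow> (nat \<Rightarrow> nat \<Rightarrow> real)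
    \<Rightarrow> (nat \<Rightarrow> nat \<Rightarrow> real) \<Rightarrow> (nat \<times> nat \<Rightarrow> real) \<Rightarrow> nat \<Rightarrow> nat \<Rightarrow> real" where
  "Ymod M N m0 n0 lam sig A B E =
     (\<lambda>i j. lam * kron (2^(M-m0)) (2^(N-n0)) A B i j + sig * 2 powr (- real (M+N) / 2) * E (i,j))"

definition gauss_mat :: "nat \<Rightarrow> nat \<Rightarrow> (nat \<times> nat \<Rightarrow> real) measure" where
  "gauss_mat M N = PiM ({..<2^M} \<times> {..<2^N}) (\<lambda>_. density lborel std_normal_density)"

definition EIC :: "nat \<Rightarrow> nat \<Rightarrow> nat \<Rightarrow> nat \<Rightarrow> real \<Rightarrow> real \<Rightarrow> (nat \<Rightarrow> nat \<Rightarrow> real)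
    \<Rightarrow> (nat \<Rightarrow> nat \<Rightarrow> real) \<Rightarrow> real \<Rightarrow> nat \<Rightarrow> nat \<Rightarrow> real" where
  "EIC M N m0 n0 lam sig A B kap m n =
     (\<integral>E. IC M N kap (Ymod M N m0 n0 lam sig A B E) m n \<partial>gauss_mat M N)"

definition phi_gap :: "nat \<Rightarrow> nat \<Rightarrow> nat \<Rightarrow> nat \<Rightarrow> (nat \<Rightarrow> nat \<Rightarrow> real) \<Rightarrow> (nat \<Rightarrow> nat \<Rightarrow> real) \<Rightarrow> real" where
  "phi_gap M N m0 n0 A B =
     Max ((\<lambda>(m,n). specnorm (2^(m+n)) (2^(M+N-m-n))
             (rearr M N m n (kron (2^(M-m0)) (2^(N-n0)) A B))) ` (cands M N - {(m0,n0)}))"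

definition psi_gap :: "nat \<Rightarrow> nat \<Rightarrow> nat \<Rightarrow> nat \<Rightarrow> (nat \<Rightarrow> nat \<Rightarrow> real) \<Rightarrow> (nat \<Rightarrow> nat \<Rightarrow> real) \<Rightarrow> real" where
  "psi_gap M N m0 n0 A B = sqrt (1 - (phi_gap M N m0 n0 A B)\<^sup>2)"

end

theory Submission
  imports Defs
begin

text \<open>Put \<open>s = \<lambda>/\<sigma>\<close>, \<open>D = 2\<^bsup>M+N\<^esup>\<close> and \<open>t = s\<^sup>2\<psi>\<^sup>2\<close>. Up to the factor \<open>\<sigma>\<^sup>2\<close>, which cancels between
  configurations, the squared residual of a fit is the squared Frobenius norm minus the squared spectral
  norm of \<open>R = s C + D\<^bsup>-1/2\<^esup> E\<close>, where \<open>C\<close> is the rearranged signal.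

  At the true configuration the residual is at most \<open>\<parallel>E\<parallel>\<^sup>2/D\<close>, whose logarithm has nonpositive mean; only
  the penalty is left, and it is negligible by the upper bound on \<open>\<kappa>\<close>.

  At a wrong configuration let \<open>n\<close> be the smaller dimension of \<open>R\<close>. Comparing the quadratic form
  \<open>\<parallel>R'u\<parallel>\<^sup>2\<close> with its values on a net of \<open>e\<^bsup>O(n)\<^esup>\<close> points shows that the residual is at least
  \<open>1 + t - 1/n\<close> up to an error of mean \<open>O(s D\<^bsup>-1/4\<^esup> + D\<^bsup>-1/2\<^esup>)\<close>, which is \<open>o(t)\<close> by the second
  signal-to-noise condition. The loss \<open>D ln (1 - 1/n) \<ge> - 2 ln 2 D/n\<close> (with equality for \<open>n = 2\<close>)
  is compensated by the penalty because \<open>\<kappa> \<ge> 2 ln 2\<close>.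

  The logarithm of the residual is controlled near zero by a two-by-two minor \<open>\<Delta>\<close> of \<open>R\<close>: the mean of
  \<open>\<bar>\<Delta>\<bar>\<^bsup>-1/2\<^esup>\<close> is \<open>O(D)\<close>, while the event on which this bound is needed has probability
  exponentially small in \<open>\<surd>D\<close>.\<close>

section \<open>Spectral norm and leading singular vectors\<close>

text \<open>The ratio \<open>t\<close> may tend to zero, so an error \<open>o(1)\<close> in the
  expected logarithm would be useless: each error has to be small against \<open>ln (1 + t)\<close>.
  This forces two estimates of the quadratic noise. One that fails only with probability of order
  \<open>exp (- sqrt D)\<close> is of size \<open>D^(-1/4)\<close> after scaling, which need not be
  \<open>o(t)\<close>; it serves only to keep the residual above half of its centre. There
  \<open>ln\<close> is bounded below by a linear function of the fluctuation, so a second estimate,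
  of the mean of the supremum alone and of size \<open>D^(-1/2)\<close>, can be integrated. The term
  \<open>1/n\<close> is the mean noise energy \<open>Q / D\<close> in a single direction, with
  \<open>Q\<close> the larger dimension. It does not shrink when \<open>n\<close> stays bounded, so
  it belongs to the centre and not to the error. A minor is used near zero because a vanishing
  residual means rank at most one and hence vanishing minors, while a minor is affine in each
  Gaussian entry, so that its negative moment can be bounded one entry at a time.\<close>

definition nsq :: "nat \<Rightarrow> (nat \<Rightarrow> real) \<Rightarrow> real" where
  "nsq c x = (\<Sum>j<c. (x j)\<^sup>2)"

definition fsq :: "nat \<Rightarrow> nat \<Rightarrow> (nat \<Rightarrow> nat \<Rightarrow> real) \<Rightarrow> real" where
  "fsq r c R = (\<Sum>i<r. \<Sum>j<c. (R i j)\<^sup>2)"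

definition trp :: "(nat \<Rightarrow> nat \<Rightarrow> real) \<Rightarrow> nat \<Rightarrow> nat \<Rightarrow> real" where
  "trp R = (\<lambda>j i. R i j)"

lemma nsq_nonneg [simp]: "nsq c x \<ge> 0"
  by (simp add: nsq_def sum_nonneg)

lemma fsq_nonneg [simp]: "fsq r c R \<ge> 0"
  by (simp add: fsq_def sum_nonneg)

lemma vnorm_eq: "vnorm c x = sqrt (nsq c x)"
  by (simp add: vnorm_def nsq_def)

lemma frob_sq: "(frob r c R)\<^sup>2 = fsq r c R"
  by (simp add: frob_def fsq_def sum_nonneg)

lemma vnorm_eq_1_iff: "vnorm c x = 1 \<longleftrightarrow> nsq c x = 1"
  by (simp add: vnorm_eq)

lemma fsq_trp: "fsq c r (trp R) = fsq r c R"
  unfolding fsq_def trp_def by (rule sum.swap)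

lemma trp_trp [simp]: "trp (trp R) = R"
  by (simp add: trp_def)

lemma nsq_eq_0_iff: "nsq c x = 0 \<longleftrightarrow> (\<forall>j<c. x j = 0)"
  by (auto simp: nsq_def sum_nonneg_eq_0_iff)

lemma nsq_scale: "nsq c (\<lambda>j. a * x j) = a\<^sup>2 * nsq c x"
  by (simp add: nsq_def power_mult_distrib sum_distrib_left)

lemma mvec_scale: "mvec r c R (\<lambda>j. a * x j) = (\<lambda>i. a * mvec r c R x i)"
  by (simp add: mvec_def sum_distrib_left algebra_simps)

lemma mvec_add: "mvec r c R (\<lambda>j. x j + y j) = (\<lambda>i. mvec r c R x i + mvec r c R y i)"
  by (simp add: mvec_def sum.distrib algebra_simps)

lemma nsq_add: "nsq c (\<lambda>j. x j + y j) = nsq c x + 2 * (\<Sum>j<c. x j * y j) + nsq c y"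
  by (simp add: nsq_def power2_sum sum.distrib sum_distrib_left algebra_simps)

lemma cauchy_schwarz_nsq: "(\<Sum>j<c. x j * y j)\<^sup>2 \<le> nsq c x * nsq c y"
  unfolding nsq_def by (rule Cauchy_Schwarz_ineq_sum)

lemma cauchy_schwarz_vnorm: "\<bar>\<Sum>j<c. x j * y j\<bar> \<le> sqrt (nsq c x) * sqrt (nsq c y)"
  by (metis cauchy_schwarz_nsq real_sqrt_abs real_sqrt_le_iff real_sqrt_mult)

lemma nsq_mvec_le_fsq: "nsq r (mvec r c R x) \<le> fsq r c R * nsq c x"
proof -
  have "nsq r (mvec r c R x) \<le> (\<Sum>i<r. nsq c (R i) * nsq c x)"
    unfolding nsq_def[of r] mvec_def by (intro sum_mono cauchy_schwarz_nsq)
  then show ?thesis by (simp add: fsq_def nsq_def sum_distrib_right)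
qed

text \<open>Vectors are functions on all of \<open>nat\<close>, so the unit sphere is compact only
  once the values from \<open>c\<close> on are fixed. It is then a closed subset of a product of
  intervals and points, to which Tychonoff's theorem applies.\<close>

lemma compact_unit_sphere:
  "compact {x::nat \<Rightarrow> real. (\<forall>j\<ge>c. x j = 0) \<and> nsq c x = 1}"
proof -
  define K where "K = PiE UNIV (\<lambda>j. if j < c then {-1..1::real} else {0})"
  have "compactin (product_topology (\<lambda>_. euclidean) UNIV) K"
    unfolding K_def by (subst compactin_PiE) auto
  then have K: "compact K"
    by (simp add: euclidean_product_topology)
  have "closed {x::nat \<Rightarrow> real. nsq c x = 1}"
    unfolding nsq_def by (intro closed_Collect_eq continuous_intros) auto
  then have "compact (K \<inter> {x. nsq c x = 1})"
    using K by blast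
  moreover have "K \<inter> {x. nsq c x = 1} = {x. (\<forall>j\<ge>c. x j = 0) \<and> nsq c x = 1}"
  proof safe
    fix x assume x: "\<forall>j\<ge>c. x j = 0" "nsq c x = 1"
    have "x j \<in> (if j < c then {-1..1} else {0})" for j
    proof (cases "j < c")
      case True
      then have "(x j)\<^sup>2 \<le> 1"
        using x(2) member_le_sum[of j "{..<c}" "\<lambda>j. (x j)\<^sup>2"] by (auto simp: nsq_def)
      then have "\<bar>x j\<bar> \<le> 1"
        by (simp add: abs_square_le_1)
      then show ?thesis using True by auto
    qed (use x in auto)
    then show "x \<in> K" by (auto simp: K_def)
  next
    fix x j assume "x \<in> K" "c \<le> j"
    then have "x j \<in> (if j < c then {-1..1::real} else {0})"
      unfolding K_def by blast
    then show "x j = 0" using \<open>c \<le> j\<close> by auto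
  qed
  ultimately show ?thesis by metis
qed

lemma mvec_maximizer:
  assumes "c > 0"
  obtains v where "nsq c v = 1"
    and "\<And>w. nsq c w = 1 \<Longrightarrow> nsq r (mvec r c R w) \<le> nsq r (mvec r c R v)"
proof -
  define S where "S = {x::nat \<Rightarrow> real. (\<forall>j\<ge>c. x j = 0) \<and> nsq c x = 1}"
  have "(\<lambda>j. if j = 0 then 1 else 0) \<in> S"
    using assms by (auto simp: S_def nsq_def if_distrib[of "\<lambda>x. x\<^sup>2"] cong: if_cong)
  then have "S \<noteq> {}" by blast
  moreover have "compact S"
    unfolding S_def by (rule compact_unit_sphere)
  moreover have "continuous_on S (\<lambda>x. nsq r (mvec r c R x))"
    unfolding nsq_def mvec_def
    by (intro continuous_intros continuous_on_subset[OF continuous_on_product_coordinates]) auto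
  ultimately obtain v where v: "v \<in> S" "\<And>w. w \<in> S \<Longrightarrow> nsq r (mvec r c R w) \<le> nsq r (mvec r c R v)"
    using continuous_attains_sup by metis
  show thesis
  proof (rule that)
    show "nsq c v = 1" using v by (simp add: S_def)
    fix w assume w: "nsq c w = 1"
    \<comment> \<open>Coordinates from \<open>c\<close> on do not enter \<open>mvec\<close>, so an
      arbitrary unit vector may be truncated into the compact set.\<close>
    let ?w = "\<lambda>j. if j < c then w j else 0"
    have "?w \<in> S" using w by (auto simp: S_def nsq_def)
    moreover have "mvec r c R ?w = mvec r c R w"
      by (simp add: mvec_def)
    ultimately show "nsq r (mvec r c R w) \<le> nsq r (mvec r c R v)"
      using v(2) by metis
  qed
qed

lemma specnorm_attained:
  assumes "c > 0"
  obtains v where "nsq c v = 1" "specnorm r c R = sqrt (nsq r (mvec r c R v))"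
    "\<And>w. nsq r (mvec r c R w) \<le> nsq r (mvec r c R v) * nsq c w"
proof -
  obtain v where v: "nsq c v = 1"
    "\<And>w. nsq c w = 1 \<Longrightarrow> nsq r (mvec r c R w) \<le> nsq r (mvec r c R v)"
    using mvec_maximizer[OF assms] by metis
  have "specnorm r c R = sqrt (nsq r (mvec r c R v))"
    unfolding specnorm_def by (rule cSup_eq_maximum) (use v in \<open>auto simp: vnorm_eq\<close>)
  moreover have "nsq r (mvec r c R w) \<le> nsq r (mvec r c R v) * nsq c w" for w
  proof (cases "nsq c w = 0")
    case True
    then show ?thesis by (simp add: nsq_eq_0_iff mvec_def) (simp add: nsq_def)
  next
    case False
    define a where "a = inverse (sqrt (nsq c w))"
    have a: "a\<^sup>2 * nsq c w = 1"
      using False by (simp add: a_def power_inverse)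
    have "a\<^sup>2 * nsq r (mvec r c R w) \<le> nsq r (mvec r c R v)"
      using v(2)[of "\<lambda>j. a * w j"] a by (simp add: nsq_scale mvec_scale)
    then have "a\<^sup>2 * nsq r (mvec r c R w) * nsq c w \<le> nsq r (mvec r c R v) * nsq c w"
      by (intro mult_right_mono) auto
    moreover have "a\<^sup>2 * nsq r (mvec r c R w) * nsq c w = nsq r (mvec r c R w)"
      using a by (metis mult.assoc mult.commute mult.right_neutral)
    ultimately show ?thesis by simp
  qed
  ultimately show thesis using that v(1) by blast
qed

lemma specnorm_nonneg:
  assumes "c > 0"
  shows "specnorm r c R \<ge> 0"
  using specnorm_attained[OF assms, of r R] by (metis nsq_nonneg real_sqrt_ge_zero)

lemma nsq_mvec_le_specnorm:
  assumes "c > 0"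
  shows "nsq r (mvec r c R w) \<le> (specnorm r c R)\<^sup>2 * nsq c w"
  using specnorm_attained[OF assms, of r R] by (metis nsq_nonneg real_sqrt_pow2)

lemma specnorm_sq_le_fsq:
  assumes "c > 0"
  shows "(specnorm r c R)\<^sup>2 \<le> fsq r c R"
  using specnorm_attained[OF assms, of r R] nsq_mvec_le_fsq[of r c R]
  by (metis mult.right_neutral nsq_nonneg real_sqrt_pow2)

text \<open>The first-order condition at a maximum: a linear term that stays below a quadratic one
  for both signs of \<open>t\<close> vanishes. The test point is \<open>t = a / d\<close> with a
  positive \<open>d > b\<close>.\<close>

lemma linear_le_quadratic_imp_zero:
  fixes a b :: real
  assumes "\<And>t. 2 * t * a \<le> t\<^sup>2 * b"
  shows "a = 0"
proof (rule ccontr)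
  assume "a \<noteq> 0"
  define d where "d = \<bar>b\<bar> + 1"
  have d: "d > 0" "b < d" by (auto simp: d_def)
  have "2 * (a / d) * a \<le> (a / d)\<^sup>2 * b" by (rule assms)
  also have "\<dots> \<le> (a / d)\<^sup>2 * d" using d by (intro mult_left_mono) auto
  finally have "2 * (a\<^sup>2 / d) \<le> a\<^sup>2 / d" using d by (simp add: power2_eq_square field_simps)
  then show False using d \<open>a \<noteq> 0\<close> by (simp add: field_simps)
qed

text \<open>A maximiser \<open>v\<close> of \<open>|R v|\<close> is perturbed to
  \<open>v + t w\<close>. The first-order condition for every \<open>w\<close> says that
  \<open>v\<close> is an eigenvector of \<open>R' R\<close> with eigenvalue \<open>L^2\<close>, and
  \<open>u = R v / L\<close> completes the pair.\<close>

lemma leading_sv_exists: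
  assumes r: "r > 0" and c: "c > 0"
  shows "\<exists>u v. leading_sv r c R u v"
proof -
  obtain v where v: "nsq c v = 1" "specnorm r c R = sqrt (nsq r (mvec r c R v))"
    and max: "\<And>w. nsq r (mvec r c R w) \<le> nsq r (mvec r c R v) * nsq c w"
    using specnorm_attained[OF c] by metis
  define L where "L = specnorm r c R"
  have L2: "L\<^sup>2 = nsq r (mvec r c R v)" and L0: "L \<ge> 0" by (simp_all add: L_def v)
  have orth: "(\<Sum>i<r. mvec r c R v i * mvec r c R w i) = L\<^sup>2 * (\<Sum>j<c. v j * w j)" for w
  proof -
    have "2 * t * ((\<Sum>i<r. mvec r c R v i * mvec r c R w i) - L\<^sup>2 * (\<Sum>j<c. v j * w j))
        \<le> t\<^sup>2 * (L\<^sup>2 * nsq c w - nsq r (mvec r c R w))" for t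
    proof -
      have "nsq r (mvec r c R (\<lambda>j. v j + t * w j)) \<le> L\<^sup>2 * nsq c (\<lambda>j. v j + t * w j)"
        using max L2 by simp
      then have "L\<^sup>2 + 2 * t * (\<Sum>i<r. mvec r c R v i * mvec r c R w i) + t\<^sup>2 * nsq r (mvec r c R w)
         \<le> L\<^sup>2 * (1 + 2 * t * (\<Sum>j<c. v j * w j) + t\<^sup>2 * nsq c w)"
        by (simp add: mvec_add mvec_scale nsq_add nsq_scale v L2 sum_distrib_left mult.left_commute mult.assoc)
      then show ?thesis by (simp add: algebra_simps)
    qed
    from linear_le_quadratic_imp_zero[OF this] show ?thesis by simp
  qed
  have RtRv: "(\<Sum>i<r. R i j * mvec r c R v i) = L\<^sup>2 * v j" if "j < c" for j
    using orth[of "\<lambda>k. if k = j then 1 else 0"] that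
    by (simp add: mvec_def[of r c R "\<lambda>k. if k = j then 1 else 0"] if_distrib mult.commute cong: if_cong)
  show ?thesis
  proof (cases "L = 0")
    case False
    define u where "u = (\<lambda>i. mvec r c R v i / L)"
    have "nsq r u = 1"
      using nsq_scale[of r "1 / L" "mvec r c R v"] False
      by (simp add: u_def L2[symmetric] power_divide)
    moreover have "(\<Sum>j<c. R i j * v j) = L * u i" for i
      using False by (simp add: u_def mvec_def)
    moreover have "(\<Sum>i<r. R i j * u i) = L * v j" if "j < c" for j
      using RtRv[OF that] False
      by (simp add: u_def sum_divide_distrib[symmetric] power2_eq_square)
    ultimately have "leading_sv r c R u v"
      using v by (simp add: leading_sv_def vnorm_eq_1_iff L_def)
    then show ?thesis by blast
  next
    \<comment> \<open>\<open>L = 0\<close> forces the matrix to vanish on its index range, so any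
      unit \<open>u\<close> will do.\<close>
    case True
    have Z: "R i j = 0" if "i < r" "j < c" for i j
    proof -
      have "nsq r (mvec r c R (\<lambda>k. if k = j then 1 else 0)) \<le> 0"
        using max[of "\<lambda>k. if k = j then 1 else 0"] True L2 by simp
      then have "nsq r (mvec r c R (\<lambda>k. if k = j then 1 else 0)) = 0"
        by (simp add: antisym)
      then show ?thesis using that
        by (simp add: nsq_eq_0_iff mvec_def if_distrib cong: if_cong)
    qed
    have "nsq r (\<lambda>i. if i = 0 then 1 else 0) = 1"
      using r by (simp add: nsq_def if_distrib[of "\<lambda>x. x\<^sup>2"] cong: if_cong)
    then have "leading_sv r c R (\<lambda>i. if i = 0 then 1 else 0) v"
      using v True Z by (simp add: leading_sv_def vnorm_eq_1_iff L_def)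
    then show ?thesis by blast
  qed
qed

lemma leading_sv_mvec:
  assumes "leading_sv r c R u v"
  shows "nsq r u = 1" "nsq c v = 1"
    and "nsq r (mvec r c R v) = (specnorm r c R)\<^sup>2"
    and "nsq c (mvec c r (trp R) u) = (specnorm r c R)\<^sup>2"
    and "(\<Sum>i<r. \<Sum>j<c. R i j * (u i * v j)) = specnorm r c R"
proof -
  let ?L = "specnorm r c R"
  have a: "nsq r u = 1" "nsq c v = 1" "\<And>i. i < r \<Longrightarrow> mvec r c R v i = ?L * u i"
    "\<And>j. j < c \<Longrightarrow> mvec c r (trp R) u j = ?L * v j"
    using assms by (auto simp: leading_sv_def vnorm_eq_1_iff mvec_def trp_def)
  then show "nsq r u = 1" "nsq c v = 1" by auto
  have "nsq r (mvec r c R v) = nsq r (\<lambda>i. ?L * u i)"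
    "nsq c (mvec c r (trp R) u) = nsq c (\<lambda>i. ?L * v i)"
    using a by (auto simp: nsq_def)
  then show "nsq r (mvec r c R v) = ?L\<^sup>2" "nsq c (mvec c r (trp R) u) = ?L\<^sup>2"
    using a by (simp_all add: nsq_scale)
  have "(\<Sum>i<r. \<Sum>j<c. R i j * (u i * v j)) = (\<Sum>i<r. u i * mvec r c R v i)"
    by (simp add: mvec_def sum_distrib_left mult.left_commute)
  also have "\<dots> = (\<Sum>i<r. ?L * (u i)\<^sup>2)"
    by (rule sum.cong) (auto simp: a(3) power2_eq_square)
  also have "\<dots> = ?L * nsq r u"
    by (simp add: nsq_def sum_distrib_left)
  finally show "(\<Sum>i<r. \<Sum>j<c. R i j * (u i * v j)) = ?L" using a by simp
qed

lemma fsq_diff_rank_one: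
  assumes "nsq r u = 1" "nsq c v = 1"
  shows "fsq r c (\<lambda>i j. R i j - t * (u i * v j))
    = fsq r c R - 2 * t * (\<Sum>i<r. \<Sum>j<c. R i j * (u i * v j)) + t\<^sup>2"
proof -
  have "(\<Sum>i<r. \<Sum>j<c. (u i * v j)\<^sup>2) = nsq r u * nsq c v"
    by (simp add: nsq_def sum_product power_mult_distrib)
  then have "(\<Sum>i<r. \<Sum>j<c. (t * (u i * v j))\<^sup>2) = t\<^sup>2"
    using assms by (simp add: power_mult_distrib[of t] sum_distrib_left[symmetric])
  then show ?thesis
    by (simp add: fsq_def power2_diff sum.distrib sum_subtractf sum_distrib_left
        mult.assoc mult.left_commute)
qed

lemma bilinear_le_specnorm:
  assumes c: "c > 0" and u: "nsq r u = 1" and v: "nsq c v = 1"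
  shows "(\<Sum>i<r. \<Sum>j<c. R i j * (u i * v j)) \<le> specnorm r c R"
proof -
  have "(\<Sum>i<r. \<Sum>j<c. R i j * (u i * v j)) = (\<Sum>i<r. u i * mvec r c R v i)"
    by (simp add: mvec_def sum_distrib_left mult.left_commute)
  also have "\<dots> \<le> sqrt (nsq r u) * sqrt (nsq r (mvec r c R v))"
    using cauchy_schwarz_vnorm by (rule abs_le_D1)
  also have "\<dots> \<le> sqrt ((specnorm r c R)\<^sup>2 * nsq c v)"
    using u nsq_mvec_le_specnorm[OF c] by simp
  finally show ?thesis using v specnorm_nonneg[OF c] by simp
qed

text \<open>A rank-one fit leaves \<open>|R|^2 - 2 t <R, u v'> + t^2\<close>, and
  \<open>2 t S - t^2 \<le> S^2\<close> for the spectral norm \<open>S\<close>. This half of the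
  Eckart-Young theorem is applied with the true signal as competitor.\<close>

lemma fsq_rank_one_residual_le:
  assumes "c > 0" "nsq r u = 1" "nsq c v = 1" "t \<ge> 0"
  shows "fsq r c R - (specnorm r c R)\<^sup>2 \<le> fsq r c (\<lambda>i j. R i j - t * (u i * v j))"
proof -
  have "t * (\<Sum>i<r. \<Sum>j<c. R i j * (u i * v j)) \<le> t * specnorm r c R"
    using assms by (intro mult_left_mono bilinear_le_specnorm)
  moreover have "0 \<le> (specnorm r c R - t)\<^sup>2" by simp
  ultimately show ?thesis
    unfolding fsq_diff_rank_one[OF assms(2,3)] by (simp add: power2_diff algebra_simps)
qed

lemma fsq_leading_sv_residual:
  assumes "leading_sv r c R u v"
  shows "fsq r c (\<lambda>i j. R i j - specnorm r c R * (u i * v j)) = fsq r c R - (specnorm r c R)\<^sup>2"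
  using leading_sv_mvec[OF assms] by (simp add: fsq_diff_rank_one power2_eq_square)

text \<open>Split each of the first two rows as \<open>a v + w\<close> with \<open>w\<close> orthogonal to \<open>v\<close>; the
  \<open>v\<close>-components contribute nothing to the minor.\<close>

lemma minor_sq_le_residual:
  assumes r: "r \<ge> 2" and c: "c \<ge> 2" and v: "nsq c v = 1"
  shows "(R 0 0 * R 1 1 - R 0 1 * R 1 0)\<^sup>2 \<le> fsq r c R * (fsq r c R - nsq r (mvec r c R v))"
proof -
  define a where "a = mvec r c R v"
  define w where "w i j = R i j - a i * v j" for i j
  have nw: "nsq c (w i) = nsq c (R i) - (a i)\<^sup>2" if "i < r" for i
  proof -
    have "nsq c (w i) = nsq c (R i) - 2 * a i * (\<Sum>j<c. R i j * v j) + (a i)\<^sup>2 * nsq c v"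
      by (simp add: w_def nsq_def power2_diff sum.distrib sum_subtractf sum_distrib_left
        power_mult_distrib mult.assoc mult.left_commute)
    then show ?thesis using that v by (simp add: a_def mvec_def power2_eq_square)
  qed
  have X: "fsq r c R - nsq r (mvec r c R v) = (\<Sum>i<r. nsq c (w i))"
    using nw by (simp add: fsq_def a_def nsq_def sum_subtractf)
  have ge2: "f 0 + f 1 \<le> (\<Sum>i<k. f i)" if "k \<ge> 2" "\<And>i. f i \<ge> 0" for f :: "nat \<Rightarrow> real" and k
    using sum_mono2[of "{..<k}" "{0,1}" f] that by auto
  have CS2: "(x1 * y1 - x2 * y2)\<^sup>2 \<le> (x1\<^sup>2 + x2\<^sup>2) * (y1\<^sup>2 + y2\<^sup>2)" for x1 x2 y1 y2 :: real
    using zero_le_power2[of "x1 * y2 + x2 * y1"] by (simp add: power2_eq_square algebra_simps)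
  have part: "(f 0)\<^sup>2 + (f 1)\<^sup>2 \<le> nsq c f" for f
    unfolding nsq_def by (intro ge2 c) auto
  have part': "(f 1)\<^sup>2 + (f 0)\<^sup>2 \<le> nsq c f" for f
    using part[of f] by simp
  \<comment> \<open>Multilinearity: writing row 1 as \<open>a 1 * v + w 1\<close> splits the
    determinant, and in the part with \<open>v\<close> row 0 may be reduced to \<open>w 0\<close>,
    since two multiples of \<open>v\<close> have determinant zero.\<close>
  define d1 d2 where "d1 = R 0 0 * w 1 1 - R 0 1 * w 1 0" and "d2 = w 0 0 * v 1 - w 0 1 * v 0"
  have det: "R 0 0 * R 1 1 - R 0 1 * R 1 0 = d1 + a 1 * d2"
    unfolding d1_def d2_def w_def by (simp add: algebra_simps)
  have d1: "d1\<^sup>2 \<le> nsq c (R 0) * nsq c (w 1)"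
    unfolding d1_def by (rule order_trans[OF CS2]) (intro mult_mono part part', auto)
  have "(a 1)\<^sup>2 \<le> nsq c (R 1) * nsq c v"
    unfolding a_def mvec_def by (rule cauchy_schwarz_nsq)
  moreover have "d2\<^sup>2 \<le> nsq c (w 0) * nsq c v"
    unfolding d2_def by (rule order_trans[OF CS2]) (intro mult_mono part part', auto)
  ultimately have d2: "(a 1 * d2)\<^sup>2 \<le> nsq c (R 1) * nsq c (w 0)"
    using v by (simp add: power_mult_distrib mult_mono)
  \<comment> \<open>AM-GM gives \<open>2 p q \<le> 2 sqrt (x t * z y) \<le> x t + z y\<close>,
    exactly the mixed terms of the product on the right.\<close>
  have mix: "(p + q)\<^sup>2 \<le> (x + z) * (y + t)"
    if "p\<^sup>2 \<le> x * y" "q\<^sup>2 \<le> z * t" "x \<ge> 0" "y \<ge> 0" "z \<ge> 0" "t \<ge> 0" for p q x y z t :: real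
  proof -
    have "(p * q)\<^sup>2 \<le> (x * y) * (z * t)"
      unfolding power_mult_distrib using that by (intro mult_mono) auto
    also have "4 * \<dots> = (x * t + z * y)\<^sup>2 - (x * t - z * y)\<^sup>2"
      by (simp add: power2_eq_square algebra_simps)
    finally have "(2 * (p * q))\<^sup>2 \<le> (x * t + z * y)\<^sup>2"
      by (simp add: power_mult_distrib) (smt (verit) zero_le_power2)
    then have "2 * (p * q) \<le> x * t + z * y"
      by (rule power2_le_imp_le) (use that in simp)
    then show ?thesis using that by (simp add: power2_sum algebra_simps)
  qed
  have "(R 0 0 * R 1 1 - R 0 1 * R 1 0)\<^sup>2
      \<le> (nsq c (R 0) + nsq c (R 1)) * (nsq c (w 1) + nsq c (w 0))"
    unfolding det using d1 d2 by (intro mix) auto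
  also have "\<dots> \<le> (\<Sum>i<r. nsq c (R i)) * (\<Sum>i<r. nsq c (w i))"
    using ge2[OF r, of "\<lambda>i. nsq c (R i)"] ge2[OF r, of "\<lambda>i. nsq c (w i)"]
    by (intro mult_mono) (auto simp: sum_nonneg)
  finally show ?thesis by (simp add: X) (simp add: fsq_def nsq_def)
qed

section \<open>Rearrangement and the residual of the fit\<close>

lemma sum_nat_mult_split:
  fixes f :: "nat \<Rightarrow> 'a :: comm_monoid_add"
  shows "(\<Sum>r<p * q. f r) = (\<Sum>a<p. \<Sum>b<q. f (a * q + b))"
proof (induction p)
  case (Suc p)
  have "(\<Sum>r<Suc p * q. f r) = (\<Sum>r<p * q. f r) + (\<Sum>r\<in>{p * q..<p * q + q}. f r)"
    by (metis add.commute atLeast0LessThan le_add1 le_add_same_cancel2 mult_Suc sum.atLeastLessThan_concat zero_le)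
  also have "(\<Sum>r\<in>{p * q..<p * q + q}. f r) = (\<Sum>b<q. f (p * q + b))"
    using sum.shift_bounds_nat_ivl[of f 0 "p * q" q] by (simp add: atLeast0LessThan add.commute)
  finally show ?case using Suc by simp
qed simp

text \<open>\<open>pos\<close> sends a row--column index of the rearranged matrix to the position of that entry in
  the original matrix.\<close>

definition pos :: "nat \<Rightarrow> nat \<Rightarrow> nat \<Rightarrow> nat \<Rightarrow> nat \<times> nat \<Rightarrow> nat \<times> nat" where
  "pos M N m n = (\<lambda>(r, s). ((r div 2^n) * 2^(M-m) + s div 2^(N-n), (r mod 2^n) * 2^(N-n) + s mod 2^(N-n)))"

lemma rearr_pos: "rearr M N m n C r s = C (fst (pos M N m n (r, s))) (snd (pos M N m n (r, s)))"
  by (simp add: rearr_def pos_def)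

lemma mult_add_less: "a < p \<Longrightarrow> b < q \<Longrightarrow> a * q + b < p * (q::nat)"
  by (metis add.commute less_le_trans mult_Suc nat_add_left_cancel_less Suc_leI mult_le_mono1)

lemma pow2_split:
  assumes "m \<le> M" "n \<le> N"
  shows "(2::nat) ^ (m + n) * 2 ^ (M + N - m - n) = 2 ^ M * 2 ^ N"
    "(2::nat) ^ M = 2 ^ m * 2 ^ (M - m)" "(2::nat) ^ N = 2 ^ n * 2 ^ (N - n)"
    "(2::nat) ^ (m + n) = 2 ^ m * 2 ^ n" "(2::nat) ^ (M + N - m - n) = 2 ^ (M - m) * 2 ^ (N - n)"
  using assms by (simp_all flip: power_add)

text \<open>The rearrangement merely permutes entries; the inverse recombines quotients and
  remainders in the other order. Frobenius norms are therefore preserved, and so is the law of the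
  noise.\<close>

lemma bij_betw_pos:
  assumes "m \<le> M" "n \<le> N"
  shows "bij_betw (pos M N m n) ({..<2^(m+n)} \<times> {..<2^(M+N-m-n)}) ({..<2^M} \<times> {..<2^N})"
proof (rule bij_betw_byWitness[where f' = "\<lambda>(i::nat, j::nat).
      ((i div 2^(M-m)) * 2^n + j div 2^(N-n), (i mod 2^(M-m)) * 2^(N-n) + j mod 2^(N-n))"])
  note sp = pow2_split[OF assms]
  have sp5: "(2::nat) ^ (M + N - (m + n)) = 2 ^ (M - m) * 2 ^ (N - n)" using sp(5) by simp
  have less: "x div b < a \<and> x mod b < b" if "x < a * b" for x a b :: nat
    using that by (metis less_mult_imp_div_less mod_less_divisor mult_0_right not_less_zero gr0I)
  have A: "(r div 2^n < 2^m \<and> r mod 2^n < 2^n) \<and> s div 2^(N-n) < 2^(M-m) \<and> s mod 2^(N-n) < 2^(N-n)"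
    if "r < 2^(m+n)" "s < 2^(M+N-m-n)" for r s :: nat
    using less[of r "2^m" "2^n"] less[of s "2^(M-m)" "2^(N-n)"] that sp by auto
  have B: "(i div 2^(M-m) < 2^m \<and> i mod 2^(M-m) < 2^(M-m)) \<and> j div 2^(N-n) < 2^n \<and> j mod 2^(N-n) < 2^(N-n)"
    if "i < 2^M" "j < 2^N" for i j :: nat
    using less[of i "2^m" "2^(M-m)"] less[of j "2^n" "2^(N-n)"] that sp by auto
  show "\<forall>a\<in>{..<2 ^ (m + n)} \<times> {..<2 ^ (M + N - m - n)}.
      (case pos M N m n a of (i, j) \<Rightarrow> (i div 2 ^ (M - m) * 2 ^ n + j div 2 ^ (N - n),
         i mod 2 ^ (M - m) * 2 ^ (N - n) + j mod 2 ^ (N - n))) = a"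
    using A by (auto simp: pos_def div_mult_mod_eq)
  show "\<forall>a'\<in>{..<2 ^ M} \<times> {..<2 ^ N}. pos M N m n (case a' of (i, j) \<Rightarrow>
       (i div 2 ^ (M - m) * 2 ^ n + j div 2 ^ (N - n), i mod 2 ^ (M - m) * 2 ^ (N - n) + j mod 2 ^ (N - n))) = a'"
    using B by (auto simp: pos_def div_mult_mod_eq)
  show "pos M N m n ` ({..<2 ^ (m + n)} \<times> {..<2 ^ (M + N - m - n)}) \<subseteq> {..<2 ^ M} \<times> {..<2 ^ N}"
    using A by (auto simp: pos_def sp(2,3) intro!: mult_add_less)
  show "(\<lambda>(i::nat, j::nat). (i div 2 ^ (M - m) * 2 ^ n + j div 2 ^ (N - n), i mod 2 ^ (M - m) * 2 ^ (N - n) + j mod 2 ^ (N - n))) `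
      ({..<2 ^ M} \<times> {..<2 ^ N}) \<subseteq> {..<2 ^ (m + n)} \<times> {..<2 ^ (M + N - m - n)}"
    using B by (auto simp: sp(4) sp5 intro!: mult_add_less)
qed

lemma fsq_rearr:
  assumes "m \<le> M" "n \<le> N"
  shows "fsq (2^(m+n)) (2^(M+N-m-n)) (rearr M N m n C) = fsq (2^M) (2^N) C"
proof -
  have "fsq (2^(m+n)) (2^(M+N-m-n)) (rearr M N m n C)
     = (\<Sum>x\<in>{..<2^(m+n)} \<times> {..<2^(M+N-m-n)}. (\<lambda>y. (C (fst y) (snd y))\<^sup>2) (pos M N m n x))"
    by (simp add: fsq_def sum.cartesian_product rearr_pos split_def)
  also have "\<dots> = (\<Sum>y\<in>{..<2^M} \<times> {..<2^N}. (C (fst y) (snd y))\<^sup>2)"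
    by (rule sum.reindex_bij_betw[OF bij_betw_pos[OF assms]])
  finally show ?thesis by (simp add: fsq_def sum.cartesian_product split_def)
qed

text \<open>In the configuration that matches the block sizes a Kronecker product becomes an outer
  product. This gives rank one to the fit and, at the true configuration, to the signal.\<close>

lemma rearr_kron:
  assumes "m \<le> M" "n \<le> N" "r < 2^(m+n)" "s < 2^(M+N-m-n)"
  shows "rearr M N m n (kron (2^(M-m)) (2^(N-n)) A B) r s
    = A (r div 2^n) (r mod 2^n) * B (s div 2^(N-n)) (s mod 2^(N-n))"
proof -
  have "s < 2^(M-m) * 2^(N-n)" using assms pow2_split(5)[of m M n N] by simp
  then have "s div 2^(N-n) < 2^(M-m)" by (rule less_mult_imp_div_less)
  then show ?thesis by (simp add: rearr_def kron_def)
qed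

lemma nsq_unvec: "nsq (p * q) (\<lambda>r. A (r div q) (r mod q)) = fsq p q A"
proof -
  have "nsq (p * q) (\<lambda>r. A (r div q) (r mod q)) = (\<Sum>a<p. \<Sum>b<q. (A ((a * q + b) div q) ((a * q + b) mod q))\<^sup>2)"
    unfolding nsq_def by (rule sum_nat_mult_split)
  also have "\<dots> = fsq p q A"
    unfolding fsq_def by (intro sum.cong refl) auto
  finally show ?thesis .
qed

lemma fsq_kron:
  assumes "m \<le> M" "n \<le> N" "frob (2^m) (2^n) A = 1" "frob (2^(M-m)) (2^(N-n)) B = 1"
  defines "a \<equiv> \<lambda>r. A (r div 2^n) (r mod 2^n)" and "b \<equiv> \<lambda>s. B (s div 2^(N-n)) (s mod 2^(N-n))"
  shows "fsq (2^M) (2^N) (kron (2^(M-m)) (2^(N-n)) A B) = 1"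
    and "nsq (2^(m+n)) a = 1" and "nsq (2^(M+N-m-n)) b = 1"
proof -
  note sp = pow2_split[OF assms(1,2)]
  show a: "nsq (2^(m+n)) a = 1" and b: "nsq (2^(M+N-m-n)) b = 1"
    unfolding a_def b_def sp(4,5) using assms(3,4)
    by (simp_all add: nsq_unvec flip: frob_sq)
  have "fsq (2^M) (2^N) (kron (2^(M-m)) (2^(N-n)) A B)
     = fsq (2^(m+n)) (2^(M+N-m-n)) (\<lambda>r s. a r * b s)"
    unfolding fsq_rearr[OF assms(1,2), symmetric]
    by (simp add: fsq_def rearr_kron assms(1,2) a_def b_def)
  also have "\<dots> = nsq (2^(m+n)) a * nsq (2^(M+N-m-n)) b"
    by (simp add: fsq_def nsq_def sum_product power_mult_distrib)
  finally show "fsq (2^M) (2^N) (kron (2^(M-m)) (2^(N-n)) A B) = 1" using a b by simp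
qed

text \<open>The sum of the squared singular values except the largest, that is, the squared
  Frobenius distance to the matrices of rank at most one.\<close>

definition resid :: "nat \<Rightarrow> nat \<Rightarrow> (nat \<Rightarrow> nat \<Rightarrow> real) \<Rightarrow> real" where
  "resid r c R = fsq r c R - (specnorm r c R)\<^sup>2"

text \<open>\<open>SOME\<close> picks an actual leading pair by \<open>leading_sv_exists\<close>,
  and every such pair leaves the same residual. The rearrangement is linear and isometric, so the
  computation can be done on the rank-one side.\<close>

lemma frob_diff_fitY:
  assumes "m \<le> M" "n \<le> N"
  shows "(frob (2^M) (2^N) (\<lambda>i j. Y i j - fitY M N m n Y i j))\<^sup>2
    = resid (2^(m+n)) (2^(M+N-m-n)) (rearr M N m n Y)"
proof -
  define R where "R = rearr M N m n Y"
  define r c :: nat where "r = 2^(m+n)" and "c = 2^(M+N-m-n)"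
  define uv where "uv = (SOME uv. leading_sv r c R (fst uv) (snd uv))"
  have "\<exists>uv. leading_sv r c R (fst uv) (snd uv)"
    using leading_sv_exists[of r c R] by (auto simp: r_def c_def)
  then have uv: "leading_sv r c R (fst uv) (snd uv)"
    unfolding uv_def by (rule someI_ex)
  have fit: "rearr M N m n (fitY M N m n Y) i j = specnorm r c R * (fst uv i * snd uv j)"
    if "i < r" "j < c" for i j
  proof -
    have "rearr M N m n (fitY M N m n Y) i j = specnorm r c R *
      rearr M N m n (kron (2^(M-m)) (2^(N-n)) (\<lambda>i j. fst uv (i * 2^n + j)) (\<lambda>k l. snd uv (k * 2^(N-n) + l))) i j"
      by (simp add: fitY_def rearr_def Let_def R_def r_def c_def uv_def)
    also have "\<dots> = specnorm r c R * (fst uv i * snd uv j)"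
      using that unfolding r_def c_def by (subst rearr_kron[OF assms]) (auto simp: div_mult_mod_eq)
    finally show ?thesis .
  qed
  have "(frob (2^M) (2^N) (\<lambda>i j. Y i j - fitY M N m n Y i j))\<^sup>2
    = fsq r c (rearr M N m n (\<lambda>i j. Y i j - fitY M N m n Y i j))"
    unfolding frob_sq r_def c_def fsq_rearr[OF assms] ..
  also have "\<dots> = fsq r c (\<lambda>i j. R i j - specnorm r c R * (fst uv i * snd uv j))"
  proof -
    have "rearr M N m n (\<lambda>i j. Y i j - fitY M N m n Y i j) i j = R i j - rearr M N m n (fitY M N m n Y) i j" for i j
      by (simp add: R_def rearr_def)
    then show ?thesis by (simp add: fsq_def fit)
  qed
  finally show ?thesis
    using fsq_leading_sv_residual[OF uv] by (simp add: resid_def R_def r_def c_def)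
qed

lemma specnorm_cong:
  assumes "\<And>i j. i < r \<Longrightarrow> j < c \<Longrightarrow> R i j = S i j"
  shows "specnorm r c R = specnorm r c S"
proof -
  have "vnorm r (mvec r c R x) = vnorm r (mvec r c S x)" for x
    using assms by (simp add: vnorm_def mvec_def)
  then show ?thesis by (simp add: specnorm_def)
qed

lemma resid_cong:
  assumes "\<And>i j. i < r \<Longrightarrow> j < c \<Longrightarrow> R i j = S i j"
  shows "resid r c R = resid r c S"
  unfolding resid_def fsq_def using specnorm_cong[of r c R S] assms by simp

lemma resid_scale:
  assumes "c > 0"
  shows "resid r c (\<lambda>i j. a * R i j) = a\<^sup>2 * resid r c R"
proof -
  have "(specnorm r c (\<lambda>i j. a * R i j))\<^sup>2 = a\<^sup>2 * (specnorm r c R)\<^sup>2"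
  proof -
    have m: "nsq r (mvec r c (\<lambda>i j. a * R i j) w) = a\<^sup>2 * nsq r (mvec r c R w)" for w
      by (simp add: mvec_def nsq_def power_mult_distrib mult.assoc flip: sum_distrib_left)
    obtain v where v: "nsq c v = 1" "specnorm r c (\<lambda>i j. a * R i j) = sqrt (nsq r (mvec r c (\<lambda>i j. a * R i j) v))"
      using specnorm_attained[OF assms] by metis
    obtain w where w: "nsq c w = 1" "specnorm r c R = sqrt (nsq r (mvec r c R w))"
      using specnorm_attained[OF assms] by metis
    have "a\<^sup>2 * nsq r (mvec r c R v) \<le> a\<^sup>2 * (specnorm r c R)\<^sup>2"
      using nsq_mvec_le_specnorm[OF assms, of r R v] v by (intro mult_left_mono) auto
    moreover have "a\<^sup>2 * (specnorm r c R)\<^sup>2 \<le> (specnorm r c (\<lambda>i j. a * R i j))\<^sup>2"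
      using nsq_mvec_le_specnorm[OF assms, of r "\<lambda>i j. a * R i j" w] w(1)
      by (simp only: m w(2) real_sqrt_pow2[OF nsq_nonneg] mult_1_right)
    moreover have "(specnorm r c (\<lambda>i j. a * R i j))\<^sup>2 = a\<^sup>2 * nsq r (mvec r c R v)"
      using v by (simp add: m)
    ultimately show ?thesis by linarith
  qed
  then show ?thesis
    by (simp add: resid_def fsq_def power_mult_distrib algebra_simps sum_distrib_left)
qed

section \<open>A lattice net of the sphere\<close>

text \<open>Rounding coordinates towards zero does not leave the unit ball, so the lattice points of the ball
  already form a net.\<close>

definition net :: "real \<Rightarrow> nat \<Rightarrow> (nat \<Rightarrow> real) set" where
  "net d n = {v. nsq n v \<le> 1 \<and> (\<exists>k::nat \<Rightarrow> int. v = (\<lambda>i. if i < n then d / sqrt n * k i else 0))}"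

text \<open>A mesh of \<open>d / sqrt n\<close> in each of the \<open>n\<close> coordinates adds up
  to a squared error of at most \<open>d^2\<close>.\<close>

lemma net_approx:
  assumes d: "d > 0" and n: "n > 0" and u: "nsq n u \<le> 1"
  obtains v where "v \<in> net d n" "nsq n (\<lambda>i. u i - v i) \<le> d\<^sup>2"
proof -
  define h where "h = d / sqrt n"
  have h: "h > 0" using d n by (simp add: h_def)
  define k :: "nat \<Rightarrow> int" where "k i = (if u i \<ge> 0 then \<lfloor>u i / h\<rfloor> else \<lceil>u i / h\<rceil>)" for i
  define v where "v = (\<lambda>i. if i < n then h * k i else 0)"
  have v: "\<bar>h * k i\<bar> \<le> \<bar>u i\<bar> \<and> \<bar>u i - h * k i\<bar> \<le> h" for i
  proof (cases "u i \<ge> 0")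
    case True
    have "real_of_int (k i) \<le> u i / h" "u i / h \<le> real_of_int (k i) + 1" "k i \<ge> 0"
      using True h by (simp_all add: k_def)
    then have "h * k i \<le> u i" "u i \<le> h * k i + h" "h * k i \<ge> 0"
      using h by (auto simp: field_simps)
    then show ?thesis using True by auto
  next
    case False
    have "u i / h \<le> real_of_int (k i)" "real_of_int (k i) - 1 \<le> u i / h" "k i \<le> 0"
      using False h ceiling_correct[of "u i / h"] by (simp_all add: k_def divide_nonpos_pos)
    then have "h * k i \<ge> u i" "u i \<ge> h * k i - h" "h * k i \<le> 0"
      using h by (auto simp: field_simps mult_le_0_iff)
    then show ?thesis using False by auto
  qed
  have "nsq n v \<le> nsq n u"
    unfolding nsq_def v_def
  proof (intro sum_mono)
    fix i assume "i \<in> {..<n}"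
    moreover have "\<bar>h * k i\<bar> \<le> \<bar>u i\<bar>" using v[of i] by blast
    ultimately show "(if i < n then h * k i else 0)\<^sup>2 \<le> (u i)\<^sup>2"
      by (simp only: abs_le_square_iff) simp
  qed
  then have "v \<in> net d n"
    using u unfolding net_def v_def h_def mem_Collect_eq by (intro conjI exI[of _ k] order_trans[OF _ u]) auto
  moreover have "nsq n (\<lambda>i. u i - v i) \<le> (\<Sum>i<n. h\<^sup>2)"
    unfolding nsq_def v_def
  proof (intro sum_mono)
    fix i assume "i \<in> {..<n}"
    moreover have "\<bar>u i - h * k i\<bar> \<le> \<bar>h\<bar>" using v[of i] h by simp
    ultimately show "(u i - (if i < n then h * k i else 0))\<^sup>2 \<le> h\<^sup>2"
      by (simp only: abs_le_square_iff) simp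
  qed
  moreover have "(\<Sum>i<n. h\<^sup>2) = d\<^sup>2" using n by (simp add: h_def power_divide)
  ultimately show thesis using that by metis
qed

lemma abs_int_le_square: "\<bar>real_of_int k\<bar> \<le> (real_of_int k)\<^sup>2"
proof (cases "k = 0")
  case False
  then have "\<bar>real_of_int k\<bar> * 1 \<le> \<bar>real_of_int k\<bar> * \<bar>real_of_int k\<bar>"
    by (intro mult_left_mono) (auto simp flip: of_int_abs)
  then show ?thesis by (simp add: power2_eq_square)
qed simp

text \<open>Since \<open>k^2 \<ge> |k|\<close> and \<open>exp (-1) \<le> 1/2\<close>, a two-sided
  geometric series dominates; its partial sum is exactly \<open>3 - 2 * (1/2) ^ L\<close>.\<close>

lemma sum_int_exp_neg_square_le:
  "(\<Sum>k\<in>{-int L..int L}. exp (- (real_of_int k)\<^sup>2)) \<le> 3"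
proof -
  have one: "exp (- (real_of_int k)\<^sup>2) \<le> (1/2) ^ nat \<bar>k\<bar>" for k
  proof -
    have "exp (- (real_of_int k)\<^sup>2) \<le> exp (- \<bar>real_of_int k\<bar>)"
      using abs_int_le_square[of k] by simp
    also have "\<dots> = exp (-1) ^ nat \<bar>k\<bar>"
      by (simp add: exp_of_nat_mult[symmetric])
    also have "\<dots> \<le> (1/2) ^ nat \<bar>k\<bar>"
    proof (intro power_mono)
      have "(2::real) \<le> exp 1" using exp_ge_add_one_self[of 1] by simp
      then show "exp (-1) \<le> (1/2::real)" by (simp add: exp_minus field_simps)
    qed auto
    finally show ?thesis .
  qed
  have "(\<Sum>k\<in>{-int L..int L}. exp (- (real_of_int k)\<^sup>2)) \<le> (\<Sum>k\<in>{-int L..int L}. (1/2) ^ nat \<bar>k\<bar>)"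
    by (intro sum_mono one)
  also have "\<dots> \<le> 3 - 2 * (1/2) ^ L"
  proof (induction L)
    case (Suc L)
    have "{-int (Suc L)..int (Suc L)} = insert (int (Suc L)) (insert (- int (Suc L)) {-int L..int L})"
      by auto
    then show ?case using Suc by (simp add: nat_add_distrib)
  qed simp
  also have "\<dots> \<le> 3" by simp
  finally show ?thesis .
qed

text \<open>Lattice points are counted as in a Chernoff bound: where the squares
  \<open>k_i^2\<close> sum to at most \<open>n / d^2\<close>, 1 is at most
  \<open>exp (n / d^2)\<close> times the product of the \<open>exp (- k_i^2)\<close>. Summed over
  the whole box this factorises into one-dimensional sums of at most
  \<open>3 \<le> exp 2\<close>.\<close>

lemma finite_card_net:
  assumes d: "d > 0" and n: "n > 0"
  shows "finite (net d n)" and "card (net d n) \<le> exp (n * (1 / d\<^sup>2 + 2))"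
proof -
  \<comment> \<open>Any finite box around the ball would do; \<open>|k| \<le> k^2\<close> shows that
    this one is large enough.\<close>
  define L where "L = nat \<lceil>n / d\<^sup>2\<rceil>"
  define K where "K = {k \<in> PiE {..<n} (\<lambda>_. {-int L..int L}). (\<Sum>i<n. (real_of_int (k i))\<^sup>2) \<le> n / d\<^sup>2}"
  have finK: "finite K" unfolding K_def by (intro finite_subset[OF _ finite_PiE[of "{..<n}" "\<lambda>_. {-int L..int L}"]]) auto
  have sub: "net d n \<subseteq> (\<lambda>k i. if i < n then d / sqrt n * real_of_int (k i) else 0) ` K"
  proof
    fix v assume "v \<in> net d n"
    then obtain k :: "nat \<Rightarrow> int" where v: "nsq n v \<le> 1" "v = (\<lambda>i. if i < n then d / sqrt n * k i else 0)"
      by (auto simp: net_def)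
    have "nsq n v = d\<^sup>2 / n * (\<Sum>i<n. (real_of_int (k i))\<^sup>2)"
      by (simp add: v(2) nsq_def power_mult_distrib power_divide sum_distrib_left sum_divide_distrib)
    then have S: "(\<Sum>i<n. (real_of_int (k i))\<^sup>2) \<le> n / d\<^sup>2"
      using mult_left_mono[OF v(1), of "n / d\<^sup>2"] d n by simp
    have "k i \<in> {-int L..int L}" if "i < n" for i
    proof -
      have "real_of_int \<bar>k i\<bar> \<le> (real_of_int (k i))\<^sup>2"
        using abs_int_le_square[of "k i"] by simp
      also have "\<dots> \<le> n / d\<^sup>2"
        using S member_le_sum[of i "{..<n}" "\<lambda>i. (real_of_int (k i))\<^sup>2"] that by auto
      also have "\<dots> \<le> L" unfolding L_def by linarith
      finally show ?thesis by auto
    qed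
    then have "restrict k {..<n} \<in> K" using S by (auto simp: K_def)
    moreover have "v = (\<lambda>i. if i < n then d / sqrt n * real_of_int (restrict k {..<n} i) else 0)"
      by (auto simp: v(2))
    ultimately show "v \<in> (\<lambda>k i. if i < n then d / sqrt n * real_of_int (k i) else 0) ` K" by blast
  qed
  show "finite (net d n)" using sub finK by (meson finite_imageI finite_subset)
  have "card (net d n) \<le> card K"
    by (meson card_image_le card_mono finK finite_imageI le_trans sub)
  then have "real (card (net d n)) \<le> (\<Sum>k\<in>K. 1)" by simp
  also have "\<dots> \<le> (\<Sum>k\<in>K. exp (n / d\<^sup>2) * (\<Prod>i<n. exp (- (real_of_int (k i))\<^sup>2)))"
  proof (intro sum_mono)
    fix k assume "k \<in> K"
    then have "exp (n / d\<^sup>2 - (\<Sum>i<n. (real_of_int (k i))\<^sup>2)) \<ge> 1" by (simp add: K_def)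
    also have "exp (n / d\<^sup>2 - (\<Sum>i<n. (real_of_int (k i))\<^sup>2)) = exp (n / d\<^sup>2) * (\<Prod>i<n. exp (- (real_of_int (k i))\<^sup>2))"
    proof -
      have "(\<Prod>i<n. exp (- (real_of_int (k i))\<^sup>2)) = exp (\<Sum>i<n. - (real_of_int (k i))\<^sup>2)"
        by (subst exp_sum) auto
      then show ?thesis by (simp only: exp_add[symmetric] sum_negf diff_conv_add_uminus)
    qed
    finally show "1 \<le> exp (n / d\<^sup>2) * (\<Prod>i<n. exp (- (real_of_int (k i))\<^sup>2))" .
  qed
  also have "\<dots> \<le> (\<Sum>k\<in>PiE {..<n} (\<lambda>_. {-int L..int L}). exp (n / d\<^sup>2) * (\<Prod>i<n. exp (- (real_of_int (k i))\<^sup>2)))"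
  proof (rule sum_mono2)
    show "K \<subseteq> PiE {..<n} (\<lambda>_. {-int L..int L})" by (simp add: K_def)
    show "0 \<le> exp (n / d\<^sup>2) * (\<Prod>i<n. exp (- (real_of_int (k i))\<^sup>2))" for k :: "nat \<Rightarrow> int"
      by (intro mult_nonneg_nonneg prod_nonneg) auto
  qed (simp add: finite_PiE)
  also have "\<dots> = exp (n / d\<^sup>2) * (\<Prod>i<n. \<Sum>k\<in>{-int L..int L}. exp (- (real_of_int k)\<^sup>2))"
    by (subst prod_sum_PiE) (auto simp: sum_distrib_left)
  also have "\<dots> \<le> exp (n / d\<^sup>2) * (\<Prod>i<n. exp 2)"
  proof (intro mult_left_mono prod_mono conjI)
    fix i assume "i \<in> {..<n}"
    show "(\<Sum>k\<in>{-int L..int L}. exp (- (real_of_int k)\<^sup>2)) \<le> exp 2"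
      using sum_int_exp_neg_square_le[of L] exp_ge_add_one_self[of 2] by linarith
  qed (auto intro: sum_nonneg)
  also have "\<dots> = exp (n * (1 / d\<^sup>2 + 2))"
  proof -
    have "(\<Prod>i<n. exp 2) = exp (real n * 2)"
      by (simp only: prod_constant card_lessThan exp_of_nat_mult)
    then show ?thesis by (simp only: exp_add[symmetric]) (simp add: distrib_left)
  qed
  finally show "card (net d n) \<le> exp (n * (1 / d\<^sup>2 + 2))" .
qed

section \<open>Quadratic forms and their supremum over a net\<close>

definition qf :: "nat \<Rightarrow> (nat \<Rightarrow> nat \<Rightarrow> real) \<Rightarrow> (nat \<Rightarrow> real) \<Rightarrow> real" where
  "qf n H u = (\<Sum>i<n. \<Sum>k<n. H i k * u i * u k)"

lemma qf_scale: "qf n H (\<lambda>i. a * u i) = a\<^sup>2 * qf n H u"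
  by (simp add: qf_def sum_distrib_left power2_eq_square mult_ac)

text \<open>The difference of the two values is the bilinear form at \<open>x - y\<close> and
  \<open>x + y\<close>. Polarising it after rescaling by \<open>a\<close> allows the short vector
  \<open>x - y\<close> to be balanced against the long vector \<open>x + y\<close>.\<close>

lemma qf_diff_square:
  assumes "\<And>i k. i < n \<Longrightarrow> k < n \<Longrightarrow> H i k = H k i" and a: "a \<noteq> 0"
  shows "4 * (qf n H x - qf n H y)
    = qf n H (\<lambda>i. a * (x i - y i) + (x i + y i) / a) - qf n H (\<lambda>i. a * (x i - y i) - (x i + y i) / a)"
proof -
  define B where "B p q = (\<Sum>i<n. \<Sum>k<n. H i k * p i * q k)" for p q :: "nat \<Rightarrow> real"
  have sym: "B p q = B q p" for p q
    unfolding B_def by (subst sum.swap) (auto intro!: sum.cong simp: assms(1))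
  have add: "qf n H (\<lambda>i. p i + q i) = qf n H p + 2 * B p q + qf n H q" for p q
  proof -
    have "qf n H (\<lambda>i. p i + q i) = qf n H p + B p q + B q p + qf n H q"
      by (simp add: qf_def B_def sum.distrib algebra_simps)
    then show ?thesis using sym[of p q] by simp
  qed
  have sub: "qf n H (\<lambda>i. p i - q i) = qf n H p - 2 * B p q + qf n H q" for p q
  proof -
    have "qf n H (\<lambda>i. p i - q i) = qf n H p - B p q - B q p + qf n H q"
      by (simp add: qf_def B_def sum.distrib sum_subtractf algebra_simps)
    then show ?thesis using sym[of p q] by simp
  qed
  have "B (\<lambda>i. a * (x i - y i)) (\<lambda>i. (x i + y i) / a) = B (\<lambda>i. x i - y i) (\<lambda>i. x i + y i)"
    unfolding B_def using a by (intro sum.cong) auto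
  also have "\<dots> = qf n H x - qf n H y + B x y - B y x"
    by (simp add: qf_def B_def sum.distrib sum_subtractf algebra_simps)
  finally show ?thesis using sym[of x y] by (simp add: add sub)
qed

lemma qf_bounded: 
  "\<exists>S. \<forall>u. nsq n u = 1 \<longrightarrow> \<bar>qf n H u\<bar> \<le> S"
proof (intro exI allI impI)
  fix u assume u: "nsq n u = 1"
  have "\<bar>qf n H u\<bar> \<le> (\<Sum>i<n. \<Sum>k<n. \<bar>H i k * u i * u k\<bar>)"
    unfolding qf_def by (rule order_trans[OF sum_abs]) (intro sum_mono sum_abs)
  also have "\<dots> \<le> (\<Sum>i<n. \<Sum>k<n. \<bar>H i k\<bar>)"
  proof (intro sum_mono)
    fix i k assume ik: "i \<in> {..<n}" "k \<in> {..<n}"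
    have "\<bar>u j\<bar> \<le> 1" if "j \<in> {..<n}" for j
      using member_le_sum[of j "{..<n}" "\<lambda>i. (u i)\<^sup>2"] u that by (simp add: nsq_def abs_square_le_1[symmetric])
    then have "\<bar>u i\<bar> * \<bar>u k\<bar> \<le> 1 * 1" using ik by (intro mult_mono) auto
    then have "\<bar>H i k\<bar> * (\<bar>u i\<bar> * \<bar>u k\<bar>) \<le> \<bar>H i k\<bar> * 1"
      by (intro mult_left_mono) auto
    then show "\<bar>H i k * u i * u k\<bar> \<le> \<bar>H i k\<bar>" by (simp add: abs_mult mult.assoc)
  qed
  finally show "\<bar>qf n H u\<bar> \<le> (\<Sum>i<n. \<Sum>k<n. \<bar>H i k\<bar>)" .
qed

text \<open>By polarisation, moving from a unit vector to a net point at distance \<open>1/4\<close> changes the form by at most half its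
  supremum.\<close>

lemma qf_le_net:
  assumes n: "n > 0" and sym: "\<And>i k. i < n \<Longrightarrow> k < n \<Longrightarrow> H i k = H k i"
    and b: "\<And>v. v \<in> net (1/4) n \<Longrightarrow> \<bar>qf n H v\<bar> \<le> b"
    and u: "nsq n u = 1"
  shows "\<bar>qf n H u\<bar> \<le> 2 * b"
proof -
  define S where "S = (SUP u\<in>{u. nsq n u = 1}. \<bar>qf n H u\<bar>)"
  have bdd: "bdd_above ((\<lambda>u. \<bar>qf n H u\<bar>) ` {u. nsq n u = 1})"
    using qf_bounded[of n H] unfolding bdd_above_def by auto
  have leS: "\<bar>qf n H w\<bar> \<le> S" if "nsq n w = 1" for w
    unfolding S_def using that bdd by (intro cSUP_upper) auto
  have leS': "\<bar>qf n H w\<bar> \<le> S * nsq n w" for w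
  proof (cases "nsq n w = 0")
    case True
    then show ?thesis by (simp add: nsq_eq_0_iff qf_def) (simp add: nsq_def)
  next
    case False
    define a where "a = inverse (sqrt (nsq n w))"
    have a: "a\<^sup>2 * nsq n w = 1" using False by (simp add: a_def power_inverse)
    have "a\<^sup>2 * \<bar>qf n H w\<bar> \<le> S"
      using leS[of "\<lambda>i. a * w i"] a by (simp add: nsq_scale qf_scale abs_mult)
    then have "a\<^sup>2 * \<bar>qf n H w\<bar> * nsq n w \<le> S * nsq n w" by (intro mult_right_mono) auto
    moreover have "a\<^sup>2 * \<bar>qf n H w\<bar> * nsq n w = \<bar>qf n H w\<bar>"
      using a by (metis mult.assoc mult.commute mult.right_neutral)
    ultimately show ?thesis by simp
  qed
  have S0: "S \<ge> 0" using leS[OF u] by linarith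
  have step: "\<bar>qf n H w\<bar> \<le> b + S / 2" if w: "nsq n w = 1" for w
  proof -
    obtain v where v: "v \<in> net (1/4) n" "nsq n (\<lambda>i. w i - v i) \<le> (1/4)\<^sup>2"
      using net_approx[of "1/4" n w] n w by auto
    \<comment> \<open>\<open>|w - v|^2 \<le> 1/16\<close> and \<open>|w + v|^2 \<le> 4\<close>, so
      \<open>a^2 = 8\<close> gives both \<open>p\<close> and \<open>q\<close> squared norm at most
      1/2.\<close>
    define a where "a = sqrt (8::real)"
    have a: "a\<^sup>2 = 8" "a \<noteq> 0" by (auto simp: a_def)
    define p q where "p i = a * (w i - v i)" and "q i = (w i + v i) / a" for i
    have par: "nsq n (\<lambda>i. x i + y i) + nsq n (\<lambda>i. x i - y i) = 2 * nsq n x + 2 * nsq n y" for x y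
      by (simp add: nsq_def power2_sum power2_diff sum.distrib sum_subtractf sum_distrib_left)
    have "nsq n p \<le> 1/2" using v(2) a by (simp add: p_def[abs_def] nsq_scale power2_eq_square)
    moreover have "nsq n q \<le> 1/2"
    proof -
      have "nsq n v \<le> 1" using v by (simp add: net_def)
      then have "nsq n (\<lambda>i. w i + v i) \<le> 4"
        using par[of w v] w nsq_nonneg[of n "\<lambda>i. w i - v i"] by linarith
      moreover have "nsq n q = nsq n (\<lambda>i. w i + v i) / 8"
        using nsq_scale[of n "1/a" "\<lambda>i. w i + v i"] a by (simp add: q_def[abs_def] power_divide)
      ultimately show ?thesis by simp
    qed
    ultimately have pq: "nsq n (\<lambda>i. p i + q i) + nsq n (\<lambda>i. p i - q i) \<le> 2"
      using par[of p q] by linarith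
    have "4 * \<bar>qf n H w - qf n H v\<bar> = \<bar>qf n H (\<lambda>i. p i + q i) - qf n H (\<lambda>i. p i - q i)\<bar>"
    proof -
      have "4 * (qf n H w - qf n H v) = qf n H (\<lambda>i. p i + q i) - qf n H (\<lambda>i. p i - q i)"
        using qf_diff_square[of n H a w v, OF sym a(2)] by (simp add: p_def q_def)
      then have "\<bar>4 * (qf n H w - qf n H v)\<bar> = \<bar>qf n H (\<lambda>i. p i + q i) - qf n H (\<lambda>i. p i - q i)\<bar>"
        by (simp only:)
      then show ?thesis by (simp only: abs_mult abs_numeral)
    qed
    also have "\<dots> \<le> S * nsq n (\<lambda>i. p i + q i) + S * nsq n (\<lambda>i. p i - q i)"
      using leS'[of "\<lambda>i. p i + q i"] leS'[of "\<lambda>i. p i - q i"] by linarith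
    also have "\<dots> \<le> S * 2" using pq S0 by (simp add: distrib_left[symmetric] mult_left_mono)
    finally have "\<bar>qf n H w - qf n H v\<bar> \<le> S / 2" by simp
    moreover have "\<bar>qf n H w\<bar> \<le> \<bar>qf n H v\<bar> + \<bar>qf n H w - qf n H v\<bar>"
      using abs_triangle_ineq2[of "qf n H w" "qf n H v"] by simp
    ultimately show ?thesis using b[OF v(1)] by (meson add_mono order_trans)
  qed
  \<comment> \<open>\<open>S\<close> is a genuine supremum by \<open>bdd\<close>, so half of it can
    be absorbed on the left.\<close>
  have "S \<le> b + S / 2"
    unfolding S_def by (rule cSUP_least) (use u step in \<open>auto simp: S_def\<close>)
  then show ?thesis using leS[OF u] by linarith
qed

section \<open>Gaussian exponential moments\<close>

abbreviation gauss1 :: "real measure" where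
  "gauss1 \<equiv> density lborel std_normal_density"

text \<open>An arbitrary index set lets the same law live on the positions of \<open>Y\<close> and
  on the index pairs of a rearranged or transposed matrix.\<close>

definition gaussI :: "'i set \<Rightarrow> ('i \<Rightarrow> real) measure" where
  "gaussI I = PiM I (\<lambda>_. gauss1)"

lemma prob_space_gauss1: "prob_space gauss1"
  by (rule prob_space_normal_density) simp

lemma prob_space_gaussI: "prob_space (gaussI I)"
  unfolding gaussI_def by (intro prob_space_PiM prob_space_gauss1)

lemma product_sigma_finite_gauss: "product_sigma_finite (\<lambda>_::'i. gauss1)"
  by (simp add: product_sigma_finite_def prob_space_gauss1 prob_space_imp_sigma_finite)

lemma sets_gaussI: "sets (gaussI I) = sets (PiM I (\<lambda>_. borel))"
  unfolding gaussI_def by (intro sets_PiM_cong) auto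

lemma measurable_gaussI_component [measurable (raw)]: "i \<in> I \<Longrightarrow> (\<lambda>x. x i) \<in> borel_measurable (gaussI I)"
  unfolding gaussI_def by measurable

lemma nn_integral_gauss1:
  assumes [measurable]: "f \<in> borel_measurable borel"
  shows "(\<integral>\<^sup>+z. f z \<partial>gauss1) = (\<integral>\<^sup>+z. ennreal (std_normal_density z) * f z \<partial>lborel)"
  by (subst nn_integral_density) auto

lemma nn_integral_normal_density:
  assumes "s > 0"
  shows "(\<integral>\<^sup>+z. ennreal (normal_density m s z) \<partial>lborel) = 1"
proof -
  interpret prob_space "density lborel (normal_density m s)" by (rule prob_space_normal_density[OF assms])
  have "emeasure (density lborel (normal_density m s)) UNIV = 1"
    using emeasure_space_1 by simp
  then show ?thesis by (simp add: emeasure_density)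
qed

lemma gauss1_exp_linear: "(\<integral>\<^sup>+z. ennreal (exp (c * z)) \<partial>gauss1) = ennreal (exp (c\<^sup>2 / 2))"
proof -
  have "ennreal (std_normal_density z) * ennreal (exp (c * z)) = ennreal (exp (c\<^sup>2 / 2)) * ennreal (normal_density c 1 z)" for z
  proof -
    have "std_normal_density z * exp (c * z) = exp (c\<^sup>2 / 2) * normal_density c 1 z"
      by (simp add: normal_density_def exp_add[symmetric] power2_eq_square field_simps)
    then show ?thesis by (simp add: ennreal_mult[symmetric])
  qed
  then show ?thesis
    by (simp add: nn_integral_gauss1 nn_integral_cmult nn_integral_normal_density)
qed

lemma gauss_exp_linear:
  assumes "finite I"
  shows "(\<integral>\<^sup>+x. ennreal (exp (\<Sum>i\<in>I. c i * x i)) \<partial>gaussI I) = ennreal (exp ((\<Sum>i\<in>I. (c i)\<^sup>2) / 2))"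
proof -
  interpret product_sigma_finite "\<lambda>_. gauss1" by (rule product_sigma_finite_gauss)
  have "(\<integral>\<^sup>+x. ennreal (exp (\<Sum>i\<in>I. c i * x i)) \<partial>gaussI I)
     = (\<integral>\<^sup>+x. (\<Prod>i\<in>I. ennreal (exp (c i * x i))) \<partial>PiM I (\<lambda>_. gauss1))"
    unfolding gaussI_def using assms by (simp add: exp_sum prod_ennreal)
  also have "\<dots> = (\<Prod>i\<in>I. ennreal (exp ((c i)\<^sup>2 / 2)))"
    using assms by (subst product_nn_integral_prod) (auto simp: gauss1_exp_linear)
  also have "\<dots> = ennreal (exp ((\<Sum>i\<in>I. (c i)\<^sup>2) / 2))"
    using assms by (simp add: prod_ennreal exp_sum[symmetric] sum_divide_distrib)
  finally show ?thesis .
qed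

text \<open>The factor \<open>exp (th * z^2)\<close> only changes the variance: up to the constant
  \<open>1 / sqrt q\<close> the product is the centred normal density of variance
  \<open>s^2 / q\<close>.\<close>

lemma normal_exp_square:
  assumes s: "s > 0" and th: "2 * th * s\<^sup>2 < 1"
  shows "(\<integral>\<^sup>+z. ennreal (normal_density 0 s z) * ennreal (exp (th * z\<^sup>2)) \<partial>lborel)
    = ennreal (1 / sqrt (1 - 2 * th * s\<^sup>2))"
proof -
  define q where "q = 1 - 2 * th * s\<^sup>2"
  have q: "q > 0" using th by (simp add: q_def)
  define t where "t = s / sqrt q"
  have t: "t > 0" "t\<^sup>2 = s\<^sup>2 / q" using s q by (auto simp: t_def power_divide)
  have "normal_density 0 s z * exp (th * z\<^sup>2) = 1 / sqrt q * normal_density 0 t z" for z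
  proof -
    have "- (z\<^sup>2 / (2 * s\<^sup>2)) + th * z\<^sup>2 = - (z\<^sup>2 / (2 * t\<^sup>2))"
      using s q by (simp add: t(2) q_def field_simps)
    moreover have "1 / sqrt (2 * pi * s\<^sup>2) = 1 / sqrt q * (1 / sqrt (2 * pi * t\<^sup>2))"
      using s q by (simp add: t(2) real_sqrt_mult real_sqrt_divide)
    ultimately show ?thesis
      by (simp add: normal_density_def exp_add[symmetric] mult.assoc)
  qed
  then have "(\<integral>\<^sup>+z. ennreal (normal_density 0 s z) * ennreal (exp (th * z\<^sup>2)) \<partial>lborel)
    = (\<integral>\<^sup>+z. ennreal (1 / sqrt q) * ennreal (normal_density 0 t z) \<partial>lborel)"
    using q by (intro nn_integral_cong) (simp add: ennreal_mult[symmetric])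
  then show ?thesis using t by (simp add: nn_integral_cmult nn_integral_normal_density q_def)
qed

text \<open>The expansion \<open>- ln (1 - 2 y) / 2 = y + O(y^2)\<close>. Its linear term is
  cancelled by centring the square, which leaves centred chi-square variables a purely quadratic
  exponent.\<close>

lemma inverse_sqrt_le_exp:
  assumes "\<bar>y\<bar> \<le> (1/4::real)"
  shows "1 / sqrt (1 - 2 * y) \<le> exp (y + 4 * y\<^sup>2)"
proof -
  have "\<bar>ln (1 + (- 2 * y)) - (- 2 * y)\<bar> \<le> 2 * (- 2 * y)\<^sup>2"
    using assms by (intro abs_ln_one_plus_x_minus_x_bound) auto
  then have "\<bar>ln (1 - 2 * y) + 2 * y\<bar> \<le> 8 * y\<^sup>2" by (simp add: power_mult_distrib)
  then have "- (ln (1 - 2 * y)) / 2 \<le> y + 4 * y\<^sup>2"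
    using abs_ge_minus_self[of "ln (1 - 2 * y) + 2 * y"] by linarith
  moreover have "1 / sqrt (1 - 2 * y) = exp (- (ln (1 - 2 * y)) / 2)"
  proof -
    have "sqrt (1 - 2 * y) = exp (ln (1 - 2 * y) / 2)"
    proof -
      have "1 - 2 * y > 0" using assms by auto
      then have "exp (ln (sqrt (1 - 2 * y))) = sqrt (1 - 2 * y)" by simp
      then show ?thesis using \<open>1 - 2 * y > 0\<close> by (simp only: ln_sqrt)
    qed
    then show ?thesis by (simp only: exp_minus divide_inverse mult_1_left minus_mult_left[symmetric])
  qed
  ultimately show ?thesis by (simp only: exp_le_cancel_iff)
qed

lemma indep_vars_gaussI:
  assumes "finite I"
  shows "prob_space.indep_vars (gaussI I) (\<lambda>_. borel) (\<lambda>i x. x i) I"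
proof -
  interpret prob_space "gaussI I" by (rule prob_space_gaussI)
  have "distr (gaussI I) (\<Pi>\<^sub>M i\<in>I. borel) (\<lambda>x. \<lambda>i\<in>I. x i) = (\<Pi>\<^sub>M i\<in>I. distr (gaussI I) borel (\<lambda>x. x i))"
  proof -
    have D: "distr (gaussI I) borel (\<lambda>x. x i) = gauss1" if "i \<in> I" for i
    proof -
      have "distr (gaussI I) borel (\<lambda>x. x i) = distr (gaussI I) gauss1 (\<lambda>x. x i)"
        by (intro distr_cong) auto
      also have "\<dots> = gauss1"
        unfolding gaussI_def using that by (subst distr_PiM_component) (auto intro: prob_space_gauss1)
      finally show ?thesis .
    qed
    have "(\<Pi>\<^sub>M i\<in>I. distr (gaussI I) borel (\<lambda>x. x i)) = PiM I (\<lambda>_. gauss1)"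
      by (intro PiM_cong D) auto
    then have "(\<Pi>\<^sub>M i\<in>I. distr (gaussI I) borel (\<lambda>x. x i)) = gaussI I"
      by (simp only: gaussI_def)
    moreover have "distr (gaussI I) (\<Pi>\<^sub>M i\<in>I. borel) (\<lambda>x. \<lambda>i\<in>I. x i) = distr (gaussI I) (gaussI I) (\<lambda>x. x)"
      by (intro distr_cong refl) (simp_all only: sets_gaussI, auto simp: gaussI_def space_PiM)
    ultimately show ?thesis by (simp add: distr_id)
  qed
  then have "I \<noteq> {} \<Longrightarrow> ?thesis"
    by (subst indep_vars_iff_distr_eq_PiM') (auto intro: measurable_gaussI_component)
  moreover have "I = {} \<Longrightarrow> ?thesis"
    unfolding indep_vars_def indep_sets_def by auto
  ultimately show ?thesis by blast
qed

lemma distributed_gaussI_component: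
  assumes "i \<in> I"
  shows "distributed (gaussI I) lborel (\<lambda>x. x i) std_normal_density"
proof -
  have "distr (gaussI I) lborel (\<lambda>x. x i) = distr (gaussI I) gauss1 (\<lambda>x. x i)"
    by (intro distr_cong) auto
  also have "\<dots> = gauss1"
    unfolding gaussI_def using assms by (subst distr_PiM_component) (auto intro: prob_space_gauss1)
  finally show ?thesis using assms by (auto simp: distributed_def)
qed

lemma distributed_gaussI_linear:
  assumes I: "finite I" and J: "J \<subseteq> I" and c: "(\<Sum>i\<in>J. (c i)\<^sup>2) > 0"
  shows "distributed (gaussI I) lborel (\<lambda>x. \<Sum>i\<in>J. c i * x i) (normal_density 0 (sqrt (\<Sum>i\<in>J. (c i)\<^sup>2)))"
proof -
  interpret prob_space "gaussI I" by (rule prob_space_gaussI)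
  \<comment> \<open>Vanishing coefficients are dropped because the rule for sums of independent
    normals asks for positive standard deviations.\<close>
  define K where "K = {i\<in>J. c i \<noteq> 0}"
  have finJ: "finite J" using I J finite_subset by blast
  have eq: "(\<Sum>i\<in>J. c i * x i) = (\<Sum>i\<in>K. c i * x i)" for x
    unfolding K_def by (rule sum.mono_neutral_right) (use finJ in auto)
  have eq2: "(\<Sum>i\<in>J. (c i)\<^sup>2) = (\<Sum>i\<in>K. \<bar>c i\<bar>\<^sup>2)"
    unfolding K_def power2_abs by (rule sum.mono_neutral_right) (use finJ in auto)
  have ind: "indep_vars (\<lambda>_. borel) (\<lambda>i x. c i * x i) K"
    by (rule indep_vars_compose2[where M' = "\<lambda>_. borel" and X = "\<lambda>i x. x i"],
        rule indep_vars_subset[OF indep_vars_gaussI[OF I]]) (use J in \<open>auto simp: K_def\<close>)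
  have "distributed (gaussI I) lborel (\<lambda>x. \<Sum>i\<in>K. c i * x i)
      (normal_density (\<Sum>i\<in>K. 0) (sqrt (\<Sum>i\<in>K. \<bar>c i\<bar>\<^sup>2)))"
  proof (rule sum_indep_normal)
    show "finite K" using finJ by (simp add: K_def)
    show "K \<noteq> {}"
    proof
      assume "K = {}"
      then show False using c by (simp only: eq2 sum.empty)
    qed
    fix i assume i: "i \<in> K"
    then show "0 < \<bar>c i\<bar>" by (simp add: K_def)
    have "distributed (gaussI I) lborel (\<lambda>x. 0 + c i * x i) (normal_density (0 + c i * 0) (\<bar>c i\<bar> * 1))"
      by (rule normal_density_affine[OF distributed_gaussI_component]) (use i J in \<open>auto simp: K_def\<close>)
    then show "distributed (gaussI I) lborel (\<lambda>x. c i * x i) (normal_density 0 \<bar>c i\<bar>)" by simp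
  qed (rule ind)
  then show ?thesis by (simp add: eq eq2)
qed

lemma borel_measurable_exp_square:
  fixes f :: "'a \<Rightarrow> real" and th q :: real
  assumes [measurable]: "f \<in> borel_measurable M"
  shows "(\<lambda>x. ennreal (exp (th * ((f x)\<^sup>2 - q)))) \<in> borel_measurable M"
    and "(\<lambda>x. ennreal (exp (th * (f x)\<^sup>2))) \<in> borel_measurable M"
  by measurable

text \<open>Different columns use disjoint coordinates, so the \<open>w j\<close> are independent
  centred normals of variance \<open>q \<le> 1\<close>. The condition on \<open>th\<close> keeps
  \<open>2 * th * q\<close> at most 1/2, and each factor is at most
  \<open>exp (4 * th^2)\<close>.\<close>

lemma gauss_exp_square_columns:
  fixes u :: "'a \<Rightarrow> real" and th :: real
  assumes "finite J" "finite K" and u: "(\<Sum>i\<in>J. (u i)\<^sup>2) \<le> 1" and th: "\<bar>th\<bar> \<le> 1/4"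
  shows "(\<integral>\<^sup>+x. ennreal (exp (th * ((\<Sum>j\<in>K. (\<Sum>i\<in>J. u i * x (i, j))\<^sup>2) - card K * (\<Sum>i\<in>J. (u i)\<^sup>2)))) \<partial>gaussI (J \<times> K))
    \<le> ennreal (exp (4 * th\<^sup>2 * card K))"
proof -
  interpret prob_space "gaussI (J \<times> K)" by (rule prob_space_gaussI)
  define q where "q = (\<Sum>i\<in>J. (u i)\<^sup>2)"
  have q: "0 \<le> q" "q \<le> 1" using u by (auto simp: q_def sum_nonneg)
  define w where "w j x = (\<Sum>i\<in>J. u i * x (i, j))" for j :: 'b and x :: "'a \<times> 'b \<Rightarrow> real"
  have meas: "(\<lambda>x. w j x) \<in> borel_measurable (gaussI (J \<times> K))" if "j \<in> K" for j
    unfolding w_def using that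
    by (intro borel_measurable_sum borel_measurable_times borel_measurable_const measurable_gaussI_component) auto
  have one: "(\<integral>\<^sup>+x. ennreal (exp (th * ((w j x)\<^sup>2 - q))) \<partial>gaussI (J \<times> K)) \<le> ennreal (exp (4 * th\<^sup>2))"
    if j: "j \<in> K" for j
  \<comment> \<open>A normal density needs positive variance, so the zero vector, which belongs to
    the net, is treated apart.\<close>
  proof (cases "q = 0")
    case True
    then have "u i = 0" if "i \<in> J" for i
      using that assms(1) by (simp add: q_def sum_nonneg_eq_0_iff)
    then have "w j x = 0" for x by (simp add: w_def)
    then show ?thesis using True by (simp add: emeasure_space_1)
  next
    case False
    then have q0: "q > 0" using q by simp
    have S: "sum f (J \<times> {j}) = (\<Sum>i\<in>J. f (i, j))" for f :: "'a \<times> 'b \<Rightarrow> real"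
      by (simp add: sum.cartesian_product')
    have "distributed (gaussI (J \<times> K)) lborel (\<lambda>x. \<Sum>p\<in>J \<times> {j}. u (fst p) * x p)
       (normal_density 0 (sqrt (\<Sum>p\<in>J \<times> {j}. (u (fst p))\<^sup>2)))"
      using assms(1,2) j q0 by (intro distributed_gaussI_linear) (auto simp: S q_def)
    then have D: "distributed (gaussI (J \<times> K)) lborel (w j) (normal_density 0 (sqrt q))"
      by (simp add: S q_def w_def[abs_def])
    have "(\<integral>\<^sup>+x. ennreal (exp (th * ((w j x)\<^sup>2 - q))) \<partial>gaussI (J \<times> K))
        = (\<integral>\<^sup>+x. ennreal (exp (- th * q)) * ennreal (exp (th * (w j x)\<^sup>2)) \<partial>gaussI (J \<times> K))"
    proof (rule nn_integral_cong)
      fix x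
      have "exp (th * ((w j x)\<^sup>2 - q)) = exp (- th * q) * exp (th * (w j x)\<^sup>2)"
        by (simp only: mult_exp_exp) (simp add: algebra_simps)
      then show "ennreal (exp (th * ((w j x)\<^sup>2 - q))) = ennreal (exp (- th * q)) * ennreal (exp (th * (w j x)\<^sup>2))"
        by (simp only: ennreal_mult exp_ge_zero)
    qed
    also have "\<dots> = ennreal (exp (- th * q)) * (\<integral>\<^sup>+x. ennreal (exp (th * (w j x)\<^sup>2)) \<partial>gaussI (J \<times> K))"
      by (rule nn_integral_cmult[OF borel_measurable_exp_square(2)[OF meas[OF j]]])
    also have "(\<integral>\<^sup>+x. ennreal (exp (th * (w j x)\<^sup>2)) \<partial>gaussI (J \<times> K))
       = (\<integral>\<^sup>+z. ennreal (normal_density 0 (sqrt q) z) * ennreal (exp (th * z\<^sup>2)) \<partial>lborel)"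
      by (rule distributed_nn_integral[OF D, symmetric]) (rule borel_measurable_exp_square(2), simp)
    also have "\<dots> = ennreal (1 / sqrt (1 - 2 * th * q))"
    proof -
      have "\<bar>th * q\<bar> \<le> 1/4 * 1" unfolding abs_mult using th q by (intro mult_mono) auto
      then show ?thesis using q0 normal_exp_square[of "sqrt q" th] by simp
    qed
    also have "ennreal (exp (- th * q)) * \<dots> \<le> ennreal (exp (- th * q)) * ennreal (exp (th * q + 4 * (th * q)\<^sup>2))"
    proof -
      have "\<bar>th * q\<bar> \<le> 1/4 * 1" unfolding abs_mult using th q by (intro mult_mono) auto
      from inverse_sqrt_le_exp[of "th * q"] this show ?thesis
        by (intro mult_left_mono ennreal_leI) (auto simp: mult.assoc)
    qed
    also have "\<dots> = ennreal (exp (4 * th\<^sup>2 * q\<^sup>2))"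
      by (simp only: ennreal_mult[symmetric] exp_ge_zero mult_exp_exp) (simp add: power_mult_distrib)
    also have "\<dots> \<le> ennreal (exp (4 * th\<^sup>2))"
    proof -
      have "q\<^sup>2 \<le> 1" using q by (simp add: power_le_one)
      then have "4 * th\<^sup>2 * q\<^sup>2 \<le> 4 * th\<^sup>2 * 1" by (intro mult_left_mono) auto
      then show ?thesis by (intro ennreal_leI) auto
    qed
    finally show ?thesis .
  qed
  have ind: "indep_vars (\<lambda>_. borel) (\<lambda>j x. ennreal (exp (th * ((w j x)\<^sup>2 - q)))) K"
  proof -
    have "indep_vars (\<lambda>j. PiM (J \<times> {j}) (\<lambda>_. borel)) (\<lambda>j x. restrict (\<lambda>i. x i) (J \<times> {j})) K"
      by (rule indep_vars_restrict[OF indep_vars_gaussI])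
        (use assms(1,2) in \<open>auto simp: disjoint_family_on_def\<close>)
    then have "indep_vars (\<lambda>_. borel) (\<lambda>j x. (\<lambda>y. ennreal (exp (th * ((w j y)\<^sup>2 - q)))) (restrict (\<lambda>i. x i) (J \<times> {j}))) K"
    proof (rule indep_vars_compose2)
      fix j assume "j \<in> K"
      have "w j \<in> borel_measurable (PiM (J \<times> {j}) (\<lambda>_. borel))"
        unfolding w_def
        by (intro borel_measurable_sum borel_measurable_times borel_measurable_const measurable_component_singleton) auto
      then show "(\<lambda>y. ennreal (exp (th * ((w j y)\<^sup>2 - q)))) \<in> borel_measurable (PiM (J \<times> {j}) (\<lambda>_. borel))"
        by (rule borel_measurable_exp_square(1))
    qed
    moreover have "w j (restrict (\<lambda>i. x i) (J \<times> {j})) = w j x" for j x by (simp add: w_def)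
    ultimately show ?thesis by simp
  qed
  have "(\<integral>\<^sup>+x. ennreal (exp (th * ((\<Sum>j\<in>K. (\<Sum>i\<in>J. u i * x (i, j))\<^sup>2) - card K * (\<Sum>i\<in>J. (u i)\<^sup>2)))) \<partial>gaussI (J \<times> K))
    = (\<integral>\<^sup>+x. (\<Prod>j\<in>K. ennreal (exp (th * ((w j x)\<^sup>2 - q)))) \<partial>gaussI (J \<times> K))"
  proof (rule nn_integral_cong)
    fix x
    have "th * ((\<Sum>j\<in>K. (w j x)\<^sup>2) - card K * q) = (\<Sum>j\<in>K. th * ((w j x)\<^sup>2 - q))"
      by (simp add: sum_subtractf sum_distrib_left[symmetric])
    then have "exp (th * ((\<Sum>j\<in>K. (w j x)\<^sup>2) - card K * q)) = (\<Prod>j\<in>K. exp (th * ((w j x)\<^sup>2 - q)))"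
      using assms(2) by (simp only: exp_sum)
    then show "ennreal (exp (th * ((\<Sum>j\<in>K. (\<Sum>i\<in>J. u i * x (i, j))\<^sup>2) - card K * (\<Sum>i\<in>J. (u i)\<^sup>2))))
      = (\<Prod>j\<in>K. ennreal (exp (th * ((w j x)\<^sup>2 - q))))"
      by (simp add: prod_ennreal w_def q_def)
  qed
  also have "\<dots> = (\<Prod>j\<in>K. \<integral>\<^sup>+x. ennreal (exp (th * ((w j x)\<^sup>2 - q))) \<partial>gaussI (J \<times> K))"
    by (rule indep_vars_nn_integral[OF assms(2) ind]) auto
  also have "\<dots> \<le> (\<Prod>j\<in>K. ennreal (exp (4 * th\<^sup>2)))"
    by (intro prod_mono_ennreal one)
  also have "\<dots> = ennreal (exp (4 * th\<^sup>2 * card K))"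
  proof -
    have "exp (4 * th\<^sup>2) ^ card K = exp (4 * th\<^sup>2 * card K)"
      by (simp only: exp_of_nat2_mult)
    then show ?thesis by (simp add: ennreal_power)
  qed
  finally show ?thesis .
qed

section \<open>A negative moment of a Gaussian minor\<close>

text \<open>\<open>|z|^(-1/2)\<close> with an infinite value at 0, where the real
  \<open>powr\<close> gives 0. A finite integral then also shows that the argument is almost surely
  nonzero.\<close>

definition inv_root :: "real \<Rightarrow> ennreal" where
  "inv_root z = (if z = 0 then \<infinity> else ennreal (\<bar>z\<bar> powr (-1/2)))"

lemma measurable_inv_root [measurable]: "inv_root \<in> borel_measurable borel"
  unfolding inv_root_def[abs_def] by measurable

lemma inv_root_mult_le: "inv_root (x * y) \<le> inv_root x * inv_root y"
proof (cases "x = 0 \<or> y = 0")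
  case True
  then show ?thesis
    by (auto simp: inv_root_def ennreal_mult_top ennreal_top_mult top_unique)
next
  case False
  then show ?thesis
    by (simp add: inv_root_def abs_mult powr_mult ennreal_mult)
qed

lemma inv_root_le_1: "\<bar>z\<bar> \<ge> 1 \<Longrightarrow> inv_root z \<le> 1"
proof -
  assume z: "\<bar>z\<bar> \<ge> 1"
  then have "\<bar>z\<bar> powr (-1/2) \<le> 1 powr (-1/2)"
    by (intro powr_mono2') auto
  then show ?thesis using z by (auto simp: inv_root_def)
qed

lemma nn_integral_inv_root: "(\<integral>\<^sup>+z. inv_root z * indicator {-1..1} z \<partial>lborel) = 4"
proof -
  have half: "(\<integral>\<^sup>+z. inv_root z * indicator {0..1} z \<partial>lborel) = 2"
  proof -
    have "((\<lambda>x. x powr (-1/2)) has_integral (1 powr (-1/2+1) / (-1/2+1))) {0..1::real}"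
      by (rule has_integral_powr_from_0) auto
    then have "((\<lambda>x. x powr (-1/2)) has_integral 2) {0..1::real}" by simp
    then have "(\<integral>\<^sup>+x. ennreal (indicator {0..1} x * x powr (-1/2)) \<partial>lborel) = ennreal 2"
      by (intro nn_integral_has_integral_lebesgue) auto
    moreover have "(\<integral>\<^sup>+z. inv_root z * indicator {0..1} z \<partial>lborel)
       = (\<integral>\<^sup>+x. ennreal (indicator {0..1} x * x powr (-1/2)) \<partial>lborel)"
    proof (rule nn_integral_cong_AE)
      have "AE x in lborel. x \<noteq> (0::real)" by (rule AE_lborel_singleton)
      then show "AE x in lborel. inv_root x * indicator {0..1} x = ennreal (indicator {0..1} x * x powr (-1/2))"
        by eventually_elim (auto simp: inv_root_def indicator_def)
    qed
    ultimately show ?thesis by simp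
  qed
  have "(\<integral>\<^sup>+z. inv_root z * indicator {-1..0} z \<partial>lborel)
    = ennreal \<bar>-1\<bar> * (\<integral>\<^sup>+z. inv_root (0 + (-1) * z) * indicator {-1..0} (0 + (-1) * z) \<partial>lborel)"
    by (rule nn_integral_real_affine) auto
  also have "\<dots> = (\<integral>\<^sup>+z. inv_root z * indicator {0..1} z \<partial>lborel)"
    by (auto simp: inv_root_def indicator_def intro!: nn_integral_cong)
  finally have half': "(\<integral>\<^sup>+z. inv_root z * indicator {-1..0} z \<partial>lborel) = 2" using half by simp
  have "(\<integral>\<^sup>+z. inv_root z * indicator {-1..1} z \<partial>lborel)
    = (\<integral>\<^sup>+z. inv_root z * indicator {-1..0} z + inv_root z * indicator {0..1} z \<partial>lborel)"
  proof (rule nn_integral_cong_AE)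
    have "AE x in lborel. x \<noteq> (0::real)" by (rule AE_lborel_singleton)
    then show "AE x in lborel. inv_root x * indicator {-1..1} x = inv_root x * indicator {-1..0} x + inv_root x * indicator {0..1} x"
      by eventually_elim (auto simp: indicator_def)
  qed
  also have "\<dots> = 4" by (subst nn_integral_add) (auto simp: half half')
  finally show ?thesis .
qed

text \<open>Where \<open>|m + t z| > 1\<close> the integrand is at most the density; elsewhere the
  density is at most 1/2 and the substitution leaves \<open>4 / t\<close>. The bound is uniform in
  \<open>m\<close>, which permits integrating one entry at a time with the others frozen.\<close>

lemma gauss1_inv_root_le:
  assumes t: "t > 0"
  shows "(\<integral>\<^sup>+z. inv_root (m + t * z) \<partial>gauss1) \<le> ennreal (1 + 2 / t)"
proof -
  have dens: "std_normal_density z \<le> 1/2" for z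
  proof -
    have "2 \<le> sqrt (2 * pi)" using pi_ge_two by (intro real_le_rsqrt) auto
    then have "1 / sqrt (2 * pi) \<le> 1 / 2" by (intro divide_left_mono) auto
    moreover have "exp (- z\<^sup>2 / 2) \<le> 1" by simp
    ultimately have "1 / sqrt (2 * pi) * exp (- z\<^sup>2 / 2) \<le> 1 / 2 * 1" by (intro mult_mono) auto
    then show ?thesis by (simp add: std_normal_density_def)
  qed
  have "(\<integral>\<^sup>+z. inv_root (m + t * z) \<partial>gauss1) = (\<integral>\<^sup>+z. ennreal (std_normal_density z) * inv_root (m + t * z) \<partial>lborel)"
    by (rule nn_integral_gauss1) measurable
  also have "\<dots> \<le> (\<integral>\<^sup>+z. ennreal (std_normal_density z) + ennreal (1/2) * (inv_root (m + t * z) * indicator {-1..1} (m + t * z)) \<partial>lborel)"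
  proof (rule nn_integral_mono)
    fix z
    show "ennreal (std_normal_density z) * inv_root (m + t * z) \<le> ennreal (std_normal_density z) + ennreal (1/2) * (inv_root (m + t * z) * indicator {-1..1} (m + t * z))"
    proof (cases "\<bar>m + t * z\<bar> \<le> 1")
      case True
      have "ennreal (std_normal_density z) * inv_root (m + t * z) \<le> ennreal (1/2) * inv_root (m + t * z)"
        by (intro mult_right_mono ennreal_leI dens) auto
      also have "\<dots> \<le> ennreal (std_normal_density z) + ennreal (1/2) * inv_root (m + t * z)" by simp
      finally show ?thesis using True by (simp add: abs_le_iff indicator_def)
    next
      case False
      then have "inv_root (m + t * z) \<le> 1" by (intro inv_root_le_1) auto
      then have "ennreal (std_normal_density z) * inv_root (m + t * z) \<le> ennreal (std_normal_density z) * 1"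
        by (intro mult_left_mono) auto
      then show ?thesis by (simp add: add_increasing2)
    qed
  qed
  also have "\<dots> = 1 + ennreal (1/2) * (\<integral>\<^sup>+z. inv_root (m + t * z) * indicator {-1..1} (m + t * z) \<partial>lborel)"
    by (subst nn_integral_add) (auto simp: nn_integral_cmult nn_integral_normal_density)
  also have "(\<integral>\<^sup>+z. inv_root (m + t * z) * indicator {-1..1} (m + t * z) \<partial>lborel) = ennreal (4 / t)"
  proof -
    have "ennreal t * (\<integral>\<^sup>+z. inv_root (m + t * z) * indicator {-1..1} (m + t * z) \<partial>lborel) = 4"
      using nn_integral_real_affine[of "\<lambda>z. inv_root z * indicator {-1..1} z" t m] t nn_integral_inv_root by simp
    then have "ennreal (1 / t) * (ennreal t * (\<integral>\<^sup>+z. inv_root (m + t * z) * indicator {-1..1} (m + t * z) \<partial>lborel)) = ennreal (1 / t) * ennreal 4"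
      by simp
    then show ?thesis using t ennreal_mult[of "1 / t" 4]
      by (simp add: mult.assoc[symmetric] ennreal_mult[symmetric])
  qed
  also have "1 + ennreal (1/2) * ennreal (4 / t) = ennreal (1 + 2 / t)"
  proof -
    have "ennreal (1/2) * ennreal (4 / t) = ennreal (2 / t)"
      by (subst ennreal_mult[symmetric]) (use t in auto)
    then show ?thesis using t by simp
  qed
  finally show ?thesis .
qed

text \<open>Integrate first over the entry \<open>a\<close>, in which the minor is affine with slope proportional to
  the entry \<open>d\<close>, and then over \<open>d\<close>.\<close>

lemma gauss_minor_inv_root_le:
  fixes \<mu> :: "'i \<Rightarrow> real"
  assumes I: "finite I" and ix: "a \<in> I" "b \<in> I" "c \<in> I" "d \<in> I" "a \<noteq> b" "a \<noteq> c" "a \<noteq> d"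
    and t: "t > 0"
  defines "R \<equiv> \<lambda>x p. \<mu> p + t * x p"
  shows "(\<integral>\<^sup>+x. inv_root (R x a * R x d - R x b * R x c) \<partial>gaussI I) \<le> ennreal ((1 + 2 / t)\<^sup>2)"
proof -
  interpret product_sigma_finite "\<lambda>_::'i. gauss1" by (rule product_sigma_finite_gauss)
  define J where "J = I - {a}"
  have J: "finite J" "a \<notin> J" "I = insert a J" "b \<in> J" "c \<in> J" "d \<in> J" using I ix by (auto simp: J_def)
  have dI: "I = insert d (I - {d})" "J = insert d (J - {d})" using J by auto
  have [measurable]: "(\<lambda>x. R x p) \<in> borel_measurable (PiM K (\<lambda>_. gauss1))" if "p \<in> K" for p K
    unfolding R_def using that by measurable
  have inner: "(\<integral>\<^sup>+y. inv_root (R (x(a := y)) a * R (x(a := y)) d - R (x(a := y)) b * R (x(a := y)) c) \<partial>gauss1)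
      \<le> ennreal (1 + 2 / t) * inv_root (R x d)" for x
  proof (cases "R x d = 0")
    \<comment> \<open>The right-hand side is infinite here, so the division by \<open>R x d\<close>
      happens only where it is nonzero.\<close>
    case True
    then show ?thesis using t by (simp add: inv_root_def ennreal_mult_top)
  next
    case False
    have "inv_root (R (x(a := y)) a * R (x(a := y)) d - R (x(a := y)) b * R (x(a := y)) c)
        \<le> inv_root (R x d) * inv_root ((\<mu> a - R x b * R x c / R x d) + t * y)" for y
    proof -
      have "R (x(a := y)) a * R (x(a := y)) d - R (x(a := y)) b * R (x(a := y)) c
         = R x d * ((\<mu> a - R x b * R x c / R x d) + t * y)"
        using ix(5-7) False by (simp add: R_def field_simps)
      then show ?thesis using inv_root_mult_le by metis
    qed
    then have "(\<integral>\<^sup>+y. inv_root (R (x(a := y)) a * R (x(a := y)) d - R (x(a := y)) b * R (x(a := y)) c) \<partial>gauss1)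
       \<le> (\<integral>\<^sup>+y. inv_root (R x d) * inv_root ((\<mu> a - R x b * R x c / R x d) + t * y) \<partial>gauss1)"
      by (intro nn_integral_mono)
    also have "\<dots> = inv_root (R x d) * (\<integral>\<^sup>+y. inv_root ((\<mu> a - R x b * R x c / R x d) + t * y) \<partial>gauss1)"
      by (rule nn_integral_cmult) measurable
    also have "\<dots> \<le> inv_root (R x d) * ennreal (1 + 2 / t)"
      by (intro mult_left_mono gauss1_inv_root_le t) auto
    finally show ?thesis by (simp add: mult.commute)
  qed
  have "(\<integral>\<^sup>+x. inv_root (R x a * R x d - R x b * R x c) \<partial>gaussI I)
     = (\<integral>\<^sup>+x. (\<integral>\<^sup>+y. inv_root (R (x(a := y)) a * R (x(a := y)) d - R (x(a := y)) b * R (x(a := y)) c) \<partial>gauss1) \<partial>PiM J (\<lambda>_. gauss1))"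
    unfolding gaussI_def J(3)
  proof (rule product_nn_integral_insert[OF J(1,2)])
    have "a \<in> insert a J" "b \<in> insert a J" "c \<in> insert a J" "d \<in> insert a J" using J by auto
    note this[measurable]
    show "(\<lambda>x. inv_root (R x a * R x d - R x b * R x c)) \<in> borel_measurable (Pi\<^sub>M (insert a J) (\<lambda>_. gauss1))"
      by measurable
  qed
  also have "\<dots> \<le> (\<integral>\<^sup>+x. ennreal (1 + 2 / t) * inv_root (R x d) \<partial>PiM J (\<lambda>_. gauss1))"
    by (intro nn_integral_mono inner)
  also have "\<dots> = ennreal (1 + 2 / t) * (\<integral>\<^sup>+x. inv_root (R x d) \<partial>PiM J (\<lambda>_. gauss1))"
    using J by (intro nn_integral_cmult) measurable
  also have "(\<integral>\<^sup>+x. inv_root (R x d) \<partial>PiM J (\<lambda>_. gauss1))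
      = (\<integral>\<^sup>+x. (\<integral>\<^sup>+y. inv_root (R (x(d := y)) d) \<partial>gauss1) \<partial>PiM (J - {d}) (\<lambda>_. gauss1))"
  proof (subst dI(2), rule product_nn_integral_insert)
    have "d \<in> insert d (J - {d})" by auto
    note this[measurable]
    show "(\<lambda>x. inv_root (R x d)) \<in> borel_measurable (Pi\<^sub>M (insert d (J - {d})) (\<lambda>_. gauss1))"
      by measurable
  qed (use J in auto)
  also have "\<dots> \<le> (\<integral>\<^sup>+x. ennreal (1 + 2 / t) \<partial>PiM (J - {d}) (\<lambda>_. gauss1))"
    unfolding R_def fun_upd_same by (intro nn_integral_mono gauss1_inv_root_le t)
  also have "\<dots> = ennreal (1 + 2 / t)"
    using prob_space.emeasure_space_1[OF prob_space_gaussI[of "J - {d}"]] by (simp add: gaussI_def)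
  also have "ennreal (1 + 2 / t) * ennreal (1 + 2 / t) = ennreal ((1 + 2 / t)\<^sup>2)"
    unfolding power2_eq_square by (rule ennreal_mult[symmetric]) (use t in auto)
  finally show ?thesis by (simp add: mult_left_mono)
qed

section \<open>The residual of a spiked Gaussian matrix\<close>

lemma nsq_triangle: "sqrt (nsq c (\<lambda>j. x j + y j)) \<le> sqrt (nsq c x) + sqrt (nsq c y)"
  using L2_set_triangle_ineq[of x y "{..<c}"] by (simp add: L2_set_def nsq_def)

text \<open>Measurability calls for a supremum over countably many vectors that do not depend on
  \<open>R\<close>. A maximiser is approximated within \<open>1 / Suc k\<close> by a net point,
  which costs at most \<open>S / Suc k\<close> in the norm, and \<open>k\<close> tends to
  infinity.\<close>

lemma specnorm_eq_SUP:
  assumes c: "c > 0"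
  shows "specnorm r c R = (SUP w\<in>(\<Union>k. net (1 / Suc k) c). vnorm r (mvec r c R w))"
    and "bdd_above ((\<lambda>w. vnorm r (mvec r c R w)) ` (\<Union>k. net (1 / Suc k) c))"
proof -
  define T where "T = (\<Union>k::nat. net (1 / Suc k) c)"
  define S where "S = specnorm r c R"
  have S0: "S \<ge> 0" using specnorm_nonneg[OF c] by (simp add: S_def)
  have vle: "vnorm r (mvec r c R w) \<le> S * sqrt (nsq c w)" for w
    using nsq_mvec_le_specnorm[OF c, of r R w] S0
    by (metis S_def real_sqrt_abs abs_of_nonneg real_sqrt_le_iff real_sqrt_mult vnorm_eq)
  have up: "vnorm r (mvec r c R w) \<le> S" if "w \<in> T" for w
  proof -
    have "sqrt (nsq c w) \<le> 1" using that by (auto simp: T_def net_def)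
    then have "S * sqrt (nsq c w) \<le> S * 1" using S0 by (rule mult_left_mono)
    then show ?thesis using vle[of w] by simp
  qed
  have bdd: "bdd_above ((\<lambda>w. vnorm r (mvec r c R w)) ` T)"
    using up by (auto simp: bdd_above_def)
  obtain v where v: "nsq c v = 1" "S = sqrt (nsq r (mvec r c R v))"
    using specnorm_attained[OF c, of r R] by (metis S_def)
  have low: "S \<le> (SUP w\<in>T. vnorm r (mvec r c R w)) + S * (1 / Suc k)" for k
  proof -
    obtain w where w: "w \<in> net (1 / Suc k) c" "nsq c (\<lambda>i. v i - w i) \<le> (1 / Suc k)\<^sup>2"
      using net_approx[of "1 / Suc k" c v thesis] c v by simp
    have "S = sqrt (nsq r (mvec r c R (\<lambda>j. w j + (v j - w j))))" using v by simp
    also have "\<dots> \<le> sqrt (nsq r (mvec r c R w)) + sqrt (nsq r (mvec r c R (\<lambda>j. v j - w j)))"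
      unfolding mvec_add by (rule nsq_triangle)
    also have "\<dots> \<le> (SUP w\<in>T. vnorm r (mvec r c R w)) + S * (1 / Suc k)"
    proof (intro add_mono)
      show "sqrt (nsq r (mvec r c R w)) \<le> (SUP w\<in>T. vnorm r (mvec r c R w))"
        unfolding vnorm_eq[symmetric] by (rule cSUP_upper[OF _ bdd]) (use w in \<open>auto simp: T_def\<close>)
      have "sqrt (nsq c (\<lambda>i. v i - w i)) \<le> 1 / Suc k"
        using w(2) by (intro real_le_lsqrt) auto
      then have "S * sqrt (nsq c (\<lambda>i. v i - w i)) \<le> S * (1 / Suc k)"
        using S0 by (rule mult_left_mono)
      then show "sqrt (nsq r (mvec r c R (\<lambda>j. v j - w j))) \<le> S * (1 / Suc k)"
        using vle[of "\<lambda>i. v i - w i"] by (simp add: vnorm_eq)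
    qed
    finally show ?thesis .
  qed
  obtain w0 where "w0 \<in> net (1 / Suc 0) c"
    using net_approx[of "1 / Suc 0" c v thesis] c v by simp
  then have "T \<noteq> {}" unfolding T_def by blast
  then have "(SUP w\<in>T. vnorm r (mvec r c R w)) \<le> S" by (intro cSUP_least up)
  moreover have "S \<le> (SUP w\<in>T. vnorm r (mvec r c R w))"
  proof (rule LIMSEQ_le_const)
    show "(\<lambda>k. (SUP w\<in>T. vnorm r (mvec r c R w)) + S * (1 / Suc k)) \<longlonglongrightarrow> (SUP w\<in>T. vnorm r (mvec r c R w))"
      using tendsto_add[OF tendsto_const tendsto_mult_right_zero[OF LIMSEQ_Suc[OF lim_1_over_n]], of "SUP w\<in>T. vnorm r (mvec r c R w)" S]
      by simp
    show "\<exists>N. \<forall>k\<ge>N. S \<le> (SUP w\<in>T. vnorm r (mvec r c R w)) + S * (1 / Suc k)"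
      using low by blast
  qed
  ultimately show "specnorm r c R = (SUP w\<in>(\<Union>k. net (1 / Suc k) c). vnorm r (mvec r c R w))"
    and "bdd_above ((\<lambda>w. vnorm r (mvec r c R w)) ` (\<Union>k. net (1 / Suc k) c))"
    using bdd by (simp_all add: S_def T_def)
qed

lemma borel_measurable_specnorm:
  assumes c: "c > 0" and F: "\<And>i j. i < r \<Longrightarrow> j < c \<Longrightarrow> (\<lambda>x. F x i j) \<in> borel_measurable M"
  shows "(\<lambda>x. specnorm r c (F x)) \<in> borel_measurable M"
  unfolding specnorm_eq_SUP(1)[OF c]
proof (rule borel_measurable_cSUP)
  show "countable (\<Union>k::nat. net (1 / Suc k) c)"
    by (rule countable_UN[OF countableI_type]) (rule countable_finite[OF finite_card_net(1)[OF _ c]], simp)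
  show "(\<lambda>x. vnorm r (mvec r c (F x) w)) \<in> borel_measurable M" for w
  proof -
    have "(\<lambda>x. \<Sum>i<r. (\<Sum>j<c. F x i j * w j)\<^sup>2) \<in> borel_measurable M"
      by (intro borel_measurable_sum borel_measurable_power borel_measurable_times borel_measurable_const F) auto
    then show ?thesis
      unfolding vnorm_def mvec_def by (rule measurable_compose) measurable
  qed
  show "bdd_above ((\<lambda>w. vnorm r (mvec r c (F x) w)) ` (\<Union>k::nat. net (1 / Suc k) c))" for x
    by (rule specnorm_eq_SUP(2)[OF c])
qed

lemma borel_measurable_resid:
  assumes "c > 0" and F: "\<And>i j. i < r \<Longrightarrow> j < c \<Longrightarrow> (\<lambda>x. F x i j) \<in> borel_measurable M"
  shows "(\<lambda>x. resid r c (F x)) \<in> borel_measurable M"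
  unfolding resid_def fsq_def
  by (intro borel_measurable_diff borel_measurable_power borel_measurable_specnorm borel_measurable_sum assms) auto

lemma integrable_of_nn_integral_le:
  fixes f :: "'a \<Rightarrow> real"
  assumes [measurable]: "f \<in> borel_measurable M" and pos: "\<And>x. x \<in> space M \<Longrightarrow> f x \<ge> 0"
    and le: "(\<integral>\<^sup>+x. ennreal (f x) \<partial>M) \<le> ennreal c" and c: "c \<ge> 0"
  shows "integrable M f" "integral\<^sup>L M f \<le> c"
proof -
  show int: "integrable M f"
    by (rule integrableI_nonneg) (use pos le in \<open>auto intro: le_less_trans\<close>)
  show "integral\<^sup>L M f \<le> c"
    using nn_integral_eq_integral[OF int] pos le c by (simp add: ennreal_le_iff)
qed

section \<open>Bounds for logarithms near zero and at infinity\<close>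

lemma ln_le_plus: 
  assumes "y \<ge> (0::real)" "x \<ge> 1"
  shows "ln (x + y) \<le> ln x + ln (1 + y)"
proof -
  have "x + y \<le> x * (1 + y)"
    using mult_right_mono[of 1 x y] assms by (simp add: algebra_simps)
  then have "ln (x + y) \<le> ln (x * (1 + y))" using assms by simp
  also have "\<dots> = ln x + ln (1 + y)" using assms by (intro ln_mult_pos) auto
  finally show ?thesis .
qed

text \<open>\<open>ln w \<le> w\<close> at \<open>w = |z|^(-1/4)\<close>, followed by AM-GM with
  weight \<open>b\<close>. The free \<open>b\<close> trades a constant loss against the weight of
  the negative moment; the choice \<open>b = D^2\<close> in the final estimate leaves that moment a
  factor \<open>1 / D^2\<close>.\<close>

lemma neg_ln_sq_le:
  fixes z :: real
  assumes "z \<noteq> 0" "b > 0"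
  shows "- ln (z\<^sup>2) \<le> b / 2 + 32 * (\<bar>z\<bar> powr (-1/2)) / b"
proof -
  define w where "w = \<bar>z\<bar> powr (-1/4)"
  have w: "w > 0" using assms by (simp add: w_def)
  have w2: "w\<^sup>2 = \<bar>z\<bar> powr (-1/2)"
    by (simp add: w_def power2_eq_square flip: powr_add)
  have "ln w = - ln \<bar>z\<bar> / 4" using assms by (simp add: w_def ln_powr)
  moreover have "ln (z\<^sup>2) = 2 * ln \<bar>z\<bar>"
    using ln_realpow[of "\<bar>z\<bar>" 2] assms by simp
  ultimately have "- ln (z\<^sup>2) = 8 * ln w" by simp
  also have "\<dots> \<le> 8 * w" using ln_bound[OF w] by simp
  also have "\<dots> \<le> b / 2 + 32 * w\<^sup>2 / b"
  proof -
    have "0 \<le> (b - 8 * w)\<^sup>2 / (2 * b)" using assms by simp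
    also have "\<dots> = b / 2 + 32 * w\<^sup>2 / b - 8 * w"
      using assms by (simp add: power2_eq_square field_simps)
    finally show ?thesis by simp
  qed
  finally show ?thesis by (simp add: w2)
qed

lemma ln_le_split:
  fixes z :: real
  assumes "z \<ge> 1" "b > 0"
  shows "ln z \<le> b + z / b"
proof -
  have "ln z = 2 * ln (sqrt z)" using assms by (simp add: ln_sqrt)
  also have "\<dots> \<le> 2 * sqrt z" using ln_bound[of "sqrt z"] assms by simp
  also have "\<dots> \<le> b + z / b"
  proof -
    have "0 \<le> (b - sqrt z)\<^sup>2 / b" using assms by simp
    also have "\<dots> = b + z / b - 2 * sqrt z"
      using assms by (simp add: power2_diff field_simps power2_eq_square)
    finally show ?thesis by simp
  qed
  finally show ?thesis .
qed

text \<open>One configuration after division by \<open>sig\<close>: \<open>C\<close> is the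
  rearranged signal and \<open>s\<close> is \<open>lam / sig\<close>. No order between
  \<open>n\<close> and \<open>Q\<close> is fixed yet, so the true configuration enters without
  transposition.\<close>

locale spiked =
  fixes n Q :: nat and s :: real and C :: "nat \<Rightarrow> nat \<Rightarrow> real"
  assumes n2: "n \<ge> 2" and Q2: "Q \<ge> 2" and C1: "fsq n Q C = 1" and s0: "s > 0"
begin

definition "D = real n * real Q"
definition "tau = 1 / sqrt D"
definition "R w i j = s * C i j + tau * w (i, j)" for w :: "nat \<times> nat \<Rightarrow> real"
abbreviation "P \<equiv> gaussI ({..<n} \<times> {..<Q})"
definition "G w = (\<Sum>p\<in>{..<n} \<times> {..<Q}. (w p)\<^sup>2)" for w :: "nat \<times> nat \<Rightarrow> real"
definition "minor w = R w 0 0 * R w 1 1 - R w 0 1 * R w 1 0"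

sublocale prob_space P by (rule prob_space_gaussI)

lemma D4: "D \<ge> 4"
proof -
  have "real n * real Q \<ge> 2 * 2" using n2 Q2 by (intro mult_mono) auto
  then show ?thesis by (simp add: D_def)
qed

lemma tau_pos: "tau > 0" and tau_sq: "tau\<^sup>2 = 1 / D"
  using D4 by (auto simp: tau_def power_divide)

lemma fsq_R: "fsq n Q (R w) = s\<^sup>2 + 2 * s * tau * (\<Sum>i<n. \<Sum>j<Q. C i j * w (i, j)) + tau\<^sup>2 * G w"
proof -
  have "fsq n Q (R w) = s\<^sup>2 * fsq n Q C + 2 * s * tau * (\<Sum>i<n. \<Sum>j<Q. C i j * w (i, j)) + tau\<^sup>2 * (\<Sum>i<n. \<Sum>j<Q. (w (i, j))\<^sup>2)"
    by (simp add: fsq_def R_def power2_sum sum.distrib sum_distrib_left power_mult_distrib mult_ac)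
  then show ?thesis by (simp add: C1 G_def sum.cartesian_product')
qed

lemma fsq_R_le: "fsq n Q (R w) \<le> 2 * s\<^sup>2 + 2 * (tau\<^sup>2 * G w)"
proof -
  have "fsq n Q (R w) \<le> (\<Sum>i<n. \<Sum>j<Q. 2 * (s * C i j)\<^sup>2 + 2 * (tau * w (i, j))\<^sup>2)"
    unfolding fsq_def R_def
  proof (intro sum_mono)
    fix i j
    show "(s * C i j + tau * w (i, j))\<^sup>2 \<le> 2 * (s * C i j)\<^sup>2 + 2 * (tau * w (i, j))\<^sup>2"
      using zero_le_power2[of "s * C i j - tau * w (i, j)"] by (simp add: power2_sum power2_diff)
  qed
  also have "\<dots> = 2 * (s\<^sup>2 * fsq n Q C) + 2 * (tau\<^sup>2 * (\<Sum>i<n. \<Sum>j<Q. (w (i, j))\<^sup>2))"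
    by (simp add: fsq_def sum.distrib sum_distrib_left power_mult_distrib mult_ac)
  finally show ?thesis by (simp add: C1 G_def sum.cartesian_product')
qed

lemma measurable_coord: "i < n \<Longrightarrow> j < Q \<Longrightarrow> (\<lambda>w. w (i, j)) \<in> borel_measurable P"
  by (rule measurable_gaussI_component) auto

lemma measurable_R: "i < n \<Longrightarrow> j < Q \<Longrightarrow> (\<lambda>w. R w i j) \<in> borel_measurable P"
  unfolding R_def
  by (intro borel_measurable_add borel_measurable_times borel_measurable_const measurable_coord)

lemma measurable_G: "G \<in> borel_measurable P"
  unfolding G_def
  by (intro borel_measurable_sum borel_measurable_power measurable_gaussI_component)

lemma measurable_minor: "minor \<in> borel_measurable P"
  unfolding minor_def using n2 Q2
  by (intro borel_measurable_diff borel_measurable_times measurable_R) auto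

lemma gauss1_square: "(\<integral>\<^sup>+z. ennreal (z\<^sup>2) \<partial>gauss1) = 1"
proof -
  have "(\<integral>\<^sup>+z. ennreal (z\<^sup>2) \<partial>gauss1) = (\<integral>\<^sup>+z. ennreal (std_normal_density z * z ^ (2 * 1)) \<partial>lborel)"
    by (subst nn_integral_gauss1) (auto simp: ennreal_mult)
  also have "\<dots> = ennreal (fact (2 * 1) / (2 ^ 1 * fact 1))"
    using std_normal_moment_even[of 1] unfolding has_bochner_integral_iff
    by (subst nn_integral_eq_integral) (auto simp: normal_density_nonneg)
  finally show ?thesis by simp
qed

lemma integrable_G: "integrable P G" and expectation_G: "integral\<^sup>L P G = D"
proof -
  have one: "(\<integral>\<^sup>+w. ennreal ((w p)\<^sup>2) \<partial>P) = 1" if p: "p \<in> {..<n} \<times> {..<Q}" for p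
  proof -
    have "(\<integral>\<^sup>+w. ennreal ((w p)\<^sup>2) \<partial>P) = (\<integral>\<^sup>+z. ennreal (std_normal_density z) * ennreal (z\<^sup>2) \<partial>lborel)"
      by (rule distributed_nn_integral[OF distributed_gaussI_component[OF p], symmetric]) auto
    also have "\<dots> = 1" using gauss1_square by (subst (asm) nn_integral_gauss1) auto
    finally show ?thesis .
  qed
  have nn: "(\<integral>\<^sup>+w. ennreal (G w) \<partial>P) = ennreal D"
  proof -
    have "(\<integral>\<^sup>+w. ennreal (G w) \<partial>P) = (\<integral>\<^sup>+w. (\<Sum>p\<in>{..<n} \<times> {..<Q}. ennreal ((w p)\<^sup>2)) \<partial>P)"
      by (simp add: G_def sum_ennreal)
    also have "\<dots> = (\<Sum>p\<in>{..<n} \<times> {..<Q}. \<integral>\<^sup>+w. ennreal ((w p)\<^sup>2) \<partial>P)"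
      by (intro nn_integral_sum measurable_compose[OF _ measurable_ennreal] borel_measurable_power measurable_gaussI_component)
    also have "\<dots> = (\<Sum>p\<in>{..<n} \<times> {..<Q}. 1)" by (intro sum.cong refl one)
    also have "\<dots> = ennreal D"
      by (simp add: D_def ennreal_of_nat_eq_real_of_nat ennreal_mult)
    finally show ?thesis .
  qed
  have G0: "G w \<ge> 0" for w by (simp add: G_def sum_nonneg)
  show int: "integrable P G"
    by (rule integrable_of_nn_integral_le[OF measurable_G G0, of D]) (use nn D4 in auto)
  show "integral\<^sup>L P G = D"
    using nn_integral_eq_integral[OF int] G0 nn D4 by (simp add: integral_nonneg)
qed

lemma G_nonneg: "G w \<ge> 0" by (simp add: G_def sum_nonneg)

text \<open>Since \<open>1 / tau = sqrt D \<ge> 1\<close>, the bound \<open>(1 + 2 / tau)^2\<close>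
  is at most \<open>(3 * sqrt D)^2 = 9 * D\<close>. Finiteness of the integral excludes zeros of the
  minor almost surely.\<close>

lemma minor_root:
  shows "AE w in P. minor w \<noteq> 0"
    and "integrable P (\<lambda>w. \<bar>minor w\<bar> powr (-1/2))"
    and "(\<integral>w. \<bar>minor w\<bar> powr (-1/2) \<partial>P) \<le> 9 * D"
proof -
  have le: "(\<integral>\<^sup>+w. inv_root (minor w) \<partial>P) \<le> ennreal ((1 + 2 / tau)\<^sup>2)"
    unfolding minor_def R_def
    using gauss_minor_inv_root_le[of "{..<n} \<times> {..<Q}" "(0,0)" "(0,1)" "(1,0)" "(1,1)" tau "\<lambda>p. s * C (fst p) (snd p)"]
      n2 Q2 tau_pos by simp
  have bound: "(1 + 2 / tau)\<^sup>2 \<le> 9 * D"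
  proof -
    have "1 \<le> sqrt D" using D4 by simp
    then have "(1 + 2 * sqrt D)\<^sup>2 \<le> (3 * sqrt D)\<^sup>2" by (intro power_mono) auto
    then show ?thesis using D4 by (simp add: tau_def power_mult_distrib)
  qed
  have meas: "(\<lambda>w. inv_root (minor w)) \<in> borel_measurable P"
    by (rule measurable_compose[OF measurable_minor measurable_inv_root])
  have "AE w in P. inv_root (minor w) \<noteq> \<infinity>"
    by (rule nn_integral_PInf_AE[OF meas]) (use le in \<open>auto simp: top_unique\<close>)
  then show AE: "AE w in P. minor w \<noteq> 0"
    by eventually_elim (auto simp: inv_root_def)
  have "(\<integral>\<^sup>+w. ennreal (\<bar>minor w\<bar> powr (-1/2)) \<partial>P) = (\<integral>\<^sup>+w. inv_root (minor w) \<partial>P)"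
    by (rule nn_integral_cong_AE) (use AE in eventually_elim, simp add: inv_root_def)
  also have "\<dots> \<le> ennreal (9 * D)"
    by (rule order_trans[OF le]) (intro ennreal_leI bound)
  finally have le': "(\<integral>\<^sup>+w. ennreal (\<bar>minor w\<bar> powr (-1/2)) \<partial>P) \<le> ennreal (9 * D)" .
  have m: "(\<lambda>w. \<bar>minor w\<bar> powr (-1/2)) \<in> borel_measurable P"
    by (rule measurable_compose[OF measurable_minor]) measurable
  show "integrable P (\<lambda>w. \<bar>minor w\<bar> powr (-1/2))" "(\<integral>w. \<bar>minor w\<bar> powr (-1/2) \<partial>P) \<le> 9 * D"
    using integrable_of_nn_integral_le[OF m _ le'] D4 by auto
qed

text \<open>Covers the residual of \<open>R\<close> and, after transposition, that of a matrix with
  more rows than columns. The direction \<open>u\<close> is chosen separately for each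
  \<open>w\<close>, so measurability is asked of \<open>X\<close> alone and not of a choice of
  singular vectors.\<close>

definition rank_one_residual :: "((nat \<times> nat \<Rightarrow> real) \<Rightarrow> real) \<Rightarrow> bool" where
  "rank_one_residual X \<longleftrightarrow> X \<in> borel_measurable P \<and>
     (\<forall>w. \<exists>u. nsq n u = 1 \<and> X w = fsq n Q (R w) - nsq Q (mvec Q n (trp (R w)) u))"

lemma minor_sq_le:
  assumes "rank_one_residual X"
  shows "(minor w)\<^sup>2 \<le> fsq n Q (R w) * X w"
proof -
  obtain u where u: "nsq n u = 1" "X w = fsq n Q (R w) - nsq Q (mvec Q n (trp (R w)) u)"
    using assms by (auto simp: rank_one_residual_def)
  have "(minor w)\<^sup>2 = (trp (R w) 0 0 * trp (R w) 1 1 - trp (R w) 0 1 * trp (R w) 1 0)\<^sup>2"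
    by (simp add: minor_def trp_def mult.commute)
  also have "\<dots> \<le> fsq Q n (trp (R w)) * (fsq Q n (trp (R w)) - nsq Q (mvec Q n (trp (R w)) u))"
    by (rule minor_sq_le_residual[OF Q2 n2 u(1)])
  finally show ?thesis by (simp add: fsq_trp u(2))
qed

lemma residual_pos:
  assumes "rank_one_residual X" "minor w \<noteq> 0"
  shows "X w > 0"
proof -
  have "0 < fsq n Q (R w) * X w"
    using minor_sq_le[OF assms(1), of w] assms(2) by (meson less_le_trans zero_less_power2)
  then show ?thesis using fsq_nonneg[of n Q "R w"] by (simp add: zero_less_mult_iff)
qed

lemma residual_le: 
  assumes "rank_one_residual X"
  shows "X w \<le> 2 * s\<^sup>2 + 2 * (tau\<^sup>2 * G w)"
proof -
  obtain u where "X w = fsq n Q (R w) - nsq Q (mvec Q n (trp (R w)) u)"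
    using assms by (auto simp: rank_one_residual_def)
  then show ?thesis using fsq_R_le[of w] nsq_nonneg[of Q "mvec Q n (trp (R w)) u"] by linarith
qed

text \<open>Solving \<open>minor^2 \<le> |R|^2 * X\<close> for \<open>X\<close> leaves
  \<open>ln (minor^2)\<close> and an upper bound for \<open>ln |R|^2\<close>. All random terms come
  out divided by \<open>b\<close>.\<close>

lemma ln_residual_ge:
  assumes X: "rank_one_residual X" and w: "minor w \<noteq> 0" and b: "b > 0"
  shows "ln (X w) \<ge> - (b / 2 + 32 * (\<bar>minor w\<bar> powr (-1/2)) / b) - ln (1 + 2 * s\<^sup>2)
    - (b + (1 + 2 * (tau\<^sup>2 * G w)) / b)"
proof -
  have X0: "X w > 0" by (rule residual_pos[OF X w])
  have h: "tau\<^sup>2 * G w \<ge> 0" using G_nonneg by simp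
  have "(minor w)\<^sup>2 \<le> fsq n Q (R w) * X w" by (rule minor_sq_le[OF X])
  also have "\<dots> \<le> (1 + 2 * s\<^sup>2 + 2 * (tau\<^sup>2 * G w)) * X w"
    using fsq_R_le[of w] X0 by (intro mult_right_mono) auto
  finally have "ln ((minor w)\<^sup>2) \<le> ln ((1 + 2 * s\<^sup>2 + 2 * (tau\<^sup>2 * G w)) * X w)"
    using w by (intro ln_mono) auto
  also have "\<dots> = ln (1 + 2 * s\<^sup>2 + 2 * (tau\<^sup>2 * G w)) + ln (X w)"
  proof (rule ln_mult_pos)
    show "0 < 1 + 2 * s\<^sup>2 + 2 * (tau\<^sup>2 * G w)"
      using h zero_le_power2[of s] by linarith
  qed (rule X0)
  finally have 1: "ln (X w) \<ge> ln ((minor w)\<^sup>2) - ln (1 + 2 * s\<^sup>2 + 2 * (tau\<^sup>2 * G w))" by simp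
  have 2: "ln (1 + 2 * s\<^sup>2 + 2 * (tau\<^sup>2 * G w)) \<le> ln (1 + 2 * s\<^sup>2) + ln (1 + 2 * (tau\<^sup>2 * G w))"
    using h by (intro ln_le_plus) (auto intro: add_pos_nonneg)
  have 3: "ln (1 + 2 * (tau\<^sup>2 * G w)) \<le> b + (1 + 2 * (tau\<^sup>2 * G w)) / b"
    using h b by (intro ln_le_split) auto
  show ?thesis using 1 2 3 neg_ln_sq_le[OF w b] by linarith
qed

lemma residual_AE_pos: "rank_one_residual X \<Longrightarrow> AE w in P. X w > 0"
  using minor_root(1) by eventually_elim (rule residual_pos)

text \<open>Dominated from above through \<open>ln x \<le> x\<close> and from below by
  \<open>ln_residual_ge\<close> with \<open>b = 1\<close>.\<close>

lemma integrable_ln_residual: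
  assumes X: "rank_one_residual X"
  shows "integrable P (\<lambda>w. ln (X w))"
proof (rule Bochner_Integration.integrable_bound)
  let ?f = "\<lambda>w. 1/2 + 32 * (\<bar>minor w\<bar> powr (-1/2)) + ln (1 + 2 * s\<^sup>2) + (2 + 2 * (tau\<^sup>2 * G w)) + (2 * s\<^sup>2 + 2 * (tau\<^sup>2 * G w))"
  show "integrable P ?f"
    using minor_root(2) integrable_G by (intro Bochner_Integration.integrable_add integrable_mult_right) auto
  show "(\<lambda>w. ln (X w)) \<in> borel_measurable P"
    by (rule measurable_compose[OF _ borel_measurable_ln]) (use X in \<open>auto simp: rank_one_residual_def\<close>)
  show "AE w in P. norm (ln (X w)) \<le> norm (?f w)"
    using minor_root(1)
  proof eventually_elim
    case (elim w)
    have X0: "X w > 0" by (rule residual_pos[OF X elim])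
    have h: "tau\<^sup>2 * G w \<ge> 0" using G_nonneg by simp
    have p: "\<bar>minor w\<bar> powr (-1/2) \<ge> 0" by simp
    have l: "ln (1 + 2 * s\<^sup>2) \<ge> 0" by simp
    have "ln (X w) \<le> 2 * s\<^sup>2 + 2 * (tau\<^sup>2 * G w)"
      using ln_bound[OF X0] residual_le[OF X, of w] by linarith
    moreover have "ln (X w) \<ge> - (1 / 2 + 32 * (\<bar>minor w\<bar> powr (-1/2))) - ln (1 + 2 * s\<^sup>2) - (1 + (1 + 2 * (tau\<^sup>2 * G w)))"
      using ln_residual_ge[OF X elim, of 1] by simp
    ultimately have "ln (X w) \<le> ?f w" "- ln (X w) \<le> ?f w"
      using h p l zero_le_power2[of s] by linarith+
    then have "\<bar>ln (X w)\<bar> \<le> ?f w" by (simp only: abs_le_iff)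
    then show ?case unfolding real_norm_def by (rule order_trans[OF _ abs_ge_self])
  qed
qed

end

section \<open>Concentration over the net\<close>

text \<open>\<open>\<Psi>\<close> plays two roles below: it bounds the mean of the supremum of the family, and, being at least \<open>1\<close>
  when some member exceeds \<open>T\<close>, it replaces the indicator of that event.\<close>

lemma exp_moment_dominate:
  fixes h :: "'k \<Rightarrow> 'a \<Rightarrow> real" and th m T :: real
  assumes K: "finite K" and meas: "\<And>k. k \<in> K \<Longrightarrow> h k \<in> borel_measurable M"
    and up: "\<And>k. k \<in> K \<Longrightarrow> (\<integral>\<^sup>+x. ennreal (exp (th * h k x)) \<partial>M) \<le> ennreal m"
    and lo: "\<And>k. k \<in> K \<Longrightarrow> (\<integral>\<^sup>+x. ennreal (exp (- th * h k x)) \<partial>M) \<le> ennreal m"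
    and th: "th > 0" and m: "m \<ge> 0"
  obtains \<Psi> where "integrable M \<Psi>" "\<And>x. \<Psi> x \<ge> 0" "integral\<^sup>L M \<Psi> \<le> 2 * card K * m * exp (- th * T)"
    "\<And>k x. k \<in> K \<Longrightarrow> \<bar>h k x\<bar> \<le> T + \<Psi> x / th"
    "\<And>k x. k \<in> K \<Longrightarrow> \<Psi> x < 1 \<Longrightarrow> \<bar>h k x\<bar> \<le> T"
proof -
  define g where "g k x = exp (th * h k x) + exp (- th * h k x)" for k x
  define \<Psi> where "\<Psi> x = exp (- th * T) * (\<Sum>k\<in>K. g k x)" for x
  have g0: "g k x \<ge> 0" for k x by (simp add: g_def add_nonneg_nonneg)
  have int: "integrable M (\<lambda>x. exp (th * h k x))" "(\<integral>x. exp (th * h k x) \<partial>M) \<le> m"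
    "integrable M (\<lambda>x. exp (- th * h k x))" "(\<integral>x. exp (- th * h k x) \<partial>M) \<le> m" if k: "k \<in> K" for k
  proof -
    have m1: "(\<lambda>x. exp (th * h k x)) \<in> borel_measurable M" "(\<lambda>x. exp (- th * h k x)) \<in> borel_measurable M"
      by (rule measurable_compose[OF meas[OF k]], measurable)+
    show "integrable M (\<lambda>x. exp (th * h k x))" "(\<integral>x. exp (th * h k x) \<partial>M) \<le> m"
      using integrable_of_nn_integral_le[OF m1(1) _ up[OF k] m] by simp_all
    show "integrable M (\<lambda>x. exp (- th * h k x))" "(\<integral>x. exp (- th * h k x) \<partial>M) \<le> m"
      using integrable_of_nn_integral_le[OF m1(2) _ lo[OF k] m] by simp_all
  qed
  have gi: "integrable M (g k)" "integral\<^sup>L M (g k) \<le> 2 * m" if "k \<in> K" for k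
  proof -
    show "integrable M (g k)" unfolding g_def using int[OF that] by (intro Bochner_Integration.integrable_add)
    have "integral\<^sup>L M (g k) = (\<integral>x. exp (th * h k x) \<partial>M) + (\<integral>x. exp (- th * h k x) \<partial>M)"
      unfolding g_def using int[OF that] by (intro Bochner_Integration.integral_add)
    then show "integral\<^sup>L M (g k) \<le> 2 * m" using int[OF that] by simp
  qed
  \<comment> \<open>\<open>exp (th * |h k x|)\<close> is at most the sum of the two exponentials in
    \<open>g k\<close>, so a single function dominates the whole family with both signs. The two
    pointwise claims then follow from \<open>1 + x \<le> exp x\<close> and from the monotonicity of
    \<open>exp\<close>.\<close>
  have key: "exp (th * (\<bar>h k x\<bar> - T)) \<le> \<Psi> x" if k: "k \<in> K" for k x
  proof -
    have "exp (th * \<bar>h k x\<bar>) \<le> g k x"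
      by (cases "h k x \<ge> 0") (auto simp: g_def)
    also have "\<dots> \<le> (\<Sum>k\<in>K. g k x)" using k K g0 by (intro member_le_sum) auto
    finally have "exp (- th * T) * exp (th * \<bar>h k x\<bar>) \<le> \<Psi> x"
      unfolding \<Psi>_def by (intro mult_left_mono) auto
    then show ?thesis by (simp only: mult_exp_exp) (simp add: right_diff_distrib)
  qed
  show thesis
  proof (rule that)
    show "integrable M \<Psi>"
      unfolding \<Psi>_def by (intro integrable_mult_right Bochner_Integration.integrable_sum gi)
    show "\<Psi> x \<ge> 0" for x unfolding \<Psi>_def by (intro mult_nonneg_nonneg sum_nonneg g0) auto
    have "integral\<^sup>L M \<Psi> = exp (- th * T) * (\<Sum>k\<in>K. integral\<^sup>L M (g k))"
      unfolding \<Psi>_def using gi(1) by (simp add: Bochner_Integration.integral_sum)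
    also have "\<dots> \<le> exp (- th * T) * (\<Sum>k\<in>K. 2 * m)"
      by (intro mult_left_mono sum_mono gi) auto
    finally show "integral\<^sup>L M \<Psi> \<le> 2 * card K * m * exp (- th * T)" by (simp add: mult_ac)
    fix k x assume k: "k \<in> K"
    have "1 + th * (\<bar>h k x\<bar> - T) \<le> \<Psi> x"
      using key[OF k, of x] exp_ge_add_one_self[of "th * (\<bar>h k x\<bar> - T)"] by linarith
    then have "th * (\<bar>h k x\<bar> - T) \<le> \<Psi> x" by linarith
    then show "\<bar>h k x\<bar> \<le> T + \<Psi> x / th" using th by (simp add: field_simps)
    assume "\<Psi> x < 1"
    then have "exp (th * (\<bar>h k x\<bar> - T)) < exp 0" using key[OF k, of x] by (simp only: exp_zero)
    then have "th * (\<bar>h k x\<bar> - T) < 0" by (simp only: exp_less_cancel_iff)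
    then show "\<bar>h k x\<bar> \<le> T" using th by (simp add: mult_less_0_iff)
  qed
qed

lemma gauss_exp_chi_square:
  fixes th :: real
  assumes "finite I" and th: "\<bar>th\<bar> \<le> 1/4"
  shows "(\<integral>\<^sup>+x. ennreal (exp (th * ((\<Sum>p\<in>I. (x p)\<^sup>2) - card I))) \<partial>gaussI I) \<le> ennreal (exp (4 * th\<^sup>2 * card I))"
proof -
  interpret product_sigma_finite "\<lambda>_. gauss1" by (rule product_sigma_finite_gauss)
  have one: "(\<integral>\<^sup>+z. ennreal (exp (th * (z\<^sup>2 - 1))) \<partial>gauss1) \<le> ennreal (exp (4 * th\<^sup>2))"
  proof -
    have "(\<integral>\<^sup>+z. ennreal (exp (th * (z\<^sup>2 - 1))) \<partial>gauss1)
       = (\<integral>\<^sup>+z. ennreal (exp (- th)) * (ennreal (normal_density 0 1 z) * ennreal (exp (th * z\<^sup>2))) \<partial>lborel)"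
    proof (subst nn_integral_gauss1)
      have "exp (th * (z\<^sup>2 - 1)) = exp (- th) * exp (th * z\<^sup>2)" for z
        by (simp only: mult_exp_exp) (simp add: algebra_simps)
      then show "(\<integral>\<^sup>+z. ennreal (std_normal_density z) * ennreal (exp (th * (z\<^sup>2 - 1))) \<partial>lborel)
        = (\<integral>\<^sup>+z. ennreal (exp (- th)) * (ennreal (normal_density 0 1 z) * ennreal (exp (th * z\<^sup>2))) \<partial>lborel)"
        by (simp only: ennreal_mult exp_ge_zero mult.left_commute)
    qed measurable
    also have "\<dots> = ennreal (exp (- th)) * ennreal (1 / sqrt (1 - 2 * th * 1\<^sup>2))"
      using th by (subst nn_integral_cmult, measurable, subst normal_exp_square) auto
    also have "\<dots> \<le> ennreal (exp (- th)) * ennreal (exp (th + 4 * th\<^sup>2))"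
      using inverse_sqrt_le_exp[OF th] by (intro mult_left_mono ennreal_leI) auto
    also have "\<dots> = ennreal (exp (4 * th\<^sup>2))"
      by (simp only: ennreal_mult[symmetric] exp_ge_zero mult_exp_exp) simp
    finally show ?thesis .
  qed
  have "(\<integral>\<^sup>+x. ennreal (exp (th * ((\<Sum>p\<in>I. (x p)\<^sup>2) - card I))) \<partial>gaussI I)
    = (\<integral>\<^sup>+x. (\<Prod>p\<in>I. ennreal (exp (th * ((x p)\<^sup>2 - 1)))) \<partial>PiM I (\<lambda>_. gauss1))"
    unfolding gaussI_def
  proof (rule nn_integral_cong)
    fix x :: "'a \<Rightarrow> real"
    have "th * ((\<Sum>p\<in>I. (x p)\<^sup>2) - card I) = (\<Sum>p\<in>I. th * ((x p)\<^sup>2 - 1))"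
      by (simp add: sum_subtractf sum_distrib_left[symmetric])
    then have "exp (th * ((\<Sum>p\<in>I. (x p)\<^sup>2) - card I)) = (\<Prod>p\<in>I. exp (th * ((x p)\<^sup>2 - 1)))"
      using assms(1) by (simp only: exp_sum)
    then show "ennreal (exp (th * ((\<Sum>p\<in>I. (x p)\<^sup>2) - card I))) = (\<Prod>p\<in>I. ennreal (exp (th * ((x p)\<^sup>2 - 1))))"
      by (simp add: prod_ennreal)
  qed
  also have "\<dots> = (\<Prod>p\<in>I. \<integral>\<^sup>+z. ennreal (exp (th * (z\<^sup>2 - 1))) \<partial>gauss1)"
    using assms(1) by (intro product_nn_integral_prod) auto
  also have "\<dots> \<le> (\<Prod>p\<in>I. ennreal (exp (4 * th\<^sup>2)))"
    by (intro prod_mono_ennreal one)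
  also have "\<dots> = ennreal (exp (4 * th\<^sup>2 * card I))"
  proof -
    have "exp (4 * th\<^sup>2) ^ card I = exp (4 * th\<^sup>2 * card I)" by (simp only: exp_of_nat2_mult)
    then show ?thesis by (simp add: ennreal_power)
  qed
  finally show ?thesis .
qed

text \<open>\<open>n \<le> Q\<close> gives \<open>n \<le> sqrt D\<close>, which bounds the logarithm
  of the size of the net. \<open>D \<ge> 256\<close> gives \<open>q4 \<ge> 4\<close>, so that
  \<open>1 / q4\<close> is an admissible exponent for the chi-square moments.\<close>

locale spiked_wide = spiked +
  assumes nQ: "n \<le> Q" and D256: "real n * real Q \<ge> 256"
begin

text \<open>\<open>lin\<close> and \<open>quad\<close> are the fluctuations of
  \<open>|R' u|^2\<close>: the cross term of signal and noise, and the noise energy minus its mean.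
  \<open>lin0\<close> and \<open>quad0\<close> play the same role for the Frobenius norm;
  \<open>rt\<close> and \<open>q4\<close> are \<open>D^(1/2)\<close> and
  \<open>D^(1/4)\<close>.\<close>

definition "cu u = mvec Q n (trp C) u"
definition "lin u w = (\<Sum>i<n. \<Sum>j<Q. (u i * cu u j) * w (i, j))" for w :: "nat \<times> nat \<Rightarrow> real"
definition "quad u w = (\<Sum>j<Q. (\<Sum>i<n. u i * w (i, j))\<^sup>2) - real Q * nsq n u" for w :: "nat \<times> nat \<Rightarrow> real"
definition "lin0 w = (\<Sum>i<n. \<Sum>j<Q. C i j * w (i, j))" for w :: "nat \<times> nat \<Rightarrow> real"
definition "quad0 w = G w - D"
definition "rt = sqrt D"
definition "q4 = sqrt rt"

lemma D_ge: "D \<ge> 256" using D256 by (simp add: D_def)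

lemma rt_sq: "rt\<^sup>2 = D" and rt_ge: "rt \<ge> 16" and q4_sq: "q4\<^sup>2 = rt" and q4_ge: "q4 \<ge> 4"
  and n_le_rt: "real n \<le> rt"
proof -
  show 1: "rt\<^sup>2 = D" using D_ge by (simp add: rt_def)
  show 2: "rt \<ge> 16" unfolding rt_def by (rule real_le_rsqrt) (use D_ge in simp)
  show "q4\<^sup>2 = rt" using 2 by (simp add: q4_def)
  show "q4 \<ge> 4" unfolding q4_def by (rule real_le_rsqrt) (use 2 in simp)
  have "real n * real n \<le> real n * real Q" using nQ by (intro mult_left_mono) auto
  then show "real n \<le> rt" unfolding rt_def by (intro real_le_rsqrt) (simp add: power2_eq_square D_def)
qed

lemma tau_rt: "tau = 1 / rt" by (simp add: tau_def rt_def)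

lemma nsq_cu_le: "nsq Q (cu u) \<le> nsq n u"
  using nsq_mvec_le_fsq[of Q n "trp C" u] C1 by (simp add: cu_def fsq_trp)

text \<open>\<open>qf_le_net\<close> asks for one symmetric form. \<open>lin\<close> is quadratic in
  \<open>v\<close> because \<open>cu v\<close> is linear in \<open>v\<close>; its two copies, with
  \<open>i\<close> and \<open>k\<close> exchanged in one, make the matrix symmetric.\<close>

lemma quadratic_identity:
  "2 * s * tau * lin v w + tau\<^sup>2 * quad v w = qf n (\<lambda>i k. s * tau * (\<Sum>j<Q. w (i, j) * C k j + w (k, j) * C i j)
      + tau\<^sup>2 * ((\<Sum>j<Q. w (i, j) * w (k, j)) - (if i = k then real Q else 0))) v"
proof -
  have lin: "lin v w = (\<Sum>i<n. \<Sum>k<n. (\<Sum>j<Q. w (i, j) * C k j) * v i * v k)"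
  proof -
    have "lin v w = (\<Sum>i<n. \<Sum>j<Q. \<Sum>k<n. w (i, j) * C k j * v i * v k)"
      by (simp add: lin_def cu_def mvec_def trp_def sum_distrib_left sum_distrib_right mult_ac)
    also have "\<dots> = (\<Sum>i<n. \<Sum>k<n. \<Sum>j<Q. w (i, j) * C k j * v i * v k)"
      by (intro sum.cong refl sum.swap)
    finally show ?thesis by (simp add: sum_distrib_right)
  qed
  have lin': "lin v w = (\<Sum>i<n. \<Sum>k<n. (\<Sum>j<Q. w (k, j) * C i j) * v i * v k)"
    unfolding lin by (subst sum.swap) (simp add: mult_ac)
  have quad: "quad v w = (\<Sum>i<n. \<Sum>k<n. (\<Sum>j<Q. w (i, j) * w (k, j)) * v i * v k) - (\<Sum>i<n. \<Sum>k<n. (if i = k then real Q else 0) * v i * v k)"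
  proof -
    have "(\<Sum>j<Q. (\<Sum>i<n. v i * w (i, j))\<^sup>2) = (\<Sum>j<Q. \<Sum>i<n. \<Sum>k<n. w (i, j) * w (k, j) * v i * v k)"
      by (simp add: power2_eq_square sum_product mult_ac)
    also have "\<dots> = (\<Sum>i<n. \<Sum>j<Q. \<Sum>k<n. w (i, j) * w (k, j) * v i * v k)"
      by (rule sum.swap)
    also have "\<dots> = (\<Sum>i<n. \<Sum>k<n. \<Sum>j<Q. w (i, j) * w (k, j) * v i * v k)"
      by (intro sum.cong refl sum.swap)
    also have "\<dots> = (\<Sum>i<n. \<Sum>k<n. (\<Sum>j<Q. w (i, j) * w (k, j)) * v i * v k)"
      by (simp add: sum_distrib_right)
    finally have "(\<Sum>j<Q. (\<Sum>i<n. v i * w (i, j))\<^sup>2) = (\<Sum>i<n. \<Sum>k<n. (\<Sum>j<Q. w (i, j) * w (k, j)) * v i * v k)" .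
    moreover have "(\<Sum>i<n. \<Sum>k<n. (if i = k then real Q else 0) * v i * v k) = real Q * nsq n v"
      by (simp add: nsq_def sum_distrib_left power2_eq_square mult.assoc if_distrib[of "\<lambda>x. x * _"] cong: if_cong)
    ultimately show ?thesis by (simp add: quad_def)
  qed
  have "2 * s * tau * lin v w + tau\<^sup>2 * quad v w = s * tau * (lin v w + lin v w) + tau\<^sup>2 * quad v w" by simp
  also have "\<dots> = s * tau * ((\<Sum>i<n. \<Sum>k<n. (\<Sum>j<Q. w (i, j) * C k j) * v i * v k) + (\<Sum>i<n. \<Sum>k<n. (\<Sum>j<Q. w (k, j) * C i j) * v i * v k))
     + tau\<^sup>2 * ((\<Sum>i<n. \<Sum>k<n. (\<Sum>j<Q. w (i, j) * w (k, j)) * v i * v k) - (\<Sum>i<n. \<Sum>k<n. (if i = k then real Q else 0) * v i * v k))"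
    using lin lin' quad by simp
  also have "\<dots> = (\<Sum>i<n. \<Sum>k<n. s * tau * ((\<Sum>j<Q. w (i, j) * C k j) * v i * v k + (\<Sum>j<Q. w (k, j) * C i j) * v i * v k)
      + tau\<^sup>2 * ((\<Sum>j<Q. w (i, j) * w (k, j)) * v i * v k - (if i = k then real Q else 0) * v i * v k))"
    by (simp only: sum.distrib sum_subtractf sum_distrib_left[symmetric])
  also have "\<dots> = qf n (\<lambda>i k. s * tau * (\<Sum>j<Q. w (i, j) * C k j + w (k, j) * C i j)
      + tau\<^sup>2 * ((\<Sum>j<Q. w (i, j) * w (k, j)) - (if i = k then real Q else 0))) v"
    unfolding qf_def by (intro sum.cong refl) (simp only: sum.distrib, simp add: algebra_simps)
  finally show ?thesis .
qed

lemma nsq_trp_R: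
  "nsq Q (mvec Q n (trp (R w)) u) = s\<^sup>2 * nsq Q (cu u) + tau\<^sup>2 * (real Q * nsq n u) + (2 * s * tau * lin u w + tau\<^sup>2 * quad u w)"
proof -
  define y where "y j = (\<Sum>i<n. u i * w (i, j))" for j
  have "mvec Q n (trp (R w)) u j = s * cu u j + tau * y j" for j
    by (simp add: y_def mvec_def trp_def R_def cu_def sum.distrib sum_distrib_left algebra_simps)
  then have "nsq Q (mvec Q n (trp (R w)) u) = s\<^sup>2 * nsq Q (cu u) + 2 * s * tau * (\<Sum>j<Q. cu u j * y j) + tau\<^sup>2 * nsq Q y"
    by (simp add: nsq_def power2_sum sum.distrib sum_distrib_left power_mult_distrib mult_ac)
  moreover have "(\<Sum>j<Q. cu u j * y j) = lin u w"
    unfolding lin_def y_def by (subst sum.swap) (simp add: sum_distrib_left mult_ac)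
  ultimately show ?thesis by (simp add: quad_def nsq_def[of Q y] y_def algebra_simps)
qed

text \<open>The Frobenius norm contributes \<open>2 * s * tau * lin0 + tau^2 * quad0\<close>, and
  passing from the net to \<open>u\<close> doubles \<open>2 * s * tau * b1 + tau^2 * b2\<close>;
  hence the factors 6 = 2 + 4 and 3 = 1 + 2. The loss \<open>1 / n\<close> is
  \<open>tau^2 * Q\<close>.\<close>

lemma residual_lower_bound:
  assumes X: "rank_one_residual X" and ph: "\<And>u. nsq n u = 1 \<Longrightarrow> nsq Q (cu u) \<le> ph"
    and lin: "\<And>v. v \<in> net (1/4) n \<Longrightarrow> \<bar>lin v w\<bar> \<le> b1" and lin0: "\<bar>lin0 w\<bar> \<le> b1"
    and quad: "\<And>v. v \<in> net (1/4) n \<Longrightarrow> \<bar>quad v w\<bar> \<le> b2" and quad0: "\<bar>quad0 w\<bar> \<le> b2"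
  shows "X w \<ge> s\<^sup>2 * (1 - ph) + 1 - 1 / n - (6 * s * tau * b1 + 3 * tau\<^sup>2 * b2)"
proof -
  obtain u where u: "nsq n u = 1" "X w = fsq n Q (R w) - nsq Q (mvec Q n (trp (R w)) u)"
    using X by (auto simp: rank_one_residual_def)
  let ?H = "\<lambda>i k. s * tau * (\<Sum>j<Q. w (i, j) * C k j + w (k, j) * C i j)
      + tau\<^sup>2 * ((\<Sum>j<Q. w (i, j) * w (k, j)) - (if i = k then real Q else 0))"
  have st: "0 \<le> 2 * s * tau" "0 \<le> tau\<^sup>2" using s0 tau_pos by auto
  have "\<bar>qf n ?H u\<bar> \<le> 2 * (2 * s * tau * b1 + tau\<^sup>2 * b2)"
  proof (rule qf_le_net[OF _ _ _ u(1)])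
    show "n > 0" using n2 by simp
    show "?H i k = ?H k i" for i k by (simp add: mult.commute add.commute)
    fix v assume v: "v \<in> net (1/4) n"
    have "\<bar>qf n ?H v\<bar> \<le> \<bar>2 * s * tau * lin v w\<bar> + \<bar>tau\<^sup>2 * quad v w\<bar>"
      unfolding quadratic_identity[symmetric] by (rule abs_triangle_ineq)
    also have "\<dots> = 2 * s * tau * \<bar>lin v w\<bar> + tau\<^sup>2 * \<bar>quad v w\<bar>"
      using st by (simp only: abs_mult[of "2 * s * tau"] abs_mult[of "tau\<^sup>2"] abs_of_nonneg)
    also have "\<dots> \<le> 2 * s * tau * b1 + tau\<^sup>2 * b2"
      using st lin[OF v] quad[OF v] by (intro add_mono mult_left_mono)
    finally show "\<bar>qf n ?H v\<bar> \<le> 2 * s * tau * b1 + tau\<^sup>2 * b2" .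
  qed
  then have qu: "2 * s * tau * lin u w + tau\<^sup>2 * quad u w \<le> 2 * (2 * s * tau * b1 + tau\<^sup>2 * b2)"
    unfolding quadratic_identity by linarith
  have "- b1 \<le> lin0 w" "- b2 \<le> quad0 w" using lin0 quad0 by linarith+
  then have "2 * s * tau * (- b1) \<le> 2 * s * tau * lin0 w" "tau\<^sup>2 * (- b2) \<le> tau\<^sup>2 * quad0 w"
    using st by (simp_all only: mult_left_mono)
  moreover have "tau\<^sup>2 * G w = 1 + tau\<^sup>2 * quad0 w"
    using D_ge by (simp add: quad0_def tau_sq field_simps)
  moreover have "tau\<^sup>2 * real Q = 1 / n"
    using D_ge n2 Q2 by (simp add: tau_sq D_def)
  moreover have "s\<^sup>2 * nsq Q (cu u) \<le> s\<^sup>2 * ph" by (intro mult_left_mono ph u) auto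
  moreover have "X w = s\<^sup>2 + 2 * s * tau * lin0 w + tau\<^sup>2 * G w
      - (s\<^sup>2 * nsq Q (cu u) + tau\<^sup>2 * real Q + (2 * s * tau * lin u w + tau\<^sup>2 * quad u w))"
    by (simp add: u fsq_R nsq_trp_R lin0_def)
  moreover have "s\<^sup>2 * (1 - ph) = s\<^sup>2 - s\<^sup>2 * ph" by (simp add: right_diff_distrib)
  moreover have "s2 - c2 + 1 - m - (3 * A + 3 * B) \<le> s2 + x + g' - (c1 + m' + q)"
    if "- A \<le> x" "- B \<le> g" "g' = 1 + g" "m' = m" "c1 \<le> c2" "q \<le> 2 * (A + B)" for A B x g g' m m' c1 c2 q s2 :: real
    using that by argo
  moreover have "6 * s * tau * b1 + 3 * tau\<^sup>2 * b2 = 3 * (2 * s * tau * b1) + 3 * (tau\<^sup>2 * b2)" by simp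
  ultimately show ?thesis using qu by (simp only: mult_minus_right)
qed

lemma measurable_lin: "lin v \<in> borel_measurable P" "lin0 \<in> borel_measurable P"
  unfolding lin_def lin0_def
  by (intro borel_measurable_sum borel_measurable_times borel_measurable_const measurable_coord; simp)+

lemma measurable_quad: "quad v \<in> borel_measurable P" "quad0 \<in> borel_measurable P"
  unfolding quad_def quad0_def
  by (intro borel_measurable_diff borel_measurable_sum borel_measurable_power borel_measurable_times borel_measurable_const
      measurable_coord measurable_G; simp)+

lemma exp_coeff_form:
  assumes c: "fsq n Q c \<le> 1"
  shows "(\<integral>\<^sup>+w. ennreal (exp (th * (\<Sum>i<n. \<Sum>j<Q. c i j * w (i, j)))) \<partial>P) \<le> ennreal (exp (th\<^sup>2 / 2))"
proof -
  have "th * (\<Sum>i<n. \<Sum>j<Q. c i j * w (i, j)) = (\<Sum>p\<in>{..<n} \<times> {..<Q}. (th * c (fst p) (snd p)) * w p)" for w :: "nat \<times> nat \<Rightarrow> real"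
    by (simp add: sum.cartesian_product' sum_distrib_left mult.assoc)
  then have "(\<integral>\<^sup>+w. ennreal (exp (th * (\<Sum>i<n. \<Sum>j<Q. c i j * w (i, j)))) \<partial>P)
      = ennreal (exp ((\<Sum>p\<in>{..<n} \<times> {..<Q}. (th * c (fst p) (snd p))\<^sup>2) / 2))"
    using gauss_exp_linear[of "{..<n} \<times> {..<Q}" "\<lambda>p. th * c (fst p) (snd p)"] by simp
  also have "(\<Sum>p\<in>{..<n} \<times> {..<Q}. (th * c (fst p) (snd p))\<^sup>2) = th\<^sup>2 * fsq n Q c"
    by (simp add: sum.cartesian_product' fsq_def power_mult_distrib sum_distrib_left)
  also have "ennreal (exp (th\<^sup>2 * fsq n Q c / 2)) \<le> ennreal (exp (th\<^sup>2 / 2))"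
    using mult_left_mono[OF c, of "th\<^sup>2"] by (intro ennreal_leI) simp
  finally show ?thesis .
qed

lemma exp_lin:
  assumes "v \<in> net d n"
  shows "(\<integral>\<^sup>+w. ennreal (exp (th * lin v w)) \<partial>P) \<le> ennreal (exp (th\<^sup>2 / 2))"
  unfolding lin_def
proof (rule exp_coeff_form)
  have v: "nsq n v \<le> 1" using assms by (simp add: net_def)
  have "fsq n Q (\<lambda>i j. v i * cu v j) = nsq n v * nsq Q (cu v)"
    by (simp add: fsq_def nsq_def power_mult_distrib sum_product)
  also have "\<dots> \<le> 1 * 1" using v nsq_cu_le[of v] by (intro mult_mono) auto
  finally show "fsq n Q (\<lambda>i j. v i * cu v j) \<le> 1" by simp
qed

lemma exp_lin0: "(\<integral>\<^sup>+w. ennreal (exp (th * lin0 w)) \<partial>P) \<le> ennreal (exp (th\<^sup>2 / 2))"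
  unfolding lin0_def by (rule exp_coeff_form) (simp add: C1)

lemma exp_quad:
  assumes "v \<in> net d n" "\<bar>th\<bar> \<le> 1/4"
  shows "(\<integral>\<^sup>+w. ennreal (exp (th * quad v w)) \<partial>P) \<le> ennreal (exp (4 * th\<^sup>2 * Q))"
  using gauss_exp_square_columns[of "{..<n}" "{..<Q}" v th] assms
  by (simp add: quad_def nsq_def net_def)

lemma exp_quad0:
  assumes "\<bar>th\<bar> \<le> 1/4"
  shows "(\<integral>\<^sup>+w. ennreal (exp (th * quad0 w)) \<partial>P) \<le> ennreal (exp (4 * th\<^sup>2 * D))"
  using gauss_exp_chi_square[of "{..<n} \<times> {..<Q}" th] assms
  by (simp add: quad0_def G_def D_def)

lemma card_net_le: "finite (net (1/4) n)" "real (card (net (1/4) n)) \<le> exp (18 * real n)"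
  using finite_card_net[of "1/4" n] n2 by (auto simp: power2_eq_square mult.commute)

text \<open>\<open>None\<close> stands for the Frobenius fluctuations \<open>lin0\<close> and
  \<open>quad0\<close>, so that one dominating function serves them together with the net.\<close>

definition "ext_net = insert None (Some ` net (1/4) n)"

lemma ext_net: "finite ext_net" "real (card ext_net) \<le> 2 * exp (18 * rt)"
proof -
  show "finite ext_net" using card_net_le by (simp add: ext_net_def)
  have "real (card ext_net) = 1 + real (card (net (1/4) n))"
    unfolding ext_net_def using card_net_le(1) by (subst card_insert_disjoint) (auto simp: card_image)
  moreover have "real (card (net (1/4) n)) \<le> exp (18 * rt)"
    using order_trans[OF card_net_le(2), of "exp (18 * rt)"] n_le_rt by simp
  moreover have "1 \<le> exp (18 * rt)" using rt_ge by simp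
  ultimately show "real (card ext_net) \<le> 2 * exp (18 * rt)" by linarith
qed

text \<open>At a net point \<open>lin\<close> is a linear form with coefficient norm at most 1. In
  the exponent, with parameter \<open>q4\<close>, the moment costs \<open>rt / 2\<close> and the net
  \<open>18 * rt\<close>, while the level \<open>20 * q4\<close> gains
  \<open>20 * rt\<close>.\<close>

lemma lin_dominated:
  obtains \<Psi> where "integrable P \<Psi>" "\<And>w. \<Psi> w \<ge> 0" "integral\<^sup>L P \<Psi> \<le> 4 * exp (- rt)"
    "\<And>v w. v \<in> net (1/4) n \<Longrightarrow> \<bar>lin v w\<bar> \<le> 20 * q4 + \<Psi> w" "\<And>w. \<bar>lin0 w\<bar> \<le> 20 * q4 + \<Psi> w"
    "\<And>v w. v \<in> net (1/4) n \<Longrightarrow> \<Psi> w < 1 \<Longrightarrow> \<bar>lin v w\<bar> \<le> 20 * q4" "\<And>w. \<Psi> w < 1 \<Longrightarrow> \<bar>lin0 w\<bar> \<le> 20 * q4"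
proof -
  define h where "h k = (case k of None \<Rightarrow> lin0 | Some v \<Rightarrow> lin v)" for k
  have meas: "h k \<in> borel_measurable P" for k by (auto simp: h_def measurable_lin split: option.split)
  have ex: "(\<integral>\<^sup>+w. ennreal (exp (th * h k w)) \<partial>P) \<le> ennreal (exp (th\<^sup>2 / 2))" if "k \<in> ext_net" for k th
    using that exp_lin exp_lin0 by (auto simp: h_def ext_net_def)
  have q0: "q4 > 0" using q4_ge by simp
  obtain \<Psi> where \<Psi>: "integrable P \<Psi>" "\<And>w. \<Psi> w \<ge> 0"
    "integral\<^sup>L P \<Psi> \<le> 2 * card ext_net * exp (q4\<^sup>2 / 2) * exp (- q4 * (20 * q4))"
    "\<And>k w. k \<in> ext_net \<Longrightarrow> \<bar>h k w\<bar> \<le> 20 * q4 + \<Psi> w / q4"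
    "\<And>k w. k \<in> ext_net \<Longrightarrow> \<Psi> w < 1 \<Longrightarrow> \<bar>h k w\<bar> \<le> 20 * q4"
    by (rule exp_moment_dominate[of ext_net h P q4 "exp (q4\<^sup>2 / 2)" "20 * q4",
        OF ext_net(1) meas ex ex[of _ "- q4", unfolded power2_minus] q0 exp_ge_zero]) (assumption | rule that)+
  have le: "\<bar>h k w\<bar> \<le> 20 * q4 + \<Psi> w" if "k \<in> ext_net" for k w
  proof -
    have "\<Psi> w / q4 \<le> \<Psi> w / 1" using \<Psi>(2)[of w] q4_ge by (intro divide_left_mono) auto
    then show ?thesis using \<Psi>(4)[OF that, of w] by simp
  qed
  have "integral\<^sup>L P \<Psi> \<le> 2 * (2 * exp (18 * rt)) * exp (q4\<^sup>2 / 2) * exp (- q4 * (20 * q4))"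
    by (rule order_trans[OF \<Psi>(3)]) (use ext_net(2) in \<open>auto intro!: mult_right_mono\<close>)
  also have "\<dots> = 4 * exp (18 * rt + q4\<^sup>2 / 2 + - q4 * (20 * q4))" by (simp only: exp_add)
  also have "\<dots> \<le> 4 * exp (- rt)"
    using rt_ge q4_sq by (intro mult_left_mono) (auto simp: power2_eq_square)
  finally have I: "integral\<^sup>L P \<Psi> \<le> 4 * exp (- rt)" .
  have N: "None \<in> ext_net" and S: "\<And>v. v \<in> net (1/4) n \<Longrightarrow> Some v \<in> ext_net" by (auto simp: ext_net_def)
  show thesis
  proof (rule that[OF \<Psi>(1,2) I])
    fix v w assume v: "v \<in> net (1/4) n"
    show "\<bar>lin v w\<bar> \<le> 20 * q4 + \<Psi> w" using le[OF S[OF v], of w] by (simp add: h_def)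
    assume "\<Psi> w < 1"
    then show "\<bar>lin v w\<bar> \<le> 20 * q4" using \<Psi>(5)[OF S[OF v], of w] by (simp add: h_def)
  next
    fix w
    show "\<bar>lin0 w\<bar> \<le> 20 * q4 + \<Psi> w" using le[OF N, of w] by (simp add: h_def)
    assume "\<Psi> w < 1"
    then show "\<bar>lin0 w\<bar> \<le> 20 * q4" using \<Psi>(5)[OF N, of w] by (simp add: h_def)
  qed
qed

text \<open>With parameter \<open>1 / q4\<close> the moment costs at most \<open>4 * rt\<close> and
  the net \<open>18 * rt\<close>, while the level gains \<open>24 * rt\<close>. After scaling by
  \<open>tau^2\<close> the level is \<open>24 / q4\<close>: enough to keep the residual away from
  zero, but too coarse for the mean.\<close>

lemma quad_tail:
  obtains \<Psi> where "integrable P \<Psi>" "\<And>w. \<Psi> w \<ge> 0" "integral\<^sup>L P \<Psi> \<le> 4 * exp (- rt)"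
    "\<And>v w. v \<in> net (1/4) n \<Longrightarrow> \<Psi> w < 1 \<Longrightarrow> \<bar>quad v w\<bar> \<le> 24 * rt * q4" "\<And>w. \<Psi> w < 1 \<Longrightarrow> \<bar>quad0 w\<bar> \<le> 24 * rt * q4"
proof -
  define h where "h k = (case k of None \<Rightarrow> quad0 | Some v \<Rightarrow> quad v)" for k
  have meas: "h k \<in> borel_measurable P" for k by (auto simp: h_def measurable_quad split: option.split)
  have q0: "q4 > 0" using q4_ge by simp
  have th4: "\<bar>1 / q4\<bar> \<le> 1/4" "\<bar>- (1 / q4)\<bar> \<le> 1/4" using q4_ge by (auto simp: field_simps)
  have D: "4 * (1 / q4)\<^sup>2 * D = 4 * rt"
  proof -
    have "(1 / q4)\<^sup>2 = 1 / rt" by (simp add: power_divide q4_sq)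
    then show ?thesis using rt_ge rt_sq by (simp add: power2_eq_square flip: rt_sq)
  qed
  have "4 * (1 / q4)\<^sup>2 * Q \<le> 4 * (1 / q4)\<^sup>2 * D"
    using n2 mult_right_mono[of 1 "real n" "real Q"] by (intro mult_left_mono) (auto simp: D_def)
  then have Q: "4 * (1 / q4)\<^sup>2 * Q \<le> 4 * rt" using D by simp
  have ex: "(\<integral>\<^sup>+w. ennreal (exp (th * h k w)) \<partial>P) \<le> ennreal (exp (4 * rt))"
    if "k \<in> ext_net" "th = 1 / q4 \<or> th = - (1 / q4)" for k th
  proof (cases k)
    case None
    have "\<bar>th\<bar> \<le> 1/4" "4 * th\<^sup>2 * D = 4 * rt" using th4 that(2) D by auto
    then show ?thesis using exp_quad0[of th] None by (simp only: h_def option.case)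
  next
    case (Some v)
    then have v: "v \<in> net (1/4) n" using that(1) by (auto simp: ext_net_def)
    have "\<bar>th\<bar> \<le> 1/4" and th2: "th\<^sup>2 = (1 / q4)\<^sup>2" using th4 that(2) by auto
    then have "(\<integral>\<^sup>+w. ennreal (exp (th * h k w)) \<partial>P) \<le> ennreal (exp (4 * th\<^sup>2 * Q))"
      using exp_quad[OF v, of th] by (simp only: h_def Some option.case)
    also have "\<dots> \<le> ennreal (exp (4 * rt))"
      using Q unfolding th2 by (intro ennreal_leI) (simp only: exp_le_cancel_iff)
    finally show ?thesis .
  qed
  have q0': "1 / q4 > 0" using q0 by simp
  have up: "(\<integral>\<^sup>+w. ennreal (exp (1 / q4 * h k w)) \<partial>P) \<le> ennreal (exp (4 * rt))"
    and lo: "(\<integral>\<^sup>+w. ennreal (exp (- (1 / q4) * h k w)) \<partial>P) \<le> ennreal (exp (4 * rt))" if "k \<in> ext_net" for k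
    using ex[OF that] by blast+
  obtain \<Psi> where \<Psi>: "integrable P \<Psi>" "\<And>w. \<Psi> w \<ge> 0"
    "integral\<^sup>L P \<Psi> \<le> 2 * card ext_net * exp (4 * rt) * exp (- (1 / q4) * (24 * rt * q4))"
    "\<And>k w. k \<in> ext_net \<Longrightarrow> \<bar>h k w\<bar> \<le> 24 * rt * q4 + \<Psi> w / (1 / q4)"
    "\<And>k w. k \<in> ext_net \<Longrightarrow> \<Psi> w < 1 \<Longrightarrow> \<bar>h k w\<bar> \<le> 24 * rt * q4"
    by (rule exp_moment_dominate[of ext_net h P "1 / q4" "exp (4 * rt)" "24 * rt * q4",
        OF ext_net(1) meas up lo q0' exp_ge_zero]) (assumption | rule that)+
  have "integral\<^sup>L P \<Psi> \<le> 2 * (2 * exp (18 * rt)) * exp (4 * rt) * exp (- (1 / q4) * (24 * rt * q4))"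
    by (rule order_trans[OF \<Psi>(3)]) (use ext_net(2) in \<open>auto intro!: mult_right_mono\<close>)
  also have "\<dots> = 4 * exp (18 * rt + 4 * rt + - (1 / q4) * (24 * rt * q4))" by (simp only: exp_add)
  also have "\<dots> \<le> 4 * exp (- rt)"
    using rt_ge q0 by (intro mult_left_mono) auto
  finally have I: "integral\<^sup>L P \<Psi> \<le> 4 * exp (- rt)" .
  have N: "None \<in> ext_net" and S: "\<And>v. v \<in> net (1/4) n \<Longrightarrow> Some v \<in> ext_net" by (auto simp: ext_net_def)
  show thesis
  proof (rule that[OF \<Psi>(1,2) I])
    fix v w assume "v \<in> net (1/4) n" "\<Psi> w < 1"
    then show "\<bar>quad v w\<bar> \<le> 24 * rt * q4" using \<Psi>(5)[OF S, of v w] by (simp add: h_def)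
  next
    fix w assume "\<Psi> w < 1"
    then show "\<bar>quad0 w\<bar> \<le> 24 * rt * q4" using \<Psi>(5)[OF N, of w] by (simp add: h_def)
  qed
qed

text \<open>Only a mean is wanted, so the parameter is adapted to \<open>n\<close>: for
  \<open>th = n / (4 * rt)\<close> the moment costs \<open>n / 4\<close>, the net
  \<open>18 * n\<close>, and the level \<open>80 * rt\<close> gains \<open>20 * n\<close>. This
  improves the order \<open>rt * q4\<close> to \<open>rt\<close>. \<open>quad0\<close> sums
  \<open>D\<close> squares instead of \<open>Q\<close> and gets its own parameter
  \<open>t0\<close>.\<close>

lemma quad_mean:
  obtains V where "integrable P V" "\<And>w. V w \<ge> 0" "integral\<^sup>L P V \<le> 100 * rt"
    "\<And>v w. v \<in> net (1/4) n \<Longrightarrow> \<bar>quad v w\<bar> \<le> V w" "\<And>w. \<bar>quad0 w\<bar> \<le> V w"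
proof -
  define th where "th = n / (4 * rt)"
  have th0: "th > 0" using n2 rt_ge by (simp add: th_def)
  have th4: "th \<le> 1/4" using n_le_rt rt_ge by (simp add: th_def field_simps)
  have e: "4 * th\<^sup>2 * Q = n / 4"
  proof -
    have "4 * th\<^sup>2 * Q = real n * (real n * real Q) / (4 * rt\<^sup>2)"
      by (simp add: th_def power_divide power_mult_distrib power2_eq_square)
    then show ?thesis using D_ge n2 Q2 by (simp add: rt_sq D_def)
  qed
  have up: "(\<integral>\<^sup>+w. ennreal (exp (th * quad v w)) \<partial>P) \<le> ennreal (exp (n / 4))"
    and lo: "(\<integral>\<^sup>+w. ennreal (exp (- th * quad v w)) \<partial>P) \<le> ennreal (exp (n / 4))" if "v \<in> net (1/4) n" for v
    using exp_quad[OF that, of th] exp_quad[OF that, of "- th"] th0 th4 e by simp_all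
  obtain \<Psi> where \<Psi>: "integrable P \<Psi>" "\<And>w. \<Psi> w \<ge> 0"
    "integral\<^sup>L P \<Psi> \<le> 2 * card (net (1/4) n) * exp (n / 4) * exp (- th * (80 * rt))"
    "\<And>v w. v \<in> net (1/4) n \<Longrightarrow> \<bar>quad v w\<bar> \<le> 80 * rt + \<Psi> w / th"
    "\<And>v w. v \<in> net (1/4) n \<Longrightarrow> \<Psi> w < 1 \<Longrightarrow> \<bar>quad v w\<bar> \<le> 80 * rt"
    by (rule exp_moment_dominate[of "net (1/4) n" quad P th "exp (n / 4)" "80 * rt",
        OF card_net_le(1) measurable_quad(1) up lo th0 exp_ge_zero]) (assumption | rule that)+
  have "integral\<^sup>L P \<Psi> \<le> 2 * exp (18 * real n) * exp (n / 4) * exp (- th * (80 * rt))"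
    by (rule order_trans[OF \<Psi>(3)]) (use card_net_le(2) in \<open>auto intro!: mult_right_mono\<close>)
  also have "\<dots> = 2 * exp (18 * real n + n / 4 + - th * (80 * rt))" by (simp only: exp_add)
  also have "- th * (80 * rt) = - 20 * real n" using rt_ge by (simp add: th_def)
  also have "2 * exp (18 * real n + n / 4 + - 20 * real n) \<le> 2 * exp 0"
    by (intro mult_left_mono) auto
  finally have I: "integral\<^sup>L P \<Psi> \<le> 2" by simp
  define t0 where "t0 = 1 / (4 * rt)"
  have t0: "t0 > 0" "t0 \<le> 1/4" using rt_ge by (auto simp: t0_def field_simps)
  have e0: "4 * t0\<^sup>2 * D = 1/4"
    using rt_ge by (simp add: t0_def power_divide power_mult_distrib rt_sq[symmetric])
  have up0: "(\<integral>\<^sup>+w. ennreal (exp (t0 * quad0 w)) \<partial>P) \<le> ennreal (exp (1 / 4))"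
    and lo0: "(\<integral>\<^sup>+w. ennreal (exp (- t0 * quad0 w)) \<partial>P) \<le> ennreal (exp (1 / 4))"
    using exp_quad0[of t0] exp_quad0[of "- t0"] t0 e0 by simp_all
  obtain \<Theta> where \<Theta>: "integrable P \<Theta>" "\<And>w. \<Theta> w \<ge> 0"
    "integral\<^sup>L P \<Theta> \<le> 2 * card {()} * exp (1 / 4) * exp (- t0 * 0)"
    "\<And>k w. k \<in> {()} \<Longrightarrow> \<bar>quad0 w\<bar> \<le> 0 + \<Theta> w / t0"
    "\<And>k w. k \<in> {()} \<Longrightarrow> \<Theta> w < 1 \<Longrightarrow> \<bar>quad0 w\<bar> \<le> 0"
    by (rule exp_moment_dominate[of "{()}" "\<lambda>_. quad0" P t0 "exp (1 / 4)" 0,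
        OF finite.insertI[OF finite.emptyI] measurable_quad(2) up0 lo0 t0(1) exp_ge_zero]) (assumption | rule that)+
  have e14: "exp (1/4) \<le> (2::real)"
  proof -
    have "1 - 1/4 \<le> exp (- (1/4::real))" using exp_ge_add_one_self[of "- (1/4::real)"] by simp
    then show ?thesis by (simp add: exp_minus field_simps)
  qed
  have I0: "integral\<^sup>L P \<Theta> \<le> 4" using \<Theta>(3) e14 by simp
  define V where "V w = 80 * rt + \<Psi> w / th + \<Theta> w / t0" for w
  show thesis
  proof (rule that[of V])
    show "integrable P V"
      unfolding V_def using \<Psi>(1) \<Theta>(1) by (intro Bochner_Integration.integrable_add integrable_divide) auto
    have p: "0 \<le> \<Psi> w / th" "0 \<le> \<Theta> w / t0" for w using \<Psi>(2) \<Theta>(2) th0 t0 by auto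
    show "V w \<ge> 0" for w using p[of w] rt_ge by (simp add: V_def)
    show "\<bar>quad v w\<bar> \<le> V w" if "v \<in> net (1/4) n" for v w
      using \<Psi>(4)[OF that, of w] p[of w] by (simp add: V_def)
    show "\<bar>quad0 w\<bar> \<le> V w" for w
      using \<Theta>(4)[of "()" w] p[of w] rt_ge by (simp add: V_def)
    have "integral\<^sup>L P V = 80 * rt + integral\<^sup>L P \<Psi> / th + integral\<^sup>L P \<Theta> / t0"
      unfolding V_def using \<Psi>(1) \<Theta>(1) by (simp add: prob_space)
    also have "\<dots> \<le> 80 * rt + 2 / th + 4 / t0"
      using I I0 th0 t0 by (intro add_mono divide_right_mono) auto
    \<comment> \<open>This is \<open>8 * rt / n\<close> with \<open>n \<ge> 2\<close>; the final
      constant is 80 + 4 + 16.\<close>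
    also have "2 / th \<le> 4 * rt"
      using n2 rt_ge by (simp add: th_def field_simps)
    also have "4 / t0 = 16 * rt" by (simp add: t0_def)
    finally show "integral\<^sup>L P V \<le> 100 * rt" by simp
  qed
qed

end

section \<open>The expected log-residual\<close>

text \<open>The first bound is the chord of the concave \<open>ln\<close> between 1/2 and 1, whose
  slope is the origin of the threshold \<open>2 * ln 2\<close> for the penalty.\<close>

lemma ln_one_minus_ge:
  fixes y :: real
  assumes "0 \<le> y" "y \<le> 1/2"
  shows "ln (1 - y) \<ge> - (2 * ln 2 * y)" and "ln (1 - y) \<ge> - (2 * y)"
proof -
  have "ln ((1 - 2 * y) *\<^sub>R 1 + (2 * y) *\<^sub>R (1/2)) \<ge> (1 - 2 * y) * ln 1 + (2 * y) * ln (1/2::real)"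
    by (rule concave_onD[OF ln_concave]) (use assms in auto)
  then show 1: "ln (1 - y) \<ge> - (2 * ln 2 * y)" by (simp add: ln_div mult_ac)
  have "2 * ln 2 * y \<le> 2 * 1 * y"
    using assms ln_2_less_1 by (intro mult_right_mono mult_left_mono) auto
  then show "ln (1 - y) \<ge> - (2 * y)" using 1 by simp
qed

text \<open>A bound linear in \<open>z\<close> that survives large \<open>z\<close>, so that it can
  be integrated with \<open>z\<close> random: for \<open>z > a / 2\<close> the guaranteed
  \<open>x \<ge> a / 2\<close> costs only \<open>ln 2 < 1 \<le> 2 * z / a\<close>.\<close>

lemma ln_diff_ge:
  fixes a x z :: real
  assumes a: "a > 0" and z: "z \<ge> 0" and x1: "x \<ge> a - z" and x2: "x \<ge> a / 2"
  shows "ln x \<ge> ln a - 2 * z / a"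
proof (cases "z \<le> a / 2")
  case True
  have y: "0 \<le> z / a" "z / a \<le> 1/2" using a z True by (auto simp: field_simps)
  have "ln a + - (2 * (z / a)) \<le> ln a + ln (1 - z / a)"
    using ln_one_minus_ge(2)[OF y] by simp
  also have "\<dots> = ln (a * (1 - z / a))"
    using a y by (subst ln_mult_pos) auto
  also have "a * (1 - z / a) = a - z" using a by (simp add: field_simps)
  also have "ln (a - z) \<le> ln x" using a True x1 by (intro ln_mono) auto
  finally show ?thesis by simp
next
  case False
  have "ln a - 1 \<le> ln a - ln 2" using ln_2_less_1 by simp
  also have "\<dots> = ln (a / 2)" using a by (simp add: ln_div)
  also have "\<dots> \<le> ln x" using a x2 by (intro ln_mono) auto
  finally have "ln a - 1 \<le> ln x" .
  moreover have "2 * z / a \<ge> 1" using False a by (simp add: field_simps)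
  ultimately show ?thesis by linarith
qed

context spiked_wide
begin

text \<open>A pointwise minorant of \<open>ln (X w)\<close> is integrated. The assumption
  \<open>small\<close> makes the tail error \<open>6 * 20 * s / q4 + 3 * 24 / q4\<close> at most
  \<open>(1 + t) / 4\<close>, hence at most half of the centre \<open>a\<close>.\<close>

lemma expectation_ln_residual_ge:
  assumes X: "rank_one_residual X" and ph: "\<And>u. nsq n u = 1 \<Longrightarrow> nsq Q (cu u) \<le> ph" and ph1: "ph \<le> 1"
  defines "t \<equiv> s\<^sup>2 * (1 - ph)"
  assumes small: "120 * s / q4 + 72 / q4 \<le> (1 + t) / 4"
  shows "(\<integral>w. ln (X w) \<partial>P) \<ge> ln (1 + t) - 2 * ln 2 / n - 4 / (1 + t) * (144 * s / q4 + 300 / rt)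
    - 8 * exp (- rt) * (ln (1 + t) + ln (1 + 2 * s\<^sup>2) + 2 * D\<^sup>2) - 300 / D"
proof -
  have t0: "t \<ge> 0" using ph1 by (simp add: t_def)
  define a where "a = 1 + t - 1 / n"
  have n_inv: "0 < 1 / real n" "1 / real n \<le> 1 / 2" using n2 by (auto simp: field_simps)
  have a: "a > 0" "a \<le> 1 + t" "(1 + t) / 2 \<le> a" using n_inv t0 unfolding a_def by argo+
  have pos: "q4 > 0" "rt > 0" "D > 0" using q4_ge rt_ge D_ge by auto
  have st: "s * tau * q4 = s / q4" "tau\<^sup>2 * rt = 1 / rt" "tau\<^sup>2 * (rt * q4) = 1 / q4"
  proof -
    show "s * tau * q4 = s / q4" using pos by (simp add: tau_rt q4_sq[symmetric] power2_eq_square)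
    show 2: "tau\<^sup>2 * rt = 1 / rt" using pos by (simp add: tau_rt power_divide power2_eq_square)
    have "tau\<^sup>2 * (rt * q4) = q4 / rt" using 2 by (metis mult.assoc mult.commute times_divide_eq_right mult.right_neutral)
    also have "\<dots> = 1 / q4" using pos by (simp add: q4_sq[symmetric] power2_eq_square)
    finally show "tau\<^sup>2 * (rt * q4) = 1 / q4" .
  qed
  obtain \<Psi> where \<Psi>: "integrable P \<Psi>" "\<And>w. \<Psi> w \<ge> 0" "integral\<^sup>L P \<Psi> \<le> 4 * exp (- rt)"
    "\<And>v w. v \<in> net (1/4) n \<Longrightarrow> \<bar>lin v w\<bar> \<le> 20 * q4 + \<Psi> w" "\<And>w. \<bar>lin0 w\<bar> \<le> 20 * q4 + \<Psi> w"
    "\<And>v w. v \<in> net (1/4) n \<Longrightarrow> \<Psi> w < 1 \<Longrightarrow> \<bar>lin v w\<bar> \<le> 20 * q4" "\<And>w. \<Psi> w < 1 \<Longrightarrow> \<bar>lin0 w\<bar> \<le> 20 * q4"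
    by (rule lin_dominated) (assumption | rule that)+
  obtain \<Theta> where \<Theta>: "integrable P \<Theta>" "\<And>w. \<Theta> w \<ge> 0" "integral\<^sup>L P \<Theta> \<le> 4 * exp (- rt)"
    "\<And>v w. v \<in> net (1/4) n \<Longrightarrow> \<Theta> w < 1 \<Longrightarrow> \<bar>quad v w\<bar> \<le> 24 * rt * q4" "\<And>w. \<Theta> w < 1 \<Longrightarrow> \<bar>quad0 w\<bar> \<le> 24 * rt * q4"
    by (rule quad_tail) (assumption | rule that)+
  obtain V where V: "integrable P V" "\<And>w. V w \<ge> 0" "integral\<^sup>L P V \<le> 100 * rt"
    "\<And>v w. v \<in> net (1/4) n \<Longrightarrow> \<bar>quad v w\<bar> \<le> V w" "\<And>w. \<bar>quad0 w\<bar> \<le> V w"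
    by (rule quad_mean) (assumption | rule that)+
  define Z where "Z w = 6 * s * tau * (20 * q4 + \<Psi> w) + 3 * tau\<^sup>2 * V w" for w
  define B where "B = ln (1 + t) + ln (1 + 2 * s\<^sup>2) + 2 * D\<^sup>2"
  \<comment> \<open>\<open>Z\<close> is the loss on the good event, \<open>\<Psi> + \<Theta>\<close>
    replaces the indicator of the bad one, and the last term is the random part of the minor bound
    with \<open>b = D^2\<close>. The deterministic \<open>2 * D^2\<close> inside \<open>B\<close> is
    harmless against \<open>exp (- rt)\<close>.\<close>
  define L where "L w = ln a - 2 / a * Z w - (\<Psi> w + \<Theta> w) * B
     - (32 * (\<bar>minor w\<bar> powr (-1/2)) + 1 + 2 * (tau\<^sup>2 * G w)) / D\<^sup>2" for w
  have B0: "B \<ge> 0" using t0 by (simp add: B_def)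
  have Z0: "Z w \<ge> 0" for w
    unfolding Z_def using s0 tau_pos pos \<Psi>(2)[of w] V(2)[of w] by (intro add_nonneg_nonneg mult_nonneg_nonneg) auto
  have Wpos: "0 \<le> (32 * (\<bar>minor w\<bar> powr (-1/2)) + 1 + 2 * (tau\<^sup>2 * G w)) / D\<^sup>2" for w
    using G_nonneg[of w] by (intro divide_nonneg_nonneg add_nonneg_nonneg mult_nonneg_nonneg) auto
  have le: "L w \<le> ln (X w)" if w: "minor w \<noteq> 0" for w
  \<comment> \<open>Both functions are nonnegative, so a sum below 1 puts each of them below 1 and
    all tail bounds hold. Otherwise the term with \<open>B\<close> absorbs \<open>ln a\<close> and
    the deterministic losses.\<close>
  proof (cases "\<Psi> w + \<Theta> w < 1")
    case True
    then have lt: "\<Psi> w < 1" "\<Theta> w < 1" using \<Psi>(2)[of w] \<Theta>(2)[of w] by linarith+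
    have X1: "X w \<ge> a - Z w"
      using residual_lower_bound[OF X ph, of w "20 * q4 + \<Psi> w" "V w"] \<Psi>(4,5) V(4,5)
      by (simp add: a_def t_def Z_def)
    have "X w \<ge> a - (6 * s * tau * (20 * q4) + 3 * tau\<^sup>2 * (24 * rt * q4))"
      using residual_lower_bound[OF X ph, of w "20 * q4" "24 * rt * q4"] \<Psi>(6,7) \<Theta>(4,5) lt
      by (simp add: a_def t_def)
    moreover have "6 * s * tau * (20 * q4) + 3 * tau\<^sup>2 * (24 * rt * q4) = 120 * (s * tau * q4) + 72 * (tau\<^sup>2 * (rt * q4))"
      by simp
    ultimately have X2: "X w \<ge> a / 2" using small a unfolding st by simp
    have "ln (X w) \<ge> ln a - 2 * Z w / a" by (rule ln_diff_ge[OF a(1) Z0 X1 X2])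
    moreover have "0 \<le> (\<Psi> w + \<Theta> w) * B" using B0 \<Psi>(2)[of w] \<Theta>(2)[of w] by simp
    ultimately show ?thesis using Wpos[of w] by (simp add: L_def)
  next
    case False
    have "B \<le> (\<Psi> w + \<Theta> w) * B" using False B0 mult_right_mono[of 1 "\<Psi> w + \<Theta> w" B] by simp
    moreover have "ln a \<le> ln (1 + t)" using a by (intro ln_mono) auto
    moreover have "0 \<le> 2 / a * Z w" using a Z0[of w] by simp
    moreover have "ln (X w) \<ge> - (D\<^sup>2 / 2 + 32 * (\<bar>minor w\<bar> powr (-1/2)) / D\<^sup>2) - ln (1 + 2 * s\<^sup>2)
       - (D\<^sup>2 + (1 + 2 * (tau\<^sup>2 * G w)) / D\<^sup>2)"
      using pos by (intro ln_residual_ge[OF X w]) auto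
    moreover have "(32 * (\<bar>minor w\<bar> powr (-1/2)) + 1 + 2 * (tau\<^sup>2 * G w)) / D\<^sup>2
      = 32 * (\<bar>minor w\<bar> powr (-1/2)) / D\<^sup>2 + (1 + 2 * (tau\<^sup>2 * G w)) / D\<^sup>2"
      by (simp add: add_divide_distrib)
    moreover have "D\<^sup>2 \<ge> 0" by simp
    moreover have "B = ln (1 + t) + ln (1 + 2 * s\<^sup>2) + 2 * D\<^sup>2" by (rule B_def)
    ultimately show ?thesis unfolding L_def by argo
  qed
  have ig: "integrable P (\<lambda>w. \<bar>minor w\<bar> powr (-1/2))" by (rule minor_root(2))
  have iZ: "integrable P Z"
    unfolding Z_def using \<Psi>(1) V(1) by (intro Bochner_Integration.integrable_add integrable_mult_right) auto
  have iW: "integrable P (\<lambda>w. (32 * (\<bar>minor w\<bar> powr (-1/2)) + 1 + 2 * (tau\<^sup>2 * G w)) / D\<^sup>2)"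
    using ig integrable_G by (intro integrable_divide Bochner_Integration.integrable_add integrable_mult_right) auto
  have iB: "integrable P (\<lambda>w. (\<Psi> w + \<Theta> w) * B)"
    using \<Psi>(1) \<Theta>(1) by (intro integrable_mult_left Bochner_Integration.integrable_add)
  have iL: "integrable P L"
    unfolding L_def using iZ iW iB by (intro Bochner_Integration.integrable_diff integrable_mult_right) auto
  have eL: "integral\<^sup>L P L = ln a - 2 / a * integral\<^sup>L P Z - (integral\<^sup>L P \<Psi> + integral\<^sup>L P \<Theta>) * B
     - (32 * (\<integral>w. \<bar>minor w\<bar> powr (-1/2) \<partial>P) + 1 + 2 * (tau\<^sup>2 * D)) / D\<^sup>2"
  proof -
    have "integral\<^sup>L P L = (\<integral>w. ln a - 2 / a * Z w - (\<Psi> w + \<Theta> w) * B \<partial>P)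
       - (\<integral>w. (32 * (\<bar>minor w\<bar> powr (-1/2)) + 1 + 2 * (tau\<^sup>2 * G w)) / D\<^sup>2 \<partial>P)"
      unfolding L_def using iZ iW iB by (intro Bochner_Integration.integral_diff Bochner_Integration.integrable_diff integrable_mult_right) auto
    also have "(\<integral>w. ln a - 2 / a * Z w - (\<Psi> w + \<Theta> w) * B \<partial>P) = (\<integral>w. ln a - 2 / a * Z w \<partial>P) - (\<integral>w. (\<Psi> w + \<Theta> w) * B \<partial>P)"
      using iZ iB by (intro Bochner_Integration.integral_diff Bochner_Integration.integrable_diff integrable_mult_right) auto
    also have "(\<integral>w. ln a - 2 / a * Z w \<partial>P) = ln a - 2 / a * integral\<^sup>L P Z"
      using iZ by (subst Bochner_Integration.integral_diff) (auto simp: prob_space)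
    also have "(\<integral>w. (\<Psi> w + \<Theta> w) * B \<partial>P) = (integral\<^sup>L P \<Psi> + integral\<^sup>L P \<Theta>) * B"
      using \<Psi>(1) \<Theta>(1) by simp
    also have "(\<integral>w. (32 * (\<bar>minor w\<bar> powr (-1/2)) + 1 + 2 * (tau\<^sup>2 * G w)) / D\<^sup>2 \<partial>P)
       = (32 * (\<integral>w. \<bar>minor w\<bar> powr (-1/2) \<partial>P) + 1 + 2 * (tau\<^sup>2 * D)) / D\<^sup>2"
      using ig integrable_G by (simp add: prob_space expectation_G)
    finally show ?thesis .
  qed
  have "integral\<^sup>L P L \<le> (\<integral>w. ln (X w) \<partial>P)"
  proof (rule integral_mono_AE[OF iL integrable_ln_residual[OF X]])
    show "AE w in P. L w \<le> ln (X w)" using minor_root(1) by eventually_elim (rule le)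
  qed
  moreover have "ln a \<ge> ln (1 + t) - 2 * ln 2 / n"
  proof -
    define y where "y = 1 / real n / (1 + t)"
    have "y \<le> 1 / real n / 1" unfolding y_def using t0 n_inv by (intro divide_left_mono) auto
    then have y3: "y \<le> 1 / real n" by simp
    have "0 \<le> y" using t0 by (simp add: y_def)
    with y3 have y: "0 \<le> y" "y \<le> 1/2" "y \<le> 1 / real n" using n_inv by linarith+
    have "ln a = ln ((1 + t) * (1 - y))"
      using t0 by (simp add: a_def y_def right_diff_distrib)
    also have "\<dots> = ln (1 + t) + ln (1 - y)"
      using t0 y by (intro ln_mult_pos) auto
    finally have "ln a \<ge> ln (1 + t) - 2 * ln 2 * y" using ln_one_minus_ge(1)[OF y(1,2)] by simp
    moreover have "2 * ln 2 * y \<le> 2 * ln 2 * (1 / real n)" using y by (intro mult_left_mono) auto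
    ultimately show ?thesis by simp
  qed
  moreover have "2 / a * integral\<^sup>L P Z \<le> 4 / (1 + t) * (144 * s / q4 + 300 / rt)"
  proof (intro mult_mono)
    show "2 / a \<le> 4 / (1 + t)" using a t0 by (simp add: field_simps)
    have "integral\<^sup>L P Z = 6 * s * tau * (20 * q4 + integral\<^sup>L P \<Psi>) + 3 * tau\<^sup>2 * integral\<^sup>L P V"
      unfolding Z_def using \<Psi>(1) V(1) by (simp add: prob_space)
    \<comment> \<open>The mean of \<open>\<Psi>\<close> is at most 4 and hence at most
      \<open>4 * q4\<close>, which turns 20 into 24 and yields 144 = 6 * 24.\<close>
    also have "\<dots> \<le> 6 * s * tau * (20 * q4 + 4 * q4) + 3 * tau\<^sup>2 * (100 * rt)"
    proof (intro add_mono mult_left_mono order_refl)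
      have "exp (- rt) \<le> 1" using pos by simp
      then show "integral\<^sup>L P \<Psi> \<le> 4 * q4" using \<Psi>(3) q4_ge by linarith
    qed (use V(3) s0 tau_pos in auto)
    also have "\<dots> = 144 * (s * tau * q4) + 300 * (tau\<^sup>2 * rt)" by simp
    finally show "integral\<^sup>L P Z \<le> 144 * s / q4 + 300 / rt" unfolding st by simp
    show "0 \<le> integral\<^sup>L P Z" using Z0 by (intro Bochner_Integration.integral_nonneg) auto
  qed (use t0 in auto)
  moreover have "(integral\<^sup>L P \<Psi> + integral\<^sup>L P \<Theta>) * B \<le> 8 * exp (- rt) * B"
    using \<Psi>(3) \<Theta>(3) B0 by (intro mult_right_mono) auto
  moreover have "(32 * (\<integral>w. \<bar>minor w\<bar> powr (-1/2) \<partial>P) + 1 + 2 * (tau\<^sup>2 * D)) / D\<^sup>2 \<le> 300 / D"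
  proof -
    have "tau\<^sup>2 * D = 1" using pos by (simp add: tau_sq)
    then have "32 * (\<integral>w. \<bar>minor w\<bar> powr (-1/2) \<partial>P) + 1 + 2 * (tau\<^sup>2 * D) \<le> 300 * D"
      using minor_root(3) D_ge by simp
    then have "(32 * (\<integral>w. \<bar>minor w\<bar> powr (-1/2) \<partial>P) + 1 + 2 * (tau\<^sup>2 * D)) / D\<^sup>2 \<le> 300 * D / D\<^sup>2"
      by (intro divide_right_mono) auto
    then show ?thesis using pos by (simp add: power2_eq_square)
  qed
  ultimately show ?thesis unfolding eL B_def[symmetric] by argo
qed

end

section \<open>The information criterion\<close>

text \<open>A matrix and its transpose have the same norm: \<open>|C' u|^2\<close> is the product of
  \<open>u\<close> with \<open>C (C' u)\<close>, hence at most \<open>|u| * |C| * |C' u|\<close>,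
  and one factor \<open>|C' u|\<close> cancels unless it is zero.\<close>

lemma nsq_mvec_trp_le_specnorm:
  assumes c: "c > 0"
  shows "nsq c (mvec c r (trp C) u) \<le> (specnorm r c C)\<^sup>2 * nsq r u"
proof -
  define y where "y = mvec c r (trp C) u"
  have "nsq c y = (\<Sum>j<c. \<Sum>i<r. C i j * u i * y j)"
    by (simp add: nsq_def power2_eq_square) (simp add: y_def mvec_def trp_def sum_distrib_right)
  also have "\<dots> = (\<Sum>i<r. u i * mvec r c C y i)"
    unfolding mvec_def by (subst sum.swap) (simp add: sum_distrib_left mult_ac)
  finally have "(nsq c y)\<^sup>2 \<le> nsq r u * nsq r (mvec r c C y)"
    using cauchy_schwarz_nsq[where c = r] by simp
  also have "\<dots> \<le> nsq r u * ((specnorm r c C)\<^sup>2 * nsq c y)"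
    by (intro mult_left_mono nsq_mvec_le_specnorm c) auto
  finally have le: "nsq c y * nsq c y \<le> ((specnorm r c C)\<^sup>2 * nsq r u) * nsq c y"
    by (simp add: power2_eq_square mult_ac)
  show ?thesis
  proof (cases "nsq c y = 0")
    case True
    then show ?thesis by (simp add: y_def)
  next
    case False
    then have "nsq c y > 0" using nsq_nonneg[of c y] by linarith
    then show ?thesis using le unfolding y_def by (rule mult_right_le_imp_le[rotated])
  qed
qed

lemma trp_apply: "trp R j i = R i j"
  by (simp add: trp_def)

lemma gauss_mat_eq: "gauss_mat M N = gaussI ({..<2^M} \<times> {..<2^N})"
  by (simp add: gauss_mat_def gaussI_def)

text \<open>\<open>f\<close> is injective, so relabelling the i.i.d. noise leaves a standard
  Gaussian product; this serves the rearrangement and its transpose alike. Almost sure positivity of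
  \<open>X\<close> is what allows \<open>ln (sig^2 * X)\<close> to be split.\<close>

lemma EIC_eq:
  fixes lam sig kap :: real
  assumes mn: "m \<le> M" "n \<le> N" and sig: "sig > 0"
    and f: "inj_on f I" "f \<in> I \<rightarrow> {..<2^M} \<times> {..<2^N}"
    and X: "X \<in> borel_measurable (gaussI I)"
    and eq: "\<And>E. resid (2^(m+n)) (2^(M+N-m-n)) (rearr M N m n (Ymod M N m0 n0 lam sig A B E))
        = sig\<^sup>2 * X (\<lambda>p\<in>I. E (f p))"
    and pos: "AE w in gaussI I. X w > 0" and int: "integrable (gaussI I) (\<lambda>w. ln (X w))"
  shows "EIC M N m0 n0 lam sig A B kap m n
    = 2^(M+N) * (ln (sig\<^sup>2) + (\<integral>w. ln (X w) \<partial>gaussI I)) + kap * (2^(m+n) + 2^(M+N-m-n))"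
proof -
  interpret prob_space "gaussI I" by (rule prob_space_gaussI)
  define F where "F w = 2^(M+N) * ln (sig\<^sup>2 * X w) + kap * (2^(m+n) + 2^(M+N-m-n))" for w
  have F: "F \<in> borel_measurable (gaussI I)"
  proof -
    have "(\<lambda>w. sig\<^sup>2 * X w) \<in> borel_measurable (gaussI I)"
      using X by (intro borel_measurable_times borel_measurable_const)
    then have "(\<lambda>w. ln (sig\<^sup>2 * X w)) \<in> borel_measurable (gaussI I)"
      by (rule measurable_compose) measurable
    then show ?thesis unfolding F_def
      by (intro borel_measurable_add borel_measurable_times borel_measurable_const)
  qed
  have distr: "distr (gauss_mat M N) (gaussI I) (\<lambda>E. \<lambda>p\<in>I. E (f p)) = gaussI I"
    unfolding gauss_mat_eq gaussI_def
    using distr_PiM_reindex[of "{..<2^M} \<times> {..<2^N}" "\<lambda>_. gauss1" f I] f prob_space_gauss1 by blast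
  have meas: "(\<lambda>E. \<lambda>p\<in>I. E (f p)) \<in> gauss_mat M N \<rightarrow>\<^sub>M gaussI I"
    unfolding gauss_mat_eq gaussI_def
    by (intro measurable_restrict measurable_component_singleton) (use f in auto)
  have "EIC M N m0 n0 lam sig A B kap m n = (\<integral>E. F (\<lambda>p\<in>I. E (f p)) \<partial>gauss_mat M N)"
    unfolding EIC_def IC_def frob_diff_fitY[OF mn] eq F_def ..
  also have "\<dots> = (\<integral>w. F w \<partial>distr (gauss_mat M N) (gaussI I) (\<lambda>E. \<lambda>p\<in>I. E (f p)))"
    by (rule integral_distr[OF meas F, symmetric])
  also have "\<dots> = (\<integral>w. F w \<partial>gaussI I)" by (simp only: distr)
  also have "\<dots> = (\<integral>w. 2^(M+N) * (ln (sig\<^sup>2) + ln (X w)) + kap * (2^(m+n) + 2^(M+N-m-n)) \<partial>gaussI I)"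
  proof (rule integral_cong_AE)
    show "F \<in> borel_measurable (gaussI I)" by (rule F)
    show "(\<lambda>w. 2^(M+N) * (ln (sig\<^sup>2) + ln (X w)) + kap * (2^(m+n) + 2^(M+N-m-n))) \<in> borel_measurable (gaussI I)"
      using borel_measurable_integrable[OF int]
      by (intro borel_measurable_add borel_measurable_times borel_measurable_const)
    show "AE w in gaussI I. F w = 2^(M+N) * (ln (sig\<^sup>2) + ln (X w)) + kap * (2^(m+n) + 2^(M+N-m-n))"
      using pos
    proof eventually_elim
      case (elim w)
      then have "ln (sig\<^sup>2 * X w) = ln (sig\<^sup>2) + ln (X w)" using sig by (intro ln_mult_pos) auto
      then show ?case by (simp add: F_def)
    qed
  qed
  also have "\<dots> = 2^(M+N) * (ln (sig\<^sup>2) + (\<integral>w. ln (X w) \<partial>gaussI I)) + kap * (2^(m+n) + 2^(M+N-m-n))"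
    using int by (simp add: prob_space)
  finally show ?thesis .
qed

lemma powr_half: "2 powr (- real k / 2) = 1 / sqrt (2 ^ k)"
  by (simp add: powr_minus_divide powr_half_sqrt[symmetric] powr_realpow[symmetric] powr_powr)

lemma resid_Ymod:
  assumes "sig > 0"
  shows "resid (2^(m+n)) (2^(M+N-m-n)) (rearr M N m n (Ymod M N m0 n0 lam sig A B E))
    = sig\<^sup>2 * resid (2^(m+n)) (2^(M+N-m-n)) (\<lambda>i j. lam / sig * rearr M N m n (kron (2^(M-m0)) (2^(N-n0)) A B) i j
        + 1 / sqrt (2^(M+N)) * E (pos M N m n (i, j)))"
proof -
  have "rearr M N m n (Ymod M N m0 n0 lam sig A B E) = (\<lambda>i j. sig * (lam / sig * rearr M N m n (kron (2^(M-m0)) (2^(N-n0)) A B) i j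
        + 1 / sqrt (2^(M+N)) * E (pos M N m n (i, j))))"
    unfolding Ymod_def powr_half using assms by (intro ext) (simp add: rearr_pos distrib_left)
  then show ?thesis by (simp only: resid_scale zero_less_power zero_less_numeral)
qed

lemma cands_pow_ge:
  assumes "(m, n) \<in> cands M N"
  shows "m \<le> M" "n \<le> N" "(2::nat) ^ (m + n) \<ge> 2" "(2::nat) ^ (M + N - m - n) \<ge> 2"
proof -
  show mn: "m \<le> M" "n \<le> N" using assms by (auto simp: cands_def)
  have ge2: "(2::nat) ^ k \<ge> 2" if "k \<ge> 1" for k using power_increasing[OF that, of "2::nat"] by simp
  show "(2::nat) ^ (m + n) \<ge> 2" using assms by (intro ge2) (auto simp: cands_def)
  show "(2::nat) ^ (M + N - m - n) \<ge> 2" using assms mn by (intro ge2) (auto simp: cands_def)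
qed

text \<open>The signal is itself a rank-one competitor, so the residual is at most the noise energy
  \<open>tau^2 * G\<close>. That energy has mean 1, and \<open>ln x \<le> x - 1\<close>.\<close>

lemma EIC_true_le:
  fixes lam sig kap :: real
  assumes cand: "(m0, n0) \<in> cands M N" and lam: "lam > 0" and sig: "sig > 0"
    and A: "frob (2^m0) (2^n0) A = 1" and B: "frob (2^(M-m0)) (2^(N-n0)) B = 1"
  shows "EIC M N m0 n0 lam sig A B kap m0 n0 \<le> 2^(M+N) * ln (sig\<^sup>2) + kap * (2^(m0+n0) + 2^(M+N-m0-n0))"
proof -
  note c = cands_pow_ge[OF cand]
  define r c where "r = (2::nat)^(m0+n0)" and "c = (2::nat)^(M+N-m0-n0)"
  define C where "C = rearr M N m0 n0 (kron (2^(M-m0)) (2^(N-n0)) A B)"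
  have fK: "fsq (2^M) (2^N) (kron (2^(M-m0)) (2^(N-n0)) A B) = 1" by (rule fsq_kron(1)[OF c(1,2) A B])
  interpret spiked r c "lam / sig" C
    by standard (use c lam sig fK in \<open>auto simp: r_def c_def C_def fsq_rearr simp del: diff_diff_left\<close>)
  have rc: "real r * real c = 2^(M+N)"
    using arg_cong[OF pow2_split(1)[OF c(1,2)], of real] by (simp add: r_def c_def power_add)
  have D: "D = 2^(M+N)" by (simp add: D_def rc)
  define X where "X w = resid r c (R w)" for w
  have X: "rank_one_residual X"
    unfolding rank_one_residual_def
  proof (intro conjI allI)
    show "X \<in> borel_measurable P"
      unfolding X_def by (intro borel_measurable_resid measurable_R) (use Q2 in auto)
    fix w
    obtain u v where "leading_sv r c (R w) u v"
      using leading_sv_exists[of r c "R w"] n2 Q2 by auto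
    from leading_sv_mvec(1,4)[OF this]
    show "\<exists>u. nsq r u = 1 \<and> X w = fsq r c (R w) - nsq c (mvec c r (trp (R w)) u)"
      by (auto simp: X_def resid_def)
  qed
  have bij: "bij_betw (pos M N m0 n0) ({..<r} \<times> {..<c}) ({..<2^M} \<times> {..<2^N})"
    unfolding r_def c_def by (rule bij_betw_pos[OF c(1,2)])
  have E: "EIC M N m0 n0 lam sig A B kap m0 n0
    = 2^(M+N) * (ln (sig\<^sup>2) + (\<integral>w. ln (X w) \<partial>P)) + kap * (2^(m0+n0) + 2^(M+N-m0-n0))"
  proof (rule EIC_eq[OF c(1,2) sig])
    show "inj_on (pos M N m0 n0) ({..<r} \<times> {..<c})" "pos M N m0 n0 \<in> ({..<r} \<times> {..<c}) \<rightarrow> {..<2^M} \<times> {..<2^N}"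
      using bij by (auto simp: bij_betw_def)
    show "X \<in> borel_measurable P" using X by (simp add: rank_one_residual_def)
    show "AE w in P. X w > 0" by (rule residual_AE_pos[OF X])
    show "integrable P (\<lambda>w. ln (X w))" by (rule integrable_ln_residual[OF X])
    show "resid (2^(m0+n0)) (2^(M+N-m0-n0)) (rearr M N m0 n0 (Ymod M N m0 n0 lam sig A B E))
      = sig\<^sup>2 * X (\<lambda>p\<in>{..<r} \<times> {..<c}. E (pos M N m0 n0 p))" for E
      unfolding resid_Ymod[OF sig] X_def unfolding r_def[symmetric] c_def[symmetric]
      by (intro arg_cong2[where f = "(*)"] refl resid_cong) (simp add: R_def tau_def D flip: C_def)
  qed
  have le: "X w \<le> tau\<^sup>2 * G w" for w
  proof -
    define a b where "a = (\<lambda>r. A (r div 2^n0) (r mod 2^n0))" and "b = (\<lambda>s. B (s div 2^(N-n0)) (s mod 2^(N-n0)))"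
    have ab: "nsq r a = 1" "nsq c b = 1"
      unfolding a_def b_def r_def c_def by (rule fsq_kron[OF c(1,2) A B])+
    have Cab: "C i j = a i * b j" if "i < r" "j < c" for i j
      using that c(1,2) by (simp add: C_def a_def b_def rearr_kron r_def c_def)
    have "X w \<le> fsq r c (\<lambda>i j. R w i j - lam / sig * (a i * b j))"
      unfolding X_def resid_def using ab lam sig Q2 by (intro fsq_rank_one_residual_le) auto
    also have "\<dots> = fsq r c (\<lambda>i j. tau * w (i, j))"
      unfolding fsq_def R_def using Cab by simp
    also have "\<dots> = tau\<^sup>2 * G w"
      by (simp add: fsq_def G_def power_mult_distrib sum_distrib_left sum.cartesian_product')
    finally show ?thesis .
  qed
  have "(\<integral>w. ln (X w) \<partial>P) \<le> (\<integral>w. tau\<^sup>2 * G w - 1 \<partial>P)"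
  proof (rule integral_mono_AE[OF integrable_ln_residual[OF X]])
    show "integrable P (\<lambda>w. tau\<^sup>2 * G w - 1)" using integrable_G by simp
    show "AE w in P. ln (X w) \<le> tau\<^sup>2 * G w - 1"
      using residual_AE_pos[OF X]
    proof eventually_elim
      case (elim w)
      then show ?case using ln_le_minus_one[OF elim] le[of w] by linarith
    qed
  qed
  also have "\<dots> = tau\<^sup>2 * D - 1" using integrable_G by (simp add: expectation_G prob_space)
  also have "\<dots> = 0" using D4 by (simp add: tau_sq)
  finally have "2^(M+N) * (\<integral>w. ln (X w) \<partial>P) \<le> 0" by (intro mult_nonneg_nonpos) auto
  then show ?thesis unfolding E by (simp add: distrib_left)
qed

text \<open>The errors of \<open>expectation_ln_residual_ge\<close> apart from the loss in
  \<open>1 / n\<close>, written without the dimensions \<open>n\<close> and \<open>Q\<close>, so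
  that one quantity serves all wrong configurations.\<close>

definition err :: "real \<Rightarrow> real \<Rightarrow> real \<Rightarrow> real" where
  "err d s t = 4 / (1 + t) * (144 * s / sqrt (sqrt d) + 300 / sqrt d)
    + 8 * exp (- sqrt d) * (ln (1 + t) + ln (1 + 2 * s\<^sup>2) + 2 * d\<^sup>2) + 300 / d"

lemma EIC_wrong_ge:
  fixes lam sig kap :: real
  assumes cand: "(m, n) \<in> cands M N" and lam: "lam > 0" and sig: "sig > 0"
    and K: "fsq (2^M) (2^N) (kron (2^(M-m0)) (2^(N-n0)) A B) = 1"
    and ph: "specnorm (2^(m+n)) (2^(M+N-m-n)) (rearr M N m n (kron (2^(M-m0)) (2^(N-n0)) A B)) \<le> ph" "ph \<le> 1"
    and t: "t = (lam / sig)\<^sup>2 * (1 - ph\<^sup>2)" and d: "d = 2^(M+N)" "d \<ge> 256"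
    and small: "120 * (lam / sig) / sqrt (sqrt d) + 72 / sqrt (sqrt d) \<le> (1 + t) / 4"
    and kap: "kap \<ge> 2 * ln 2"
  shows "EIC M N m0 n0 lam sig A B kap m n \<ge> d * (ln (sig\<^sup>2) + ln (1 + t) - err d (lam / sig) t)"
proof -
  note c = cands_pow_ge[OF cand]
  define r c where "r = (2::nat)^(m+n)" and "c = (2::nat)^(M+N-m-n)"
  define C where "C = rearr M N m n (kron (2^(M-m0)) (2^(N-n0)) A B)"
  have fC: "fsq r c C = 1" using K c(1,2) by (simp add: r_def c_def C_def fsq_rearr del: diff_diff_left)
  have r2: "r \<ge> 2" and c2: "c \<ge> 2" using c by (simp_all add: r_def c_def)
  have rc: "real r * real c = d"
    using arg_cong[OF pow2_split(1)[OF c(1,2)], of real] by (simp add: d r_def c_def power_add)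
  have sp: "0 \<le> specnorm r c C" "specnorm r c C \<le> ph"
    using specnorm_nonneg[of c r C] c2 ph by (simp_all add: r_def c_def C_def)
  have sp2: "(specnorm r c C)\<^sup>2 \<le> ph\<^sup>2" using sp by (intro power_mono) auto
  have ph21: "ph\<^sup>2 \<le> 1" using sp ph(2) by (simp add: power_le_one)
  have bij: "bij_betw (pos M N m n) ({..<r} \<times> {..<c}) ({..<2^M} \<times> {..<2^N})"
    unfolding r_def c_def by (rule bij_betw_pos[OF c(1,2)])
  have s0: "lam / sig > 0" using lam sig by simp
  \<comment> \<open>In both uses \<open>d / k\<close> is the longer side of the matrix, so the loss
    \<open>d * (2 * ln 2 / k)\<close> is at most \<open>2 * ln 2 * (r + c)\<close>, which the
    penalty covers.\<close>
  have fin: "d * (ln (sig\<^sup>2) + ln (1 + t) - err d (lam / sig) t) \<le> d * (ln (sig\<^sup>2) + I) + kap * (2^(m+n) + 2^(M+N-m-n))"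
    if I: "I \<ge> ln (1 + t) - 2 * ln 2 / k - err d (lam / sig) t" and k: "k > 0" "d / k \<le> real r + real c" for I k
  proof -
    have "d * (ln (sig\<^sup>2) + I) \<ge> d * (ln (sig\<^sup>2) + (ln (1 + t) - 2 * ln 2 / k - err d (lam / sig) t))"
      using I d by (intro mult_left_mono) auto
    moreover have "d * (2 * ln 2 / k) \<le> kap * (real r + real c)"
    proof -
      have "d * (2 * ln 2 / k) = 2 * ln 2 * (d / k)" by simp
      also have "\<dots> \<le> kap * (real r + real c)"
        using kap k d by (intro mult_mono) (auto intro: order_trans[of 0 "2 * ln 2"])
      finally show ?thesis .
    qed
    ultimately show ?thesis by (simp add: algebra_simps r_def c_def)
  qed
  show ?thesis
  proof (cases "r \<le> c")
    case True
    interpret spiked_wide r c "lam / sig" C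
      by standard (use r2 c2 fC True s0 rc d in auto)
    have D: "D = d" by (simp add: D_def rc)
    define X where "X w = resid r c (R w)" for w
    have X: "rank_one_residual X"
      unfolding rank_one_residual_def
    proof (intro conjI allI)
      show "X \<in> borel_measurable P"
        unfolding X_def by (intro borel_measurable_resid measurable_R) (use Q2 in auto)
      fix w
      obtain u v where "leading_sv r c (R w) u v"
        using leading_sv_exists[of r c "R w"] n2 Q2 by auto
      from leading_sv_mvec(1,4)[OF this]
      show "\<exists>u. nsq r u = 1 \<and> X w = fsq r c (R w) - nsq c (mvec c r (trp (R w)) u)"
        by (auto simp: X_def resid_def)
    qed
    have E: "EIC M N m0 n0 lam sig A B kap m n
      = 2^(M+N) * (ln (sig\<^sup>2) + (\<integral>w. ln (X w) \<partial>P)) + kap * (2^(m+n) + 2^(M+N-m-n))"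
    proof (rule EIC_eq[OF c(1,2) sig])
      show "inj_on (pos M N m n) ({..<r} \<times> {..<c})" "pos M N m n \<in> ({..<r} \<times> {..<c}) \<rightarrow> {..<2^M} \<times> {..<2^N}"
        using bij by (auto simp: bij_betw_def)
      show "X \<in> borel_measurable P" using X by (simp add: rank_one_residual_def)
      show "AE w in P. X w > 0" by (rule residual_AE_pos[OF X])
      show "integrable P (\<lambda>w. ln (X w))" by (rule integrable_ln_residual[OF X])
      show "resid (2^(m+n)) (2^(M+N-m-n)) (rearr M N m n (Ymod M N m0 n0 lam sig A B E))
        = sig\<^sup>2 * X (\<lambda>p\<in>{..<r} \<times> {..<c}. E (pos M N m n p))" for E
        unfolding resid_Ymod[OF sig] X_def unfolding r_def[symmetric] c_def[symmetric]
        by (intro arg_cong2[where f = "(*)"] refl resid_cong) (simp add: R_def tau_def D d flip: C_def)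
    qed
    have "nsq c (cu u) \<le> ph\<^sup>2" if "nsq r u = 1" for u
      using nsq_mvec_trp_le_specnorm[of c r C u] c2 sp2 that by (simp add: cu_def)
    then have "(\<integral>w. ln (X w) \<partial>P) \<ge> ln (1 + t) - 2 * ln 2 / r - err d (lam / sig) t"
      using expectation_ln_residual_ge[OF X _ ph21] small
      by (simp add: t[symmetric] q4_def rt_def D err_def)
    moreover have "d / real r \<le> real r + real c" using r2 by (simp add: rc[symmetric])
    ultimately show ?thesis unfolding E d(1)[symmetric] using r2 by (intro fin) auto
  next
    case False
    \<comment> \<open>With more rows than columns the transpose is analysed, so that the net again
      lives in the smaller dimension; the relabelling of the noise then includes a swap of the index
      pair.\<close>
    interpret spiked_wide c r "lam / sig" "trp C"
      by standard (use r2 c2 fC False s0 rc d in \<open>auto simp: fsq_trp mult.commute\<close>)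
    have D: "D = d" using rc by (simp add: D_def mult.commute)
    define X where "X w = resid r c (trp (R w))" for w
    have X: "rank_one_residual X"
      unfolding rank_one_residual_def
    proof (intro conjI allI)
      show "X \<in> borel_measurable P"
        unfolding X_def
      proof (rule borel_measurable_resid)
        show "c > 0" using n2 by simp
        show "(\<lambda>w. trp (R w) i j) \<in> borel_measurable P" if "i < r" "j < c" for i j
          unfolding trp_apply[of "R _"] by (rule measurable_R[OF that(2,1)])
      qed
      fix w
      obtain u v where "leading_sv r c (trp (R w)) u v"
        using leading_sv_exists[of r c "trp (R w)"] n2 Q2 by auto
      from leading_sv_mvec(2,3)[OF this]
      show "\<exists>u. nsq c u = 1 \<and> X w = fsq c r (R w) - nsq r (mvec r c (trp (R w)) u)"
        by (auto simp: X_def resid_def fsq_trp)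
    qed
    have E: "EIC M N m0 n0 lam sig A B kap m n
      = 2^(M+N) * (ln (sig\<^sup>2) + (\<integral>w. ln (X w) \<partial>P)) + kap * (2^(m+n) + 2^(M+N-m-n))"
    proof (rule EIC_eq[OF c(1,2) sig])
      show "inj_on (pos M N m n \<circ> prod.swap) ({..<c} \<times> {..<r})"
        "pos M N m n \<circ> prod.swap \<in> ({..<c} \<times> {..<r}) \<rightarrow> {..<2^M} \<times> {..<2^N}"
        using bij_betwE[OF bij] bij by (auto simp: bij_betw_def inj_on_def)
      show "X \<in> borel_measurable P" using X by (simp add: rank_one_residual_def)
      show "AE w in P. X w > 0" by (rule residual_AE_pos[OF X])
      show "integrable P (\<lambda>w. ln (X w))" by (rule integrable_ln_residual[OF X])
      show "resid (2^(m+n)) (2^(M+N-m-n)) (rearr M N m n (Ymod M N m0 n0 lam sig A B E))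
        = sig\<^sup>2 * X (\<lambda>p\<in>{..<c} \<times> {..<r}. E ((pos M N m n \<circ> prod.swap) p))" for E
        unfolding resid_Ymod[OF sig] X_def unfolding r_def[symmetric] c_def[symmetric]
        by (intro arg_cong2[where f = "(*)"] refl resid_cong) (simp add: R_def trp_apply tau_def D d flip: C_def)
    qed
    have "nsq r (cu u) \<le> ph\<^sup>2" if "nsq c u = 1" for u
      using nsq_mvec_le_specnorm[of c r C u] c2 sp2 that by (simp add: cu_def)
    then have "(\<integral>w. ln (X w) \<partial>P) \<ge> ln (1 + t) - 2 * ln 2 / c - err d (lam / sig) t"
      using expectation_ln_residual_ge[OF X _ ph21] small
      by (simp add: t[symmetric] q4_def rt_def D err_def)
    moreover have "d / real c \<le> real r + real c" using c2 by (simp add: rc[symmetric])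
    ultimately show ?thesis unfolding E d(1)[symmetric] using c2 by (intro fin) auto
  qed
qed

text \<open>Every rearrangement has Frobenius norm 1, so all the spectral norms lie between 0 and 1,
  and the root in \<open>psi_gap\<close> is taken of a nonnegative number.\<close>

lemma phi_gap_bounds:
  fixes A B :: "nat \<Rightarrow> nat \<Rightarrow> real"
  assumes mn: "m0 \<le> M" "n0 \<le> N" and ne: "cands M N - {(m0, n0)} \<noteq> {}"
    and A: "frob (2^m0) (2^n0) A = 1" and B: "frob (2^(M-m0)) (2^(N-n0)) B = 1"
  defines "K \<equiv> kron (2^(M-m0)) (2^(N-n0)) A B"
  shows "phi_gap M N m0 n0 A B \<le> 1" "0 \<le> phi_gap M N m0 n0 A B"
    and "\<And>m n. (m, n) \<in> cands M N - {(m0, n0)} \<Longrightarrow>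
      specnorm (2^(m+n)) (2^(M+N-m-n)) (rearr M N m n K) \<le> phi_gap M N m0 n0 A B"
    and "(psi_gap M N m0 n0 A B)\<^sup>2 = 1 - (phi_gap M N m0 n0 A B)\<^sup>2"
proof -
  define S where "S = (\<lambda>(m,n). specnorm (2^(m+n)) (2^(M+N-m-n)) (rearr M N m n K)) ` (cands M N - {(m0,n0)})"
  have phi: "phi_gap M N m0 n0 A B = Max S" by (simp add: phi_gap_def S_def K_def)
  have finS: "finite S" and neS: "S \<noteq> {}" using ne by (auto simp: S_def cands_def)
  have S01: "0 \<le> x \<and> x \<le> 1" if xS: "x \<in> S" for x
  proof -
    obtain m n where x: "x = specnorm (2^(m+n)) (2^(M+N-m-n)) (rearr M N m n K)" and "(m, n) \<in> cands M N"
      using xS unfolding S_def by (auto simp del: diff_diff_left)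
    then have "m \<le> M" "n \<le> N" by (auto simp: cands_def)
    then have "fsq (2^(m+n)) (2^(M+N-m-n)) (rearr M N m n K) = 1"
      using fsq_kron(1)[OF mn A B] by (simp add: fsq_rearr K_def del: diff_diff_left)
    then have "x\<^sup>2 \<le> 1" using specnorm_sq_le_fsq[of "2^(M+N-m-n)" "2^(m+n)" "rearr M N m n K"] x by simp
    moreover have "0 \<le> x" unfolding x by (rule specnorm_nonneg) simp
    ultimately show ?thesis by (simp add: abs_square_le_1)
  qed
  show le1: "phi_gap M N m0 n0 A B \<le> 1" unfolding phi using finS neS S01 by simp
  obtain x where "x \<in> S" using neS by blast
  then show ge0: "0 \<le> phi_gap M N m0 n0 A B"
    unfolding phi using finS S01[of x] Max_ge[of S x] by linarith
  show "specnorm (2^(m+n)) (2^(M+N-m-n)) (rearr M N m n K) \<le> phi_gap M N m0 n0 A B"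
    if "(m, n) \<in> cands M N - {(m0, n0)}" for m n
    unfolding phi using finS that by (intro Max_ge) (auto simp: S_def)
  have "(phi_gap M N m0 n0 A B)\<^sup>2 \<le> 1" using le1 ge0 by (simp add: power_le_one)
  then show "(psi_gap M N m0 n0 A B)\<^sup>2 = 1 - (phi_gap M N m0 n0 A B)\<^sup>2"
    by (simp add: psi_gap_def)
qed

text \<open>Here \<open>e = 1 / (d\<^bsup>1/4\<^esup> s \<psi>\<^sup>2)\<close> is the reciprocal of the quantity that the second
  signal-to-noise condition sends to infinity.\<close>

lemma err_le:
  fixes d s p t e :: real
  assumes d: "d \<ge> 1" and s: "s > 0" and p: "0 < p" "p \<le> 1" and t: "t = s\<^sup>2 * p"
    and e: "e = 1 / (sqrt (sqrt d) * s * p)" "e \<le> 1"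
  shows "err d s t \<le> (576 * e + 4480776 * e\<^sup>2 + 5600000 * (1 / d)) * ln (1 + t)"
proof -
  define q where "q = sqrt (sqrt d)"
  define l where "l = ln (1 + t)"
  have q: "q \<ge> 1" "q\<^sup>2 = sqrt d" "q ^ 4 = d"
  proof -
    show "q \<ge> 1" using d by (simp add: q_def)
    show 2: "q\<^sup>2 = sqrt d" using d by (simp add: q_def)
    have "q ^ 4 = (q\<^sup>2)\<^sup>2" by (simp add: power_mult[symmetric])
    then show "q ^ 4 = d" using d 2 by simp
  qed
  have e0: "e > 0" using q s p by (simp add: e q_def[symmetric])
  have t0: "t > 0" using s p by (simp add: t)
  \<comment> \<open>The two noise errors \<open>s / q\<close> and \<open>1 / sqrt d\<close> turn
    into multiples of \<open>t\<close>, with factors \<open>e\<close> and at most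
    \<open>e^2\<close>.\<close>
  have sq: "s / q = e * t"
    using q s p by (simp add: e q_def[symmetric] t power2_eq_square)
  have iq: "1 / sqrt d \<le> e\<^sup>2 * t"
  proof -
    have "1 / sqrt d = e\<^sup>2 * t * p"
      using q s p unfolding q(2)[symmetric] by (simp add: e q_def[symmetric] t power2_eq_square)
    also have "\<dots> \<le> e\<^sup>2 * t * 1" using p t0 by (intro mult_left_mono) auto
    finally show ?thesis by simp
  qed
  have lt: "t / (1 + t) \<le> l"
  proof -
    have "ln (1 / (1 + t)) \<le> 1 / (1 + t) - 1" using t0 by (intro ln_le_minus_one) auto
    moreover have "1 / (1 + t) - 1 = - (t / (1 + t))" using t0 by (simp add: field_simps)
    moreover have "ln (1 / (1 + t)) = - l" using t0 by (simp add: ln_div l_def)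
    ultimately show ?thesis by linarith
  qed
  have l0: "l \<ge> 0" using t0 by (simp add: l_def)
  \<comment> \<open>The error \<open>1 / d\<close> carries no factor \<open>t\<close>. For
    \<open>t \<le> 1\<close> it is at most \<open>1 / sqrt d \<le> e^2 * t\<close>; for larger
    \<open>t\<close> the logarithm \<open>l\<close> is at least 1/2.\<close>
  have id: "1 / d \<le> 2 * (e\<^sup>2 + 1 / d) * l"
  proof (cases "t \<le> 1")
    case True
    have "t / 2 \<le> t / (1 + t)" using t0 True by (intro divide_left_mono) auto
    then have tl: "t \<le> 2 * l" using lt by linarith
    have "sqrt d \<le> d" using d by (simp add: sqrt_le_D real_le_lsqrt power2_eq_square)
    then have "1 / d \<le> 1 / sqrt d" using d by (intro divide_left_mono) auto
    also have "\<dots> \<le> e\<^sup>2 * t" by (rule iq)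
    also have "\<dots> \<le> e\<^sup>2 * (2 * l)" using tl by (intro mult_left_mono) auto
    also have "\<dots> \<le> 2 * (e\<^sup>2 + 1 / d) * l" using l0 d by (simp add: algebra_simps)
    finally show ?thesis .
  next
    case False
    have "1 / 2 \<le> t / (1 + t)" using False by (simp add: field_simps)
    then have "1 \<le> 2 * l" using lt by linarith
    then have "1 / d * 1 \<le> 1 / d * (2 * l)" using d by (intro mult_left_mono) auto
    also have "\<dots> \<le> 2 * (e\<^sup>2 + 1 / d) * l" using l0 d by (simp add: algebra_simps)
    finally show ?thesis by simp
  qed
  have T1: "4 / (1 + t) * (144 * s / q + 300 / sqrt d) \<le> (576 * e + 1200 * e\<^sup>2) * l"
  proof -
    have "144 * s / q + 300 / sqrt d = 144 * (s / q) + 300 * (1 / sqrt d)" by simp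
    also have "\<dots> \<le> 144 * (e * t) + 300 * (e\<^sup>2 * t)" using iq unfolding sq by simp
    also have "\<dots> = (144 * e + 300 * e\<^sup>2) * t" by (simp add: algebra_simps)
    finally have "4 / (1 + t) * (144 * s / q + 300 / sqrt d) \<le> 4 / (1 + t) * ((144 * e + 300 * e\<^sup>2) * t)"
      using t0 by (intro mult_left_mono) auto
    also have "\<dots> = (576 * e + 1200 * e\<^sup>2) * (t / (1 + t))" using t0 by (simp add: field_simps)
    also have "\<dots> \<le> (576 * e + 1200 * e\<^sup>2) * l" using e0 by (intro mult_left_mono lt) auto
    finally show ?thesis .
  qed
  \<comment> \<open>\<open>exp x \<ge> (x / 6)^6\<close> at \<open>x = sqrt d\<close>, with
    \<open>6^6 = 46656\<close>. The cube of \<open>d\<close> beats the \<open>d^2\<close> that this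
    factor multiplies.\<close>
  have ex: "exp (- sqrt d) \<le> 46656 / d ^ 3"
  proof -
    have "(sqrt d / 6) ^ 6 \<le> exp (sqrt d / 6) ^ 6"
    proof (rule power_mono)
      show "sqrt d / 6 \<le> exp (sqrt d / 6)" using exp_ge_add_one_self[of "sqrt d / 6"] by linarith
    qed (use d in simp)
    moreover have "exp (sqrt d / 6) ^ 6 = exp (sqrt d)" using exp_of_nat2_mult[of "sqrt d / 6" 6] by simp
    moreover have "sqrt d ^ 6 = d ^ 3"
    proof -
      have "sqrt d ^ 6 = (sqrt d ^ 2) ^ 3" by (simp only: power_mult[symmetric]) simp
      then show ?thesis using d by simp
    qed
    ultimately have "d ^ 3 / 46656 \<le> exp (sqrt d)" by (simp add: power_divide)
    then show ?thesis using d by (simp add: exp_minus field_simps)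
  qed
  \<comment> \<open>\<open>s\<close> may be huge when \<open>p\<close> is small, but
    \<open>e \<le> 1\<close> gives \<open>s \<le> q * t\<close>, so its logarithm is controlled by
    \<open>l\<close> and a power of \<open>d\<close>.\<close>
  have lns: "ln (1 + 2 * s\<^sup>2) \<le> 4 * d\<^sup>2 + 2 * l"
  proof -
    have "s = q * (e * t)" using sq q by (simp add: field_simps)
    also have "\<dots> \<le> q * (1 * t)" using e e0 t0 q by (intro mult_left_mono mult_right_mono) auto
    finally have "s \<le> q * t" by simp
    then have "1 + 2 * s \<le> 2 * q * (1 + t)" using q t0 by (simp add: algebra_simps)
    then have "ln (1 + 2 * s) \<le> ln (2 * q * (1 + t))" using s by (intro ln_mono) auto
    also have "\<dots> = ln (2 * q) + l" unfolding l_def using q t0 by (intro ln_mult_pos) auto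
    also have "ln (2 * q) \<le> 2 * q" using q by (intro ln_bound) auto
    also have "2 * q \<le> 2 * d\<^sup>2"
    proof -
      have "q ^ 1 \<le> q ^ 8" using q by (intro power_increasing) auto
      also have "q ^ 8 = d\<^sup>2" unfolding q(3)[symmetric] by (simp add: power_mult[symmetric])
      finally show ?thesis by simp
    qed
    finally have "ln (1 + 2 * s) \<le> 2 * d\<^sup>2 + l" by simp
    moreover have "ln (1 + 2 * s\<^sup>2) \<le> ln ((1 + 2 * s)\<^sup>2)"
    proof (intro ln_mono)
      show "1 + 2 * s\<^sup>2 \<le> (1 + 2 * s)\<^sup>2" using s by (simp add: power2_sum power_mult_distrib)
      show "0 < 1 + 2 * s\<^sup>2" by (simp add: add_pos_nonneg)
    qed
    moreover have "ln ((1 + 2 * s)\<^sup>2) = 2 * ln (1 + 2 * s)" using s by (simp add: ln_realpow)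
    ultimately show ?thesis by linarith
  qed
  have T2: "8 * exp (- sqrt d) * (l + ln (1 + 2 * s\<^sup>2) + 2 * d\<^sup>2) \<le> 1119744 * (1 / d) * l + 2239488 * (1 / d)"
  proof -
    have "8 * exp (- sqrt d) * (l + ln (1 + 2 * s\<^sup>2) + 2 * d\<^sup>2) \<le> 8 * (46656 / d ^ 3) * (3 * l + 6 * d\<^sup>2)"
      using ex lns l0 d by (intro mult_mono) auto
    also have "\<dots> = 1119744 * (1 / d ^ 3) * l + 2239488 * (1 / d)"
      using d by (simp add: field_simps power2_eq_square power3_eq_cube)
    also have "1119744 * (1 / d ^ 3) * l \<le> 1119744 * (1 / d) * l"
    proof -
      have "d ^ 1 \<le> d ^ 3" using d by (intro power_increasing) auto
      then have "1 / d ^ 3 \<le> 1 / d" using d by (intro divide_left_mono) auto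
      then show ?thesis using l0 by (intro mult_right_mono mult_left_mono) auto
    qed
    finally show ?thesis by simp
  qed
  have "err d s t \<le> (576 * e + 1200 * e\<^sup>2) * l + 1119744 * (1 / d) * l + 2239788 * (1 / d)"
    using T1 T2 unfolding err_def q_def l_def by simp
  \<comment> \<open>2239788 collects 2239488 from \<open>T2\<close> and the term
    \<open>300 / d\<close> of \<open>err\<close>. Doubled by \<open>id\<close>, it gives 4480776
    after adding 1200, and 5599320 after adding 1119744.\<close>
  also have "2239788 * (1 / d) \<le> 2239788 * (2 * (e\<^sup>2 + 1 / d) * l)" using id by (intro mult_left_mono) auto
  also have "(576 * e + 1200 * e\<^sup>2) * l + 1119744 * (1 / d) * l + 2239788 * (2 * (e\<^sup>2 + 1 / d) * l)
     = (576 * e + 4480776 * e\<^sup>2 + 5599320 * (1 / d)) * l"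
    by (simp add: algebra_simps)
  also have "\<dots> \<le> (576 * e + 4480776 * e\<^sup>2 + 5600000 * (1 / d)) * l"
    using l0 d e0 by (intro mult_right_mono add_mono) auto
  finally show ?thesis by (simp add: l_def)
qed

section \<open>Passage to the limit along the sequence\<close>

lemma sqrt_sqrt_eq_powr: "sqrt (sqrt (2 ^ k)) = 2 powr (real k / 4)"
  by (simp add: powr_half_sqrt[symmetric] powr_realpow[symmetric] powr_powr)

text \<open>For all large \<open>k\<close> the normalised gap is at least
  \<open>1 - \<delta> k - kap k * S k / L k\<close>. The first error vanishes by the growth of
  \<open>d\<close> and the second signal-to-noise condition, the second by the upper bound on the
  penalty. The \<open>max\<close> keeps only the shortfall below 1, since the gap may be arbitrarily
  large.\<close>

theorem theorem2:
  fixes M N m0 n0 :: "nat \<Rightarrow> nat"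
    and lam sig kap :: "nat \<Rightarrow> real"
    and A B :: "nat \<Rightarrow> nat \<Rightarrow> nat \<Rightarrow> real"
  defines "W \<equiv> (\<lambda>k. cands (M k) (N k) - {(m0 k, n0 k)})"
    and "L \<equiv> (\<lambda>k. 2 ^ (M k + N k) * ln (1 + (lam k / sig k)\<^sup>2 * (psi_gap (M k) (N k) (m0 k) (n0 k) (A k) (B k))\<^sup>2))"
    and "EI \<equiv> (\<lambda>k m n. EIC (M k) (N k) (m0 k) (n0 k) (lam k) (sig k) (A k) (B k) (kap k) m n)"
  assumes dims: "\<And>k. m0 k \<le> M k \<and> n0 k \<le> N k"
    and lam_pos: "\<And>k. lam k > 0"
    and sig_pos: "\<And>k. sig k > 0"
    and A_norm: "\<And>k. frob (2 ^ m0 k) (2 ^ n0 k) (A k) = 1"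
    and B_norm: "\<And>k. frob (2 ^ (M k - m0 k)) (2 ^ (N k - n0 k)) (B k) = 1"
    and MN_inf: "filterlim (\<lambda>k. M k + N k) at_top sequentially"
    and A1a: "filterlim (\<lambda>k. real (m0 k + n0 k) / ln (ln (real (M k * N k)))) at_top sequentially"
    and A1b: "filterlim (\<lambda>k. real ((M k - m0 k) + (N k - n0 k)) / ln (ln (real (M k * N k))))
                at_top sequentially"
    and A3a: "filterlim (\<lambda>k. 2 powr (real (M k + N k) / 2)
                   / (2 powr (real (m0 k + n0 k) / 2) + 2 powr (real ((M k - m0 k) + (N k - n0 k)) / 2))
                   * (lam k / sig k) * psi_gap (M k) (N k) (m0 k) (n0 k) (A k) (B k)) at_top sequentially"
    and A3b: "filterlim (\<lambda>k. 2 powr (real (M k + N k) / 4) * (lam k / sig k) * (psi_gap (M k) (N k) (m0 k) (n0 k) (A k) (B k))\<^sup>2)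
                at_top sequentially"
    and kap_lb: "\<And>k. kap k \<ge> 2 * ln 2"
    and kap_o: "kap \<in> o(\<lambda>k. 2 ^ (M k + N k) * ln (1 + (lam k / sig k)\<^sup>2 * (psi_gap (M k) (N k) (m0 k) (n0 k) (A k) (B k))\<^sup>2)
                     / (2 ^ (m0 k + n0 k) + 2 ^ ((M k - m0 k) + (N k - n0 k))))"
  shows "(\<lambda>k. max (- ((Min ((\<lambda>(m,n). EI k m n) ` W k) - EI k (m0 k) (n0 k)) / L k - 1)) 0)
           \<longlonglongrightarrow> 0"
proof -
  define s where "s k = lam k / sig k" for k
  define ph where "ph k = phi_gap (M k) (N k) (m0 k) (n0 k) (A k) (B k)" for k
  define p where "p k = (psi_gap (M k) (N k) (m0 k) (n0 k) (A k) (B k))\<^sup>2" for k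
  define d :: "nat \<Rightarrow> real" where "d k = 2 ^ (M k + N k)" for k
  define q where "q k = sqrt (sqrt (d k))" for k
  define t where "t k = (s k)\<^sup>2 * p k" for k
  define e where "e k = 1 / (q k * s k * p k)" for k
  define S :: "nat \<Rightarrow> real" where "S k = 2 ^ (m0 k + n0 k) + 2 ^ ((M k - m0 k) + (N k - n0 k))" for k
  define \<delta> where "\<delta> k = 576 * e k + 4480776 * (e k)\<^sup>2 + 5600000 * (1 / d k)" for k
  have Lk: "L k = d k * ln (1 + t k)" for k by (simp add: L_def d_def t_def s_def p_def)
  have s0: "s k > 0" for k using lam_pos sig_pos by (simp add: s_def)

  have d_top: "filterlim d at_top sequentially"
  proof -
    have "filterlim (\<lambda>n. (2::real) ^ n) at_top sequentially" 
      by (rule filterlim_at_infinity_imp_filterlim_at_top[OF filterlim_realpow_sequentially_gt1]) auto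
    from filterlim_compose[OF this MN_inf] show ?thesis by (simp add: d_def[abs_def])
  qed
  have q_top: "filterlim q at_top sequentially"
    unfolding q_def by (intro filterlim_compose[OF sqrt_at_top] d_top)
  have qsp_top: "filterlim (\<lambda>k. q k * s k * p k) at_top sequentially"
    using A3b by (simp add: q_def d_def s_def p_def sqrt_sqrt_eq_powr)
  have e_lim: "e \<longlonglongrightarrow> 0"
    unfolding e_def using tendsto_divide_0[OF tendsto_const filterlim_at_top_imp_at_infinity[OF qsp_top]] by blast
  have d_lim: "(\<lambda>k. 1 / d k) \<longlonglongrightarrow> 0"
    using tendsto_divide_0[OF tendsto_const filterlim_at_top_imp_at_infinity[OF d_top]] by blast
  have \<delta>_lim: "\<delta> \<longlonglongrightarrow> 0"
  proof -
    have "\<delta> \<longlonglongrightarrow> 576 * 0 + 4480776 * 0\<^sup>2 + 5600000 * 0"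
      unfolding \<delta>_def by (intro tendsto_intros e_lim d_lim)
    then show ?thesis by simp
  qed
  have kap_lim: "(\<lambda>k. kap k * S k / L k) \<longlonglongrightarrow> 0"
  proof -
    have "(\<lambda>k. kap k / (L k / S k)) \<longlonglongrightarrow> 0"
      using smalloD_tendsto[OF kap_o] by (simp add: L_def S_def)
    then show ?thesis by (simp add: field_simps)
  qed

  \<comment> \<open>The thresholds 960 and 576 bound the two parts of \<open>small\<close> by
    \<open>t / 8\<close> and 1/8; 256 is the size required by \<open>spiked_wide\<close>.\<close>
  have ev: "\<forall>\<^sub>F k in sequentially. max (- ((Min ((\<lambda>(m,n). EI k m n) ` W k) - EI k (m0 k) (n0 k)) / L k - 1)) 0
      \<le> \<bar>\<delta> k\<bar> + \<bar>kap k * S k / L k\<bar>"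
    using filterlim_at_top_dense[THEN iffD1, OF A1a, rule_format, of 0]
      filterlim_at_top_dense[THEN iffD1, OF A1b, rule_format, of 0]
      filterlim_at_top_dense[THEN iffD1, OF qsp_top, rule_format, of 960]
      filterlim_at_top_dense[THEN iffD1, OF q_top, rule_format, of 576]
      filterlim_at_top_dense[THEN iffD1, OF d_top, rule_format, of 256]
  proof eventually_elim
    case (elim k)
    have mn: "m0 k \<le> M k" "n0 k \<le> N k" using dims by auto
    \<comment> \<open>A quotient above 0 has a nonzero numerator; this keeps the true configuration
      off the two excluded corners.\<close>
    have "m0 k + n0 k \<noteq> 0" "(M k - m0 k) + (N k - n0 k) \<noteq> 0"
      using elim(1,2) by (metis div_0 less_irrefl of_nat_0)+
    then have cand0: "(m0 k, n0 k) \<in> cands (M k) (N k)"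
      using mn by (auto simp: cands_def)
    have MN: "M k + N k > 8"
    proof (rule ccontr)
      assume "\<not> M k + N k > 8"
      then have "d k \<le> 2 ^ 8" unfolding d_def by (intro power_increasing) auto
      then show False using elim(5) by simp
    qed
    \<comment> \<open>At most three grid points are removed, while \<open>M k + N k > 8\<close>
      provides at least ten.\<close>
    have Wne: "W k \<noteq> {}"
    proof
      assume "W k = {}"
      then have "{0..M k} \<times> {0..N k} \<subseteq> {(0,0), (M k, N k), (m0 k, n0 k)}" by (auto simp: W_def cands_def)
      then have "card ({0..M k} \<times> {0..N k}) \<le> card {(0,0), (M k, N k), (m0 k, n0 k)}"
        by (intro card_mono) auto
      also have "\<dots> \<le> 3" by (simp add: card_insert_if)
      finally have "Suc (M k) * Suc (N k) \<le> 3" by (simp add: card_cartesian_product)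
      then show False using MN by auto
    qed
    note phi = phi_gap_bounds[OF mn Wne[unfolded W_def] A_norm B_norm, folded ph_def]
    have p_eq: "p k = 1 - (ph k)\<^sup>2" using phi(4) by (simp add: p_def ph_def)
    have p1: "p k \<le> 1" by (simp add: p_eq)
    \<comment> \<open>\<open>p k = 0\<close> would annihilate the product that exceeds 960.\<close>
    have p0: "p k > 0"
    proof (rule ccontr)
      assume "\<not> p k > 0"
      then have "p k = 0" by (simp add: p_def)
      then show False using elim(3) by simp
    qed
    have d: "d k \<ge> 256" "d k = 2 ^ (M k + N k)" using elim(5) by (simp_all add: d_def)
    have q0: "q k > 0" using elim(4) by simp
    have t0: "t k > 0" using s0[of k] p0 by (simp add: t_def)
    have ln0: "ln (1 + t k) > 0" using t0 by simp
    have L0: "L k > 0" using d ln0 by (simp add: Lk)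
    have e1: "e k \<le> 1 / 960" "e k > 0"
    proof -
      have "1 / (q k * s k * p k) \<le> 1 / 960" using elim(3) by (intro divide_left_mono) auto
      then show "e k \<le> 1 / 960" by (simp add: e_def)
      show "e k > 0" using q0 s0 p0 by (simp add: e_def)
    qed
    have err: "err (d k) (s k) (t k) \<le> \<delta> k * ln (1 + t k)"
      unfolding \<delta>_def
      by (rule err_le[where p = "p k"]) (use d s0 p0 p1 e1 in \<open>auto simp: t_def e_def q_def\<close>)
    have small: "120 * s k / q k + 72 / q k \<le> (1 + t k) / 4"
    proof -
      have "s k / q k = e k * t k"
        using q0 s0[of k] p0 by (simp add: e_def t_def power2_eq_square)
      then have "120 * s k / q k = 120 * (e k * t k)" by simp
      also have "\<dots> \<le> 120 * (1 / 960 * t k)" using e1 t0 by (intro mult_left_mono mult_right_mono) auto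
      finally have "120 * s k / q k \<le> t k / 8" by simp
      moreover have "72 / q k \<le> 1 / 8" using elim(4) by (simp add: field_simps)
      moreover have "(1 + t k) / 4 = 1 / 4 + t k / 4" by (simp add: add_divide_distrib)
      ultimately show ?thesis using t0 by linarith
    qed
    have lower: "d k * (ln ((sig k)\<^sup>2) + ln (1 + t k) - \<delta> k * ln (1 + t k)) \<le> EI k m n" if "(m, n) \<in> W k" for m n
    proof -
      have c: "(m, n) \<in> cands (M k) (N k)" using that by (simp add: W_def)
      have "d k * (ln ((sig k)\<^sup>2) + ln (1 + t k) - err (d k) (lam k / sig k) (t k)) \<le> EI k m n"
        unfolding EI_def
      proof (rule EIC_wrong_ge[where ph = "ph k", OF c lam_pos sig_pos _ _ phi(1) _ d(2) d(1) _ kap_lb])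
        show "fsq (2 ^ M k) (2 ^ N k) (kron (2 ^ (M k - m0 k)) (2 ^ (N k - n0 k)) (A k) (B k)) = 1"
          by (rule fsq_kron(1)[OF mn A_norm B_norm])
        show "specnorm (2 ^ (m + n)) (2 ^ (M k + N k - m - n)) (rearr (M k) (N k) m n
            (kron (2 ^ (M k - m0 k)) (2 ^ (N k - n0 k)) (A k) (B k))) \<le> ph k"
          using phi(3) that by (simp add: W_def)
        show "t k = (lam k / sig k)\<^sup>2 * (1 - (ph k)\<^sup>2)" by (simp add: t_def s_def p_eq)
        show "120 * (lam k / sig k) / sqrt (sqrt (d k)) + 72 / sqrt (sqrt (d k)) \<le> (1 + t k) / 4"
          using small by (simp add: s_def q_def)
      qed
      moreover have "d k * (ln ((sig k)\<^sup>2) + ln (1 + t k) - \<delta> k * ln (1 + t k))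
          \<le> d k * (ln ((sig k)\<^sup>2) + ln (1 + t k) - err (d k) (lam k / sig k) (t k))"
        using err d by (intro mult_left_mono) (auto simp: s_def)
      ultimately show ?thesis by linarith
    qed
    have finW: "finite (W k)" by (simp add: W_def cands_def)
    have "d k * (ln ((sig k)\<^sup>2) + ln (1 + t k) - \<delta> k * ln (1 + t k)) \<le> Min ((\<lambda>(m,n). EI k m n) ` W k)"
      using finW Wne lower by (subst Min_ge_iff) auto
    moreover have "EI k (m0 k) (n0 k) \<le> d k * ln ((sig k)\<^sup>2) + kap k * S k"
    proof -
      have "M k + N k - m0 k - n0 k = (M k - m0 k) + (N k - n0 k)" using mn by simp
      then show ?thesis
        using EIC_true_le[OF cand0 lam_pos[of k] sig_pos[of k] A_norm B_norm, where kap = "kap k"] by (simp only: EI_def d_def S_def)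
    qed
    ultimately have "L k - \<delta> k * L k - kap k * S k \<le> Min ((\<lambda>(m,n). EI k m n) ` W k) - EI k (m0 k) (n0 k)"
      unfolding Lk by (simp add: algebra_simps)
    then have "(L k - \<delta> k * L k - kap k * S k) / L k \<le> (Min ((\<lambda>(m,n). EI k m n) ` W k) - EI k (m0 k) (n0 k)) / L k"
      using L0 by (intro divide_right_mono) auto
    moreover have "(L k - \<delta> k * L k - kap k * S k) / L k = 1 - \<delta> k - kap k * S k / L k"
      using L0 by (simp add: diff_divide_distrib)
    moreover have "max (- (y - 1)) 0 \<le> \<bar>a\<bar> + \<bar>b\<bar>" if "1 - a - b \<le> y" for a b y :: real
      using that by (intro max.boundedI) auto
    ultimately show ?case by (simp only:)
  qed
  show ?thesis
  proof (rule tendsto_sandwich[OF _ ev tendsto_const])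
    show "(\<lambda>k. \<bar>\<delta> k\<bar> + \<bar>kap k * S k / L k\<bar>) \<longlonglongrightarrow> 0"
      using tendsto_add[OF tendsto_rabs[OF \<delta>_lim] tendsto_rabs[OF kap_lim]] by simp
  qed simp
qed

end
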